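(* The integral $q$-Schur algebra $\mathbf{S}_{\mathcal{A}}(n,d)$ is the $\mathcal{A}$-subalgebra of $\mathbf{S}(n,d)$ generated by all quantum divided powers $E_i^{(m)},F_i^{(m)}$ ($1\le i\le n-1$, $m\in\mathbb{N}$), along with the elements $\begin{bmatrix} K_i \\ m \end{bmatrix}$ ($1\le i\le n$, $m\in\mathbb{N}$). Moreover, each of the sets (a) $\mathbf{Y}_+=\bigcup_\lambda\{E_A1_\lambda F_C\mid\chi(E_AF_C)\preceq\lambda\}$, (b) $\mathbf{Y}_-=\bigcup_\lambda\{F_A1_\lambda E_C\mid\chi(F_AE_C)\preceq\lambda\}$, as $\lambda$ ranges over $\Lambda(n,d)$ and $A,C$ over $\mathbb{N}^{\Phi^+}$, forms an $\mathcal{A}$-basis of $\mathbf{S}_{\mathcal{A}}(n,d)$.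
   Context: $n\ge1$, $d\ge0$ are integers, $\mathbb{N}=\{0,1,2,\dots\}$, $v$ is an indeterminate, $\mathcal{A}=\mathbb{Z}[v,v^{-1}]$. $\varepsilon_1,\dots,\varepsilon_n$ is the standard orthonormal basis of $\mathbb{R}^n$; $\Phi^+=\{\varepsilon_i-\varepsilon_j\mid i<j\}$, $\Phi=\Phi^+\cup-\Phi^+$, $\alpha_i=\varepsilon_i-\varepsilon_{i+1}$. $\mathbf{U}=\mathbf{U}(\mathfrak{gl}_n)$ is the $\mathbb{Q}(v)$-algebra with generators $E_i,F_i$ ($1\le i\le n-1$), $K_i^{\pm1}$ ($1\le i\le n$) and relations: $K_iK_j=K_jK_i$, $K_iK_i^{-1}=K_i^{-1}K_i=1$; $E_iF_j-F_jE_i=\delta_{ij}(K_iK_{i+1}^{-1}-K_i^{-1}K_{i+1})/(v-v^{-1})$; $K_iE_j=v^{(\varepsilon_i,\alpha_j)}E_jK_i$, $K_iF_j=v^{-(\varepsilon_i,\alpha_j)}F_jK_i$; $E_i^2E_j-(v+v^{-1})E_iE_jE_i+E_jE_i^2=0$ for $|i-j|=1$, $E_iE_j=E_jE_i$ otherwise; and the same two relations with $F$ in place of $E$. $\mathbf{V}$ is the natural module with basis $w_1,\dots,w_n$: $K_iw_j=v^{\delta_{ij}}w_j$, $E_iw_j=\delta_{j,i+1}w_i$, $F_iw_j=\delta_{ij}w_{i+1}$; $\mathbf{U}$ acts on $\mathbf{V}^{\otimes d}$ through a standard comultiplication, e.g. $\Delta(K_i)=K_i\otimes K_i$, $\Delta(E_i)=E_i\otimes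 K_iK_{i+1}^{-1}+1\otimes E_i$, $\Delta(F_i)=F_i\otimes1+K_i^{-1}K_{i+1}\otimes F_i$. $\mathbf{S}(n,d)$ is the image of $\mathbf{U}\to\operatorname{End}(\mathbf{V}^{\otimes d})$ (equivalently the commuting algebra of the Hecke algebra of $\Sigma_d$ on $\mathbf{V}^{\otimes d}$). The integral form $\mathbf{S}_{\mathcal{A}}(n,d)$ is the $\mathcal{A}$-subalgebra of those elements of $\mathbf{S}(n,d)$ which preserve the lattice $\mathbf{V}_{\mathcal{A}}^{\otimes d}$, where $\mathbf{V}_{\mathcal{A}}=\bigoplus_j\mathcal{A}w_j$ (equivalently, the endomorphisms of $\mathbf{V}_{\mathcal{A}}^{\otimes d}$ commuting with the integral Hecke algebra); by a theorem of Du it is the image of Lusztig's $\mathcal{A}$-form $\mathbf{U}_{\mathcal{A}}$, the $\mathcal{A}$-subalgebra of $\mathbf{U}$ generated by all $E_i^{(m)},F_i^{(m)},K_i^{\pm1},\begin{bmatrix} K_i \\ m \end{bmatrix}$. Elements of $\mathbf{U}$ and their images in $\mathbf{S}(n,d)$ are denoted by the same symbols. Notation: $[m]=(v^m-v^{-m})/(v-v^{-1})$, $[m]!=[m][m-1]\cdots[1]$, $[0]!=1$; $\begin{bmatrix} K_i \\ t \end{bmatrix}=\prod_{s=1}^t\frac{K_iv^{-s+1}-K_i^{-1}v^{s-1}}{v^s-v^{-s}}$, $\begin{bmatrix} K_i \\ 0 \end{bmatrix}=1$. $\Lambda(n,d)=\{\lambda\in\mathbb{N}^n\mid\sum\lambda_i=d\}$,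 $1_\lambda=\prod_{i=1}^n\begin{bmatrix} K_i \\ \lambda_i \end{bmatrix}$. Root vectors: for $\alpha=\varepsilon_i-\varepsilon_j$, $i<j$: if $j-i=1$, $X_\alpha=E_i$, $X_{-\alpha}=F_i$; if $j-i>1$, inductively $X_\alpha=v^{-1}E_iX_{\alpha-\alpha_i}-X_{\alpha-\alpha_i}E_i$, $X_{-\alpha}=vX_{-\alpha+\alpha_i}F_i-F_iX_{-\alpha+\alpha_i}$. Quantum divided powers: $X_\alpha^{(m)}=X_\alpha^m/[m]!$. For $A,C\in\mathbb{N}^{\Phi^+}$: $E_A=\prod_{\alpha\in\Phi^+}X_\alpha^{(A(\alpha))}$, $F_C=\prod_{\alpha\in\Phi^+}X_{-\alpha}^{(C(\alpha))}$, products taken relative to any two specified orderings on $\Phi^+$. The content $\chi\in\mathbb{N}^n$ of a (formal) product of elements $X_\alpha^{(m)}$ is determined by $\chi(X_\alpha^{(m)})=m\,\varepsilon_{\max(i,j)}$ for $\alpha=\varepsilon_i-\varepsilon_j\in\Phi$ and $\chi(XY)=\chi(X)+\chi(Y)$. $\preceq$ is the componentwise order on $\mathbb{N}^n$.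
   Formalization: In (b) the content of X_α^{(m)} is taken as m ε_{min(i,j)} instead of m ε_{max(i,j)}; with max, (b) fails for all n≥2, d≥1, since e.g. for n=2, d=1 the set Y_- contains F_1 1_{(0,1)} = 0. *)

theory Defs
  imports
    "HOL-Computational_Algebra.Fraction_Field"
    "HOL-Library.Poly_Mapping"
    "HOL-Algebra.QuotRing"
    "HOL-Algebra.Generated_Rings"
    "Jordan_Normal_Form.VS_Connect"
begin

text \<open>
  All indices are shifted down by one: the index set \<open>1, \<dots>, n\<close> of the mathematics is
  \<open>{..<n}\<close> here, so that \<open>E\<^sub>i, F\<^sub>i\<close> exist for \<open>Suc i < n\<close> and \<open>K\<^sub>i\<close> for \<open>i < n\<close>.
\<close>

section \<open>The ground field and its Laurent subring\<close>

type_synonym Qv = "rat poly fract"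

definition vv :: Qv where
  "vv = Fract [:0, 1:] 1"

definition laurent :: "Qv set" where
  "laurent = {poly (map_poly of_int p) vv / vv ^ k | (p :: int poly) k. True}"

definition laurent_ring :: "Qv ring" where
  "laurent_ring = \<lparr>carrier = laurent, mult = (*), one = 1, zero = 0, add = (+)\<rparr>"

definition qint :: "nat \<Rightarrow> Qv" where
  "qint m = (vv powi int m - vv powi (- int m)) / (vv - inverse vv)"

definition qfact :: "nat \<Rightarrow> Qv" where
  "qfact m = (\<Prod>k = 1..m. qint k)"

section \<open>The free algebra on the generators\<close>

datatype gen = GE nat | GF nat | GK nat | GKinv nat

datatype gword = GWord (letters: "gen list")

instantiation gword :: monoid_add
begin

definition zero_gword :: gword where
  "zero_gword = GWord []"

definition plus_gword :: "gword \<Rightarrow> gword \<Rightarrow> gword" where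
  "plus_gword x y = GWord (letters x @ letters y)"

instance
  by standard (simp_all add: zero_gword_def plus_gword_def)

end

text \<open>
  As words form an additive monoid under concatenation, the convolution product of
  \<^theory>\<open>HOL-Library.Poly_Mapping\<close> makes this type the free associative unital algebra on \<^typ>\<open>gen\<close>.
\<close>

type_synonym free_alg = "gword \<Rightarrow>\<^sub>0 Qv"

definition cst :: "Qv \<Rightarrow> free_alg" where
  "cst c = Poly_Mapping.single 0 c"

definition gen_elem :: "gen \<Rightarrow> free_alg" where
  "gen_elem g = Poly_Mapping.single (GWord [g]) 1"

abbreviation EE :: "nat \<Rightarrow> free_alg" where "EE i \<equiv> gen_elem (GE i)"
abbreviation FF :: "nat \<Rightarrow> free_alg" where "FF i \<equiv> gen_elem (GF i)"
abbreviation KK :: "nat \<Rightarrow> free_alg" where "KK i \<equiv> gen_elem (GK i)"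
abbreviation KI :: "nat \<Rightarrow> free_alg" where "KI i \<equiv> gen_elem (GKinv i)"

definition gens :: "nat \<Rightarrow> gen set" where
  "gens n = {GE i | i. Suc i < n} \<union> {GF i | i. Suc i < n} \<union> {GK i | i. i < n} \<union> {GKinv i | i. i < n}"

definition free_ring :: "nat \<Rightarrow> free_alg ring" where
  "free_ring n = \<lparr>carrier = {f. \<forall>w \<in> Poly_Mapping.keys f. set (letters w) \<subseteq> gens n},
     mult = (*), one = 1, zero = 0, add = (+)\<rparr>"

section \<open>The quantized enveloping algebra of \<open>gl\<^sub>n\<close>\<close>

text \<open>The inner product of \<open>\<epsilon>\<^sub>i\<close> with the simple root \<open>\<alpha>\<^sub>j = \<epsilon>\<^sub>j - \<epsilon>\<^sub>j\<^sub>+\<^sub>1\<close>.\<close>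

definition eps_alpha :: "nat \<Rightarrow> nat \<Rightarrow> int" where
  "eps_alpha i j = (if i = j then 1 else 0) - (if i = Suc j then 1 else 0)"

definition serre :: "free_alg \<Rightarrow> free_alg \<Rightarrow> free_alg" where
  "serre x y = x^2 * y - cst (vv + inverse vv) * x * y * x + y * x^2"

definition adjacent :: "nat \<Rightarrow> nat \<Rightarrow> bool" where
  "adjacent i j \<longleftrightarrow> i = Suc j \<or> j = Suc i"

text \<open>Each relation \<open>lhs = rhs\<close> is recorded as the element \<open>lhs - rhs\<close>.\<close>

definition relators :: "nat \<Rightarrow> free_alg set" where
  "relators n =
     {KK i * KK j - KK j * KK i | i j. i < n \<and> j < n}
   \<union> {KK i * KI i - 1 | i. i < n} \<union> {KI i * KK i - 1 | i. i < n}
   \<union> {EE i * FF j - FF j * EE i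
        - (if i = j then cst (inverse (vv - inverse vv)) * (KK i * KI (Suc i) - KI i * KK (Suc i)) else 0)
      | i j. Suc i < n \<and> Suc j < n}
   \<union> {KK i * EE j - cst (vv powi eps_alpha i j) * EE j * KK i | i j. i < n \<and> Suc j < n}
   \<union> {KK i * FF j - cst (vv powi (- eps_alpha i j)) * FF j * KK i | i j. i < n \<and> Suc j < n}
   \<union> {serre (EE i) (EE j) | i j. Suc i < n \<and> Suc j < n \<and> adjacent i j}
   \<union> {EE i * EE j - EE j * EE i | i j. Suc i < n \<and> Suc j < n \<and> \<not> adjacent i j}
   \<union> {serre (FF i) (FF j) | i j. Suc i < n \<and> Suc j < n \<and> adjacent i j}
   \<union> {FF i * FF j - FF j * FF i | i j. Suc i < n \<and> Suc j < n \<and> \<not> adjacent i j}"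

definition rel_ideal :: "nat \<Rightarrow> free_alg set" where
  "rel_ideal n = Idl\<^bsub>free_ring n\<^esub> (relators n)"

definition U_gl :: "nat \<Rightarrow> free_alg set ring" where
  "U_gl n = free_ring n Quot rel_ideal n"

definition to_U :: "nat \<Rightarrow> free_alg \<Rightarrow> free_alg set" where
  "to_U n x = rel_ideal n +>\<^bsub>free_ring n\<^esub> x"

section \<open>Tensor space\<close>

definition kron :: "'a :: semiring_1 mat \<Rightarrow> 'a mat \<Rightarrow> 'a mat" where
  "kron A B = mat (dim_row A * dim_row B) (dim_col A * dim_col B)
     (\<lambda>(r, c). A $$ (r div dim_row B, c div dim_col B) * B $$ (r mod dim_row B, c mod dim_col B))"

fun nat_mod :: "nat \<Rightarrow> gen \<Rightarrow> Qv mat" where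
  "nat_mod n (GE i) = mat n n (\<lambda>(r, c). if r = i \<and> c = Suc i then 1 else 0)"
| "nat_mod n (GF i) = mat n n (\<lambda>(r, c). if r = Suc i \<and> c = i then 1 else 0)"
| "nat_mod n (GK i) = mat n n (\<lambda>(r, c). if r = c then (if c = i then vv else 1) else 0)"
| "nat_mod n (GKinv i) = mat n n (\<lambda>(r, c). if r = c then (if c = i then inverse vv else 1) else 0)"

text \<open>
  The action of the generators on the \<open>d\<close>-th tensor power of the natural module, as matrices with
  respect to the basis of tensors \<open>w\<^sub>a \<otimes> w\<^sub>b \<otimes> \<dots>\<close>, whose position is the number with
  base-\<open>n\<close> digits \<open>a, b, \<dots>\<close>. The power \<open>d + 1\<close> is the natural module tensored with the power \<open>d\<close>,
  on which a generator acts through the comultiplication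
  \<open>\<Delta>(E\<^sub>i) = E\<^sub>i \<otimes> K\<^sub>i K\<^sub>i\<^sub>+\<^sub>1\<^sup>-\<^sup>1 + 1 \<otimes> E\<^sub>i\<close>,
  \<open>\<Delta>(F\<^sub>i) = F\<^sub>i \<otimes> 1 + K\<^sub>i\<^sup>-\<^sup>1 K\<^sub>i\<^sub>+\<^sub>1 \<otimes> F\<^sub>i\<close>; the power \<open>0\<close> is the counit.
\<close>

fun tensor_mod :: "nat \<Rightarrow> nat \<Rightarrow> gen \<Rightarrow> Qv mat" where
  "tensor_mod n 0 (GE i) = 0\<^sub>m 1 1"
| "tensor_mod n 0 (GF i) = 0\<^sub>m 1 1"
| "tensor_mod n 0 (GK i) = 1\<^sub>m 1"
| "tensor_mod n 0 (GKinv i) = 1\<^sub>m 1"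
| "tensor_mod n (Suc d) (GE i) =
     kron (nat_mod n (GE i)) (tensor_mod n d (GK i) * tensor_mod n d (GKinv (Suc i)))
   + kron (1\<^sub>m n) (tensor_mod n d (GE i))"
| "tensor_mod n (Suc d) (GF i) =
     kron (nat_mod n (GF i)) (1\<^sub>m (n ^ d))
   + kron (nat_mod n (GKinv i) * nat_mod n (GK (Suc i))) (tensor_mod n d (GF i))"
| "tensor_mod n (Suc d) (GK i) = kron (nat_mod n (GK i)) (tensor_mod n d (GK i))"
| "tensor_mod n (Suc d) (GKinv i) = kron (nat_mod n (GKinv i)) (tensor_mod n d (GKinv i))"

definition word_act :: "nat \<Rightarrow> nat \<Rightarrow> gword \<Rightarrow> Qv mat" where
  "word_act n d w = foldr (\<lambda>g M. tensor_mod n d g * M) (letters w) (1\<^sub>m (n ^ d))"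

definition free_act :: "nat \<Rightarrow> nat \<Rightarrow> free_alg \<Rightarrow> Qv mat" where
  "free_act n d f = mat (n ^ d) (n ^ d)
     (\<lambda>rc. \<Sum>w \<in> Poly_Mapping.keys f. Poly_Mapping.lookup f w * word_act n d w $$ rc)"

text \<open>The map induced on cosets; \<^const>\<open>free_act\<close> is constant on each of them since it respects the relations.\<close>

definition U_act :: "nat \<Rightarrow> nat \<Rightarrow> free_alg set \<Rightarrow> Qv mat" where
  "U_act n d X = the_elem (free_act n d ` X)"

section \<open>The \<open>q\<close>-Schur algebra and its integral form\<close>

definition qSchur :: "nat \<Rightarrow> nat \<Rightarrow> Qv mat set" where
  "qSchur n d = U_act n d ` carrier (U_gl n)"

definition lattice :: "nat \<Rightarrow> nat \<Rightarrow> Qv vec set" where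
  "lattice n d = {x \<in> carrier_vec (n ^ d). \<forall>r < n ^ d. x $ r \<in> laurent}"

definition qSchur_int :: "nat \<Rightarrow> nat \<Rightarrow> Qv mat set" where
  "qSchur_int n d = {s \<in> qSchur n d. \<forall>x \<in> lattice n d. s *\<^sub>v x \<in> lattice n d}"

text \<open>The image in the \<open>q\<close>-Schur algebra of the element of \<^const>\<open>U_gl\<close> represented by \<open>x\<close>.\<close>

definition img :: "nat \<Rightarrow> nat \<Rightarrow> free_alg \<Rightarrow> Qv mat" where
  "img n d x = U_act n d (to_U n x)"

definition laurent_subalgebra :: "nat \<Rightarrow> nat \<Rightarrow> Qv mat set \<Rightarrow> Qv mat set" where
  "laurent_subalgebra n d G =
     generate_ring (ring_mat TYPE(Qv) (n ^ d) ()) ({a \<cdot>\<^sub>m 1\<^sub>m (n ^ d) | a. a \<in> laurent} \<union> G)"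

definition End_module :: "nat \<Rightarrow> nat \<Rightarrow> (Qv, Qv mat) module" where
  "End_module n d = module_mat TYPE(Qv) (n ^ d) (n ^ d)"

definition laurent_basis :: "nat \<Rightarrow> nat \<Rightarrow> Qv mat set \<Rightarrow> Qv mat set \<Rightarrow> bool" where
  "laurent_basis n d Y M \<longleftrightarrow> Y \<subseteq> M
     \<and> LinearCombinations.module.span laurent_ring (End_module n d) Y = M
     \<and> \<not> LinearCombinations.module.lin_dep laurent_ring (End_module n d) Y"

section \<open>Divided powers, root vectors and weight idempotents\<close>

definition divpow :: "free_alg \<Rightarrow> nat \<Rightarrow> free_alg" where
  "divpow x m = cst (inverse (qfact m)) * x ^ m"

definition Kbinom :: "nat \<Rightarrow> nat \<Rightarrow> free_alg" where
  "Kbinom i t = (\<Prod>s \<leftarrow> [1..<Suc t].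
     cst (inverse (vv powi int s - vv powi (- int s)))
     * (cst (vv powi (1 - int s)) * KK i - cst (vv powi (int s - 1)) * KI i))"

definition Lambda :: "nat \<Rightarrow> nat \<Rightarrow> (nat \<Rightarrow> nat) set" where
  "Lambda n d = {l. (\<Sum>i<n. l i) = d \<and> (\<forall>i \<ge> n. l i = 0)}"

definition one_wt :: "nat \<Rightarrow> (nat \<Rightarrow> nat) \<Rightarrow> free_alg" where
  "one_wt n l = (\<Prod>i \<leftarrow> [0..<n]. Kbinom i (l i))"

text \<open>The pair \<open>(i, j)\<close> stands for the root \<open>\<epsilon>\<^sub>i - \<epsilon>\<^sub>j\<close>; only \<open>i < j\<close> is meaningful in the next two functions.\<close>

function pos_vec :: "nat \<Rightarrow> nat \<Rightarrow> free_alg" where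
  "pos_vec i j = (if Suc i < j
     then cst (inverse vv) * EE i * pos_vec (Suc i) j - pos_vec (Suc i) j * EE i
     else EE i)"
  by pat_completeness auto
termination pos_vec
  by (relation "measure (\<lambda>(i, j). j - i)") auto

function neg_vec :: "nat \<Rightarrow> nat \<Rightarrow> free_alg" where
  "neg_vec i j = (if Suc i < j
     then cst vv * neg_vec (Suc i) j * FF i - FF i * neg_vec (Suc i) j
     else FF i)"
  by pat_completeness auto
termination neg_vec
  by (relation "measure (\<lambda>(i, j). j - i)") auto

declare pos_vec.simps [simp del] neg_vec.simps [simp del]

definition root_vec :: "nat \<times> nat \<Rightarrow> free_alg" where
  "root_vec = (\<lambda>(i, j). if i < j then pos_vec i j else neg_vec j i)"

definition pos_roots :: "nat \<Rightarrow> (nat \<times> nat) set" where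
  "pos_roots n = {(i, j). i < j \<and> j < n}"

definition root_ordering :: "nat \<Rightarrow> (nat \<times> nat) list \<Rightarrow> bool" where
  "root_ordering n os \<longleftrightarrow> distinct os \<and> set os = pos_roots n"

section \<open>Formal products and their content\<close>

text \<open>A formal product of divided powers of root vectors, as a list of roots with exponents.\<close>

type_synonym formal_prod = "((nat \<times> nat) \<times> nat) list"

definition fp_eval :: "formal_prod \<Rightarrow> free_alg" where
  "fp_eval p = (\<Prod>(a, m) \<leftarrow> p. divpow (root_vec a) m)"

definition E_prod :: "(nat \<times> nat) list \<Rightarrow> (nat \<times> nat \<Rightarrow> nat) \<Rightarrow> formal_prod" where
  "E_prod os A = map (\<lambda>a. (a, A a)) os"

definition F_prod :: "(nat \<times> nat) list \<Rightarrow> (nat \<times> nat \<Rightarrow> nat) \<Rightarrow> formal_prod" where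
  "F_prod os C = map (\<lambda>(i, j). ((j, i), C (i, j))) os"

text \<open>
  The content of a formal product, where \<open>ix i j\<close> is the index that counts for the roots
  \<open>\<epsilon>\<^sub>i - \<epsilon>\<^sub>j\<close> and \<open>\<epsilon>\<^sub>j - \<epsilon>\<^sub>i\<close>. For \<open>E 1\<^sub>\<lambda> F\<close> it is \<^const>\<open>max\<close>. For \<open>F 1\<^sub>\<lambda> E\<close> it has to be
  \<^const>\<open>min\<close>: with \<^const>\<open>max\<close>, already for \<open>n = 2\<close>, \<open>d = 1\<close> and \<open>\<lambda> = (0, 1)\<close> the set \<open>Y_minus\<close> below
  would contain \<open>F\<^sub>0 1\<^sub>\<lambda> = 0\<close>, and it would have too few elements to span.
\<close>

definition content :: "(nat \<Rightarrow> nat \<Rightarrow> nat) \<Rightarrow> formal_prod \<Rightarrow> nat \<Rightarrow> nat" where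
  "content ix p k = (\<Sum>((i, j), m) \<leftarrow> p. if ix i j = k then m else 0)"

definition Y_plus :: "nat \<Rightarrow> nat \<Rightarrow> (nat \<times> nat) list \<Rightarrow> (nat \<times> nat) list \<Rightarrow> Qv mat set" where
  "Y_plus n d osE osF =
     {img n d (fp_eval (E_prod osE A) * one_wt n l * fp_eval (F_prod osF C)) | l A C.
        l \<in> Lambda n d \<and> (\<forall>k<n. content max (E_prod osE A @ F_prod osF C) k \<le> l k)}"

definition Y_minus :: "nat \<Rightarrow> nat \<Rightarrow> (nat \<times> nat) list \<Rightarrow> (nat \<times> nat) list \<Rightarrow> Qv mat set" where
  "Y_minus n d osE osF =
     {img n d (fp_eval (F_prod osF A) * one_wt n l * fp_eval (E_prod osE C)) | l A C.
        l \<in> Lambda n d \<and> (\<forall>k<n. content min (F_prod osF A @ E_prod osE C) k \<le> l k)}"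

end

theory Submission
  imports Defs
begin

text \<open>
  An element of the \<open>q\<close>-Schur algebra is a matrix indexed by pairs of words of length
  \<open>d\<close>. Since it commutes with the Hecke operators, it is determined by its columns at
  sorted words, and entries of these columns differ by units when the two pairs of words differ by a
  simultaneous permutation of the positions. The classes of pairs under such permutations are the
  \<open>n \<times> n\<close> matrices over \<open>\<nat>\<close> with entry sum \<open>d\<close>;
  these also index the monomials in either of the two sets.

  Divided powers of root vectors replace letters of words. With respect to the sum of
  \<open>i * j\<close> over the pairs \<open>(i, j)\<close> in a class, their monomials have leading classes
  with unit coefficients: lowest or highest ones, according to the direction in which the column
  words are sorted. In one direction, monomials of one sign with bounded content at a fixed weight
  reach only triangular classes with the same bound. Elimination within these classes shows that for
  the outer factor the order of its root vectors does not matter for the lattice spanned, and that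
  for each class there is a combination of inner monomials concentrated on it. With the order that
  is best for the other direction, the products of outer monomials and concentrated inner elements
  have every class as a leading class exactly once. So these products span the integral matrices
  over the Laurent polynomials, they lie in the span of the monomials, and independence follows by
  counting.
\<close>

section \<open>The ground field\<close>

text \<open>Replacing a letter s by t opposite a column letter b changes the sum of i * j by (t - s)
  * b, so only the comparison of b with s decides whether a contribution leads. The extreme value (t
  - s) * s forces every replaced letter to stand opposite s. A replacement made in several steps
  telescopes to the same bound only if the column letters are monotone along it; this is where
  sorting enters. The coefficient of a leading class is a geometric sum, a unit times [j] at the
  j-th application, and the division by [m]! removes exactly these factors. The two directions of
  sorting are unequal. In one, triangularity is preserved in whatever order the root vectors act; in
  the other, only if smaller sources act first. Outer and inner factors have opposite signs but meet
  the same column word, so both cannot enjoy the favourable direction at once. The outer factor is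
  therefore reordered separately, where its own direction is favourable. Both sets of the theorem
  are treated together: for a sign \<epsilon>, outer root vectors replace s by t with \<epsilon> t <
  \<epsilon> s, and inner ones do the opposite.\<close>

lemma vv_nonzero [simp]: "vv \<noteq> 0"
  by (simp add: vv_def Zero_fract_def eq_fract)

lemma vv_power: "vv ^ m = Fract (monom 1 m) 1"
proof (induction m)
  case (Suc m)
  have "[:0, 1:] * monom (1::rat) m = monom 1 (Suc m)"
    by (simp add: monom_Suc)
  with Suc show ?case by (simp add: vv_def)
qed (simp add: One_fract_def one_pCons monom_0)

text \<open>That v is not a root of unity is what makes the quantum integers,
  \<open>vv - inverse vv\<close> and later \<open>1 + vv * vv\<close> invertible.\<close>

lemma vv_power_eq_1_iff: "vv ^ m = 1 \<longleftrightarrow> m = 0"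
proof
  assume "vv ^ m = 1"
  then have "monom (1::rat) m = 1"
    by (simp add: vv_power One_fract_def eq_fract)
  then have "degree (monom (1::rat) m) = 0" by simp
  then show "m = 0" by (simp add: degree_monom_eq)
qed simp

lemma vv_minus_inverse_nonzero [simp]: "vv - inverse vv \<noteq> 0"
proof
  assume "vv - inverse vv = 0"
  then have "vv * vv = 1" by (metis eq_iff_diff_eq_0 right_inverse vv_nonzero)
  then show False using vv_power_eq_1_iff[of 2] by (simp add: power2_eq_square)
qed

lemma vv_neq_inverse [simp]: "vv \<noteq> inverse vv" "inverse vv \<noteq> vv"
  using vv_minus_inverse_nonzero by auto

lemma vv_powi_diff_nonzero: "m > 0 \<Longrightarrow> vv powi int m - vv powi (- int m) \<noteq> 0"
proof
  assume "m > 0" "vv powi int m - vv powi (- int m) = 0"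
  then have "vv ^ m = inverse (vv ^ m)" by (simp add: power_int_minus)
  then have "vv ^ m * vv ^ m = 1" by (metis power_not_zero right_inverse vv_nonzero)
  then have "vv ^ (m + m) = 1" by (simp add: power_add)
  then show False using \<open>m > 0\<close> by (simp only: vv_power_eq_1_iff)
qed

lemma qint_nonzero: "m > 0 \<Longrightarrow> qint m \<noteq> 0"
  using vv_powi_diff_nonzero[of m] by (simp add: qint_def)

lemma qfact_nonzero [simp]: "qfact m \<noteq> 0"
  unfolding qfact_def using qint_nonzero by (auto simp: prod_zero_iff)

lemma qint_0 [simp]: "qint 0 = 0"
  by (simp add: qint_def)

lemma qint_1 [simp]: "qint (Suc 0) = 1"
  by (simp add: qint_def power_int_minus)

lemma qfact_0 [simp]: "qfact 0 = 1"
  by (simp add: qfact_def)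

lemma qfact_Suc: "qfact (Suc m) = qint (Suc m) * qfact m"
  by (simp add: qfact_def prod.nat_ivl_Suc' mult.commute)

lemma qint_add: "qint (a + b) = vv powi (int a) * qint b + vv powi (- int b) * qint a"
proof -
  have "vv powi (int (a + b)) - vv powi (- int (a + b))
    = vv powi (int a) * (vv powi int b - vv powi (- int b))
      + vv powi (- int b) * (vv powi int a - vv powi (- int a))"
    by (simp add: power_int_add power_int_diff power_int_minus field_simps)
  then show ?thesis unfolding qint_def
    by (metis (no_types, lifting) add_divide_distrib times_divide_eq_right)
qed

lemma qint_add': "qint (a + b) = vv powi (- int a) * qint b + vv powi (int b) * qint a"
  using qint_add[of b a] by (simp add: add.commute)

section \<open>The Laurent subring and its units\<close>

lemma laurent_iff: "x \<in> laurent \<longleftrightarrow> (\<exists>p k. x * vv ^ k = poly (map_poly of_int (p :: int poly)) vv)"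
  unfolding laurent_def by (auto simp: field_simps)

lemma laurentI: "x * vv ^ k = poly (map_poly of_int (p :: int poly)) vv \<Longrightarrow> x \<in> laurent"
  by (auto simp: laurent_iff)

lemma laurent_0 [simp]: "0 \<in> laurent"
  by (rule laurentI[of _ 0 0]) simp

lemma laurent_1 [simp]: "1 \<in> laurent"
  by (rule laurentI[of _ 0 1]) simp

lemma laurent_vv [simp]: "vv \<in> laurent"
  by (rule laurentI[of _ 0 "[:0, 1:]"]) (simp add: map_poly_pCons)

lemma laurent_inverse_vv [simp]: "inverse vv \<in> laurent"
  by (rule laurentI[of _ 1 1]) simp

lemma poly_of_int_add:
  "poly (map_poly of_int (p + q :: int poly)) x
    = (poly (map_poly of_int p) x + poly (map_poly of_int q) x :: 'a :: comm_ring_1)"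
  by (induction p q rule: poly_induct2) (simp_all add: map_poly_pCons algebra_simps)

lemma poly_of_int_mult:
  "poly (map_poly of_int (p * q :: int poly)) x
    = (poly (map_poly of_int p) x * poly (map_poly of_int q) x :: 'a :: comm_ring_1)"
proof (induction p)
  case (pCons a p)
  have "poly (map_poly of_int (Polynomial.smult a q)) x = of_int a * poly (map_poly of_int q) x"
    by (induction q) (simp_all add: map_poly_pCons algebra_simps)
  with pCons show ?case by (simp add: map_poly_pCons poly_of_int_add algebra_simps)
qed simp

lemma laurent_add [simp]: "x \<in> laurent \<Longrightarrow> y \<in> laurent \<Longrightarrow> x + y \<in> laurent"
proof -
  assume "x \<in> laurent" "y \<in> laurent"
  then obtain p q :: "int poly" and k l where
    x: "x * vv ^ k = poly (map_poly of_int p) vv" and y: "y * vv ^ l = poly (map_poly of_int q) vv"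
    by (auto simp: laurent_iff)
  have "(x + y) * vv ^ (k + l) = (x * vv ^ k) * vv ^ l + (y * vv ^ l) * vv ^ k"
    by (simp add: power_add algebra_simps)
  also have "\<dots> = poly (map_poly of_int (p * monom 1 l + q * monom 1 k)) vv"
    unfolding x y by (simp add: poly_of_int_add poly_of_int_mult map_poly_monom poly_monom)
  finally show ?thesis by (rule laurentI)
qed

lemma laurent_mult [simp]: "x \<in> laurent \<Longrightarrow> y \<in> laurent \<Longrightarrow> x * y \<in> laurent"
proof -
  assume "x \<in> laurent" "y \<in> laurent"
  then obtain p q :: "int poly" and k l where
    x: "x * vv ^ k = poly (map_poly of_int p) vv" and y: "y * vv ^ l = poly (map_poly of_int q) vv"
    by (auto simp: laurent_iff)
  have "(x * y) * vv ^ (k + l) = (x * vv ^ k) * (y * vv ^ l)"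
    by (simp add: power_add algebra_simps)
  also have "\<dots> = poly (map_poly of_int (p * q)) vv"
    unfolding x y by (simp add: poly_of_int_mult)
  finally show ?thesis by (rule laurentI)
qed

lemma laurent_uminus [simp]: "x \<in> laurent \<Longrightarrow> - x \<in> laurent"
proof -
  assume x: "x \<in> laurent"
  have "- 1 \<in> laurent" by (rule laurentI[of _ 0 "[:-1:]"]) (simp add: map_poly_pCons)
  from laurent_mult[OF this x] show ?thesis by simp
qed

lemma laurent_diff [simp]: "x \<in> laurent \<Longrightarrow> y \<in> laurent \<Longrightarrow> x - y \<in> laurent"
  using laurent_add[of x "- y"] by simp

lemma laurent_sum: "(\<And>a. a \<in> A \<Longrightarrow> f a \<in> laurent) \<Longrightarrow> sum f A \<in> laurent"
  by (induction A rule: infinite_finite_induct) auto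

lemma laurent_power [simp]: "x \<in> laurent \<Longrightarrow> x ^ k \<in> laurent"
  by (induction k) auto

lemma laurent_powi [simp]: "vv powi k \<in> laurent"
  by (cases "k \<ge> 0") (auto simp: power_int_def)

text \<open>The units of the integral Laurent polynomial ring are precisely the signed powers of v;
  stating them explicitly makes closure properties computations with exponents.\<close>

definition is_unit_laurent :: "Qv \<Rightarrow> bool" where
  "is_unit_laurent u \<longleftrightarrow> (\<exists>k. u = vv powi k \<or> u = - (vv powi k))"

lemma unit_powi [simp]: "is_unit_laurent (vv powi k)"
  by (auto simp: is_unit_laurent_def)

lemma unit_1 [simp]: "is_unit_laurent 1"
  using unit_powi[of 0] by simp

lemma unit_mult [simp]: "is_unit_laurent x \<Longrightarrow> is_unit_laurent y \<Longrightarrow> is_unit_laurent (x * y)"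
  unfolding is_unit_laurent_def by (auto simp flip: power_int_add)

lemma unit_inverse [simp]: "is_unit_laurent x \<Longrightarrow> is_unit_laurent (inverse x)"
  unfolding is_unit_laurent_def by (auto simp flip: power_int_minus)

lemma unit_nonzero: "is_unit_laurent x \<Longrightarrow> x \<noteq> 0"
  unfolding is_unit_laurent_def by auto

lemma unit_laurent: "is_unit_laurent x \<Longrightarrow> x \<in> laurent"
  unfolding is_unit_laurent_def by auto

section \<open>Operators on coordinate functions of tensors\<close>

text \<open>
  A vector of the tensor powers is given by its coordinates at all words, of whatever length;
  \<open>\<lambda>I. f (x # I)\<close> is its component along \<open>w\<^sub>x \<otimes> _\<close>.
\<close>

type_synonym tens = "nat list \<Rightarrow> Qv"

definition linear_op :: "(tens \<Rightarrow> tens) \<Rightarrow> bool" where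
  "linear_op h \<longleftrightarrow> (\<forall>f g. h (\<lambda>I. f I + g I) = (\<lambda>I. h f I + h g I))
     \<and> (\<forall>c f. h (\<lambda>I. c * f I) = (\<lambda>I. c * h f I))"

text \<open>As a type, the linear operators form an instance of \<open>ring_1\<close>, so relations
  between generators become ring identities without carrier conditions. One operator acts on all
  tensor powers, and on all letters, at once.\<close>

typedef endo = "{h. linear_op h}" morphisms app Endo
  by (rule exI[of _ "\<lambda>f. f"]) (simp add: linear_op_def)

lemma app_Endo: "linear_op h \<Longrightarrow> app (Endo h) = h"
  by (simp add: Endo_inverse)

lemma linear_app: "linear_op (app a)"
  using app[of a] by simp

lemma endo_eqI: "(\<And>f I. app a f I = app b f I) \<Longrightarrow> a = b"
  by (metis app_inject ext)

instantiation endo :: ring_1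
begin

definition zero_endo :: endo where "zero_endo = Endo (\<lambda>f I. 0)"
definition one_endo :: endo where "one_endo = Endo (\<lambda>f. f)"
definition plus_endo :: "endo \<Rightarrow> endo \<Rightarrow> endo" where
  "plus_endo a b = Endo (\<lambda>f I. app a f I + app b f I)"
definition minus_endo :: "endo \<Rightarrow> endo \<Rightarrow> endo" where
  "minus_endo a b = Endo (\<lambda>f I. app a f I - app b f I)"
definition uminus_endo :: "endo \<Rightarrow> endo" where
  "uminus_endo a = Endo (\<lambda>f I. - app a f I)"
definition times_endo :: "endo \<Rightarrow> endo \<Rightarrow> endo" where
  "times_endo a b = Endo (\<lambda>f. app a (app b f))"

lemma app_ring:
  "app 0 f I = 0" "app 1 f = f" "app (a + b) f I = app a f I + app b f I"
  "app (a - b) f I = app a f I - app b f I" "app (- a) f I = - app a f I"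
  "app (a * b) f = app a (app b f)"
  using linear_app[of a] linear_app[of b]
  unfolding zero_endo_def one_endo_def plus_endo_def minus_endo_def uminus_endo_def times_endo_def
  by (subst app_Endo; simp add: linear_op_def algebra_simps)+

instance
proof
  fix a b c :: endo
  show "a * (b + c) = a * b + a * c"
  proof (rule endo_eqI)
    fix f I
    have "app (b + c) f = (\<lambda>I. app b f I + app c f I)" by (simp add: fun_eq_iff app_ring)
    then show "app (a * (b + c)) f I = app (a * b + a * c) f I"
      using linear_app[of a] by (simp add: app_ring linear_op_def)
  qed
  show "(0::endo) \<noteq> 1"
    using app_ring(1)[of "\<lambda>_. 1" "[]"] app_ring(2)[of "\<lambda>_. 1"] by (metis one_neq_zero)
qed (rule endo_eqI; simp add: app_ring)+

end

definition scal :: "Qv \<Rightarrow> endo" where "scal c = Endo (\<lambda>f I. c * f I)"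

lemma app_scal: "app (scal c) f = (\<lambda>I. c * f I)"
  unfolding scal_def by (subst app_Endo) (simp_all add: linear_op_def algebra_simps)

lemmas app_1 [simp] = app_ring(2)
lemmas app_times = app_ring(6)

lemma app_simps [simp]:
  "app 0 f I = 0" "app (a + b) f I = app a f I + app b f I"
  "app (a - b) f I = app a f I - app b f I" "app (- a) f I = - app a f I"
  "app (a * b) f = app a (app b f)" "app (scal c) f I = c * f I"
  by (simp_all add: app_ring app_scal)

lemma app_add: "app a (\<lambda>I. f I + g I) = (\<lambda>I. app a f I + app a g I)"
  using linear_app[of a] by (simp add: linear_op_def)

lemma app_cmult: "app a (\<lambda>I. c * f I) = (\<lambda>I. c * app a f I)"
  using linear_app[of a] by (simp add: linear_op_def)

lemma app_zero: "app a (\<lambda>I. 0) = (\<lambda>I. 0)"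
  using app_cmult[of a 0 "\<lambda>I. 0"] by simp

lemma app_sum: "app (sum a S) f I = (\<Sum>i\<in>S. app (a i) f I)"
  by (induction S rule: infinite_finite_induct) auto

lemma scal_simps [simp]:
  "scal 0 = 0" "scal 1 = 1" "scal (- c) = - scal c"
  by (rule endo_eqI; simp)+

lemma scal_add: "scal (c + d) = scal c + scal d"
  and scal_diff: "scal (c - d) = scal c - scal d"
  and scal_mult: "scal (c * d) = scal c * scal d"
  by (rule endo_eqI; simp add: algebra_simps)+

lemma scal_central: "a * scal c = scal c * a"
  by (rule endo_eqI) (simp add: app_scal app_cmult)

section \<open>Weights of words, and the operators of the generators with their relations\<close>

definition wt :: "(nat \<Rightarrow> int) \<Rightarrow> nat list \<Rightarrow> int" where
  "wt c I = (\<Sum>x\<leftarrow>I. c x)"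

lemma wt_simps [simp]: "wt c [] = 0" "wt c (x # I) = c x + wt c I" "wt c (I @ J) = wt c I + wt c J"
  by (simp_all add: wt_def)

lemma wt_add: "wt (\<lambda>x. c x + d x) I = wt c I + wt d I"
  and wt_diff: "wt (\<lambda>x. c x - d x) I = wt c I - wt d I"
  and wt_uminus: "wt (\<lambda>x. - c x) I = - wt c I"
  and wt_zero [simp]: "wt (\<lambda>x. 0) I = 0"
  by (induction I) auto

definition eps :: "nat \<Rightarrow> nat \<Rightarrow> int" where
  "eps i x = (if x = i then 1 else 0)"

definition rho :: "nat \<Rightarrow> nat \<Rightarrow> nat \<Rightarrow> int" where
  "rho i j x = eps i x - eps j x"

lemma wt_eps: "wt (eps i) I = int (count_list I i)"
  by (induction I) (auto simp: eps_def)

lemma wt_rho: "wt (rho i j) I = wt (eps i) I - wt (eps j) I"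
  by (simp add: rho_def [abs_def] wt_diff)

text \<open>An arbitrary weight function c covers the generators K, their inverses and the products
  of these that occur in the comultiplication.\<close>

definition kk :: "(nat \<Rightarrow> int) \<Rightarrow> endo" where
  "kk c = Endo (\<lambda>f I. vv powi (wt c I) * f I)"

lemma app_kk: "app (kk c) f = (\<lambda>I. vv powi (wt c I) * f I)"
  unfolding kk_def by (subst app_Endo) (simp_all add: linear_op_def algebra_simps)

lemma kk_mult: "kk c * kk d = kk (\<lambda>x. c x + d x)"
  by (rule endo_eqI) (simp add: app_kk wt_add power_int_add)

lemma kk_zero: "kk (\<lambda>x. 0) = 1"
  by (rule endo_eqI) (simp add: app_kk)

text \<open>This is the comultiplication read on coordinates: the summand with E on the first factor
  reaches the coordinate at i from i + 1, because E maps the basis vector i + 1 to i, and the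
  K-factor then acts on the tail.\<close>

fun opE :: "nat \<Rightarrow> tens \<Rightarrow> tens" where
  "opE i f [] = 0"
| "opE i f (x # I) = opE i (\<lambda>I. f (x # I)) I
     + (if x = i then vv powi (wt (rho i (Suc i)) I) * f (Suc i # I) else 0)"

fun opF :: "nat \<Rightarrow> tens \<Rightarrow> tens" where
  "opF i f [] = 0"
| "opF i f (x # I) = vv powi (rho (Suc i) i x) * opF i (\<lambda>I. f (x # I)) I
     + (if x = Suc i then f (i # I) else 0)"

lemma linear_opE: "linear_op (opE i)"
proof -
  have "opE i (\<lambda>I. f I + g I) I = opE i f I + opE i g I" for f g I
    by (induction I arbitrary: f g) (auto simp: algebra_simps)
  moreover have "opE i (\<lambda>I. c * f I) I = c * opE i f I" for c f I
    by (induction I arbitrary: f) (auto simp: algebra_simps)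
  ultimately show ?thesis by (auto simp: linear_op_def)
qed

lemma linear_opF: "linear_op (opF i)"
proof -
  have "opF i (\<lambda>I. f I + g I) I = opF i f I + opF i g I" for f g I
    by (induction I arbitrary: f g) (auto simp: algebra_simps)
  moreover have "opF i (\<lambda>I. c * f I) I = c * opF i f I" for c f I
    by (induction I arbitrary: f) (auto simp: algebra_simps)
  ultimately show ?thesis by (auto simp: linear_op_def)
qed

definition ee :: "nat \<Rightarrow> endo" where "ee i = Endo (opE i)"
definition ff :: "nat \<Rightarrow> endo" where "ff i = Endo (opF i)"

lemma app_ee [simp]:
  "app (ee i) f [] = 0"
  "app (ee i) f (x # I) = app (ee i) (\<lambda>I. f (x # I)) I
     + (if x = i then vv powi (wt (rho i (Suc i)) I) * f (Suc i # I) else 0)"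
  by (simp_all add: ee_def ff_def app_Endo linear_opE linear_opF)

lemma app_ff [simp]:
  "app (ff i) f [] = 0"
  "app (ff i) f (x # I) = vv powi (rho (Suc i) i x) * app (ff i) (\<lambda>I. f (x # I)) I
     + (if x = Suc i then f (i # I) else 0)"
  by (simp_all add: ee_def ff_def app_Endo linear_opE linear_opF)

text \<open>The coordinate at I is read from words in which one letter i has become i + 1, and this
  shifts the weight by a constant.\<close>

lemma ee_wt: "app (ee i) (\<lambda>I. vv powi (wt c I) * f I) I
    = vv powi (wt c I + c (Suc i) - c i) * app (ee i) f I"
proof (induction I arbitrary: f)
  case (Cons x I)
  have "app (ee i) (\<lambda>I. vv powi (c x + wt c I) * f (x # I)) I
    = app (ee i) (\<lambda>I. vv powi wt c I * (vv powi (c x) * f (x # I))) I"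
    by (simp add: power_int_add mult_ac)
  also have "\<dots> = vv powi (wt c I + c (Suc i) - c i) * vv powi (c x) * app (ee i) (\<lambda>I. f (x # I)) I"
    by (subst Cons) (simp add: app_cmult)
  finally have eq: "app (ee i) (\<lambda>I. vv powi (c x + wt c I) * f (x # I)) I = \<dots>" .
  show ?case unfolding app_ee wt_simps eq
    by (simp add: power_int_add power_int_diff field_simps)
qed simp

lemma ff_wt: "app (ff i) (\<lambda>I. vv powi (wt c I) * f I) I
    = vv powi (wt c I + c i - c (Suc i)) * app (ff i) f I"
proof (induction I arbitrary: f)
  case (Cons x I)
  have "app (ff i) (\<lambda>I. vv powi (c x + wt c I) * f (x # I)) I
    = app (ff i) (\<lambda>I. vv powi wt c I * (vv powi (c x) * f (x # I))) I"
    by (simp add: power_int_add mult_ac)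
  also have "\<dots> = vv powi (wt c I + c i - c (Suc i)) * vv powi (c x) * app (ff i) (\<lambda>I. f (x # I)) I"
    by (subst Cons) (simp add: app_cmult)
  finally have eq: "app (ff i) (\<lambda>I. vv powi (c x + wt c I) * f (x # I)) I = \<dots>" .
  show ?case unfolding app_ff wt_simps eq
    by (simp add: power_int_add power_int_diff field_simps)
qed simp

lemma ee_wt': "app (ee i) (\<lambda>I. vv powi (wt c I) * f I)
    = (\<lambda>I. vv powi (c (Suc i) - c i) * (vv powi wt c I * app (ee i) f I))"
  by (rule ext, subst ee_wt) (simp add: power_int_add power_int_diff field_simps)

lemma ee_kk: "ee i * kk c = scal (vv powi (c (Suc i) - c i)) * kk c * ee i"
  by (rule endo_eqI) (simp add: app_kk ee_wt app_cmult, simp add: power_int_add power_int_diff field_simps)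

lemma ff_wt': "app (ff i) (\<lambda>I. vv powi (wt c I) * f I)
    = (\<lambda>I. vv powi (c i - c (Suc i)) * (vv powi wt c I * app (ff i) f I))"
  by (rule ext, subst ff_wt) (simp add: power_int_add power_int_diff field_simps)

lemma ff_kk: "ff i * kk c = scal (vv powi (c i - c (Suc i))) * kk c * ff i"
  by (rule endo_eqI) (simp add: app_kk ff_wt app_cmult, simp add: power_int_add power_int_diff field_simps)

text \<open>Induction on the word splits off one tensor factor; what remains is a case distinction
  on the position of the first letter relative to the indices of the two generators.\<close>

lemma ee_ff_comm:
  "ee i * ff j - ff j * ee i
    = (if i = j then scal (inverse (vv - inverse vv)) * (kk (rho i (Suc i)) - kk (rho (Suc i) i)) else 0)"
proof (rule endo_eqI)
  fix f I
  \<comment> \<open>The denominator is kept opaque. The simplifier knows of it only the relation v *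
    v * D = v + D and therefore does not clear it.\<close>
  define D where "D = inverse (vv - inverse vv)"
  have D: "vv * vv * D = vv + D"
  proof -
    have "D * (vv - inverse vv) = 1" by (simp add: D_def)
    moreover have "vv * vv * D = vv * (D * (vv - inverse vv)) + D * (vv * inverse vv)"
      by (simp only: algebra_simps)
    ultimately show ?thesis by simp
  qed
  have D': "D * (vv * (vv * z)) = vv * z + D * z" for z
    using arg_cong[OF D, of "\<lambda>x. x * z"] by (simp add: algebra_simps)
  have "app (ee i * ff j - ff j * ee i) f I = app (if i = j
    then scal D * (kk (rho i (Suc i)) - kk (rho (Suc i) i)) else 0) f I"
  proof (induction I arbitrary: f)
    case Nil
    then show ?case by (simp add: app_kk)
  next
    case (Cons x I)
    have IH: "app (ee i) (app (ff j) (\<lambda>I. f (x # I))) I = app (ff j) (app (ee i) (\<lambda>I. f (x # I))) I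
      + (if i = j then D * (vv powi wt (rho i (Suc i)) I - vv powi wt (rho (Suc i) i) I) * f (x # I) else 0)"
      using Cons[of "\<lambda>I. f (x # I)"] by (simp add: app_kk algebra_simps split: if_splits)
    show ?case using IH
      apply (cases "i = j"; cases "x = i"; cases "x = Suc i"; cases "x = Suc j"; cases "x = j")
      apply (simp_all add: app_add app_cmult ee_wt' ff_wt' app_kk rho_def[of _ _ x] eps_def[of _ x])
      apply (simp_all add: rho_def eps_def wt_rho power_int_add power_int_diff power_int_minus field_simps)
      apply (simp_all add: D' power2_eq_square algebra_simps)
      done
  qed
  then show "app (ee i * ff j - ff j * ee i) f I = app (if i = j
    then scal (inverse (vv - inverse vv)) * (kk (rho i (Suc i)) - kk (rho (Suc i) i)) else 0) f I"
    by (simp add: D_def)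
qed

lemma ee_comm: "\<not> adjacent i j \<Longrightarrow> ee i * ee j = ee j * ee i"
proof (rule endo_eqI)
  fix f I
  assume ij: "\<not> adjacent i j"
  show "app (ee i * ee j) f I = app (ee j * ee i) f I"
  proof (induction I arbitrary: f)
    case (Cons x I)
    show ?case using Cons[of "\<lambda>I. f (x # I)"] ij
      apply (cases "i = j"; cases "x = i"; cases "x = j")
      apply (simp_all add: app_add app_cmult ee_wt' adjacent_def)
      apply (simp_all add: rho_def eps_def power_int_minus field_simps)
      done
  qed simp
qed

lemma ff_comm: "\<not> adjacent i j \<Longrightarrow> ff i * ff j = ff j * ff i"
proof (rule endo_eqI)
  fix f I
  assume ij: "\<not> adjacent i j"
  show "app (ff i * ff j) f I = app (ff j * ff i) f I"
  proof (induction I arbitrary: f)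
    case (Cons x I)
    show ?case using Cons[of "\<lambda>I. f (x # I)"] ij
      apply (cases "i = j"; cases "x = i"; cases "x = j"; cases "x = Suc i"; cases "x = Suc j")
      apply (simp_all add: app_add app_cmult ff_wt' adjacent_def)
      apply (simp_all add: rho_def eps_def power_int_minus field_simps)
      done
  qed simp
qed

definition serre_op :: "endo \<Rightarrow> endo \<Rightarrow> endo" where
  "serre_op x y = x * x * y - scal (vv + inverse vv) * x * y * x + y * x * x"

lemma serre_ee: "adjacent i j \<Longrightarrow> serre_op (ee i) (ee j) = 0"
proof (rule endo_eqI)
  fix f I
  assume ij: "adjacent i j"
  show "app (serre_op (ee i) (ee j)) f I = app 0 f I"
  proof (induction I arbitrary: f)
    case (Cons x I)
    \<comment> \<open>The induction hypothesis is solved for its first term, so that it can act as a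
      rewrite rule.\<close>
    have IH: "app (ee i) (app (ee i) (app (ee j) (\<lambda>I. f (x # I)))) I
      = (vv + inverse vv) * app (ee i) (app (ee j) (app (ee i) (\<lambda>I. f (x # I)))) I
        - app (ee j) (app (ee i) (app (ee i) (\<lambda>I. f (x # I)))) I"
      using Cons[of "\<lambda>I. f (x # I)"] by (simp add: serre_op_def app_scal app_cmult algebra_simps)
    show ?case using IH ij
      apply (cases "i = Suc j"; cases "x = i"; cases "x = j")
      apply (simp_all add: serre_op_def app_add app_cmult ee_wt' adjacent_def)
      apply (simp_all add: rho_def eps_def power_int_minus field_simps)
      apply (simp_all add: eval_nat_numeral algebra_simps)?
      done
  qed (simp add: serre_op_def)
qed

lemma serre_ff: "adjacent i j \<Longrightarrow> serre_op (ff i) (ff j) = 0"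
proof (rule endo_eqI)
  fix f I
  assume ij: "adjacent i j"
  show "app (serre_op (ff i) (ff j)) f I = app 0 f I"
  proof (induction I arbitrary: f)
    case (Cons x I)
    have IH: "app (ff i) (app (ff i) (app (ff j) (\<lambda>I. f (x # I)))) I
      = (vv + inverse vv) * app (ff i) (app (ff j) (app (ff i) (\<lambda>I. f (x # I)))) I
        - app (ff j) (app (ff i) (app (ff i) (\<lambda>I. f (x # I)))) I"
      using Cons[of "\<lambda>I. f (x # I)"] by (simp add: serre_op_def app_scal app_cmult algebra_simps)
    show ?case using IH ij
      apply (cases "i = Suc j"; cases "x = i"; cases "x = j"; cases "x = Suc i"; cases "x = Suc j")
      apply (simp_all add: serre_op_def app_add app_cmult ff_wt' adjacent_def)
      apply (simp_all add: rho_def eps_def power_int_minus field_simps)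
      apply (simp_all add: eval_nat_numeral algebra_simps)?
      done
  qed (simp add: serre_op_def)
qed

section \<open>The action of the free algebra\<close>

fun gop :: "gen \<Rightarrow> endo" where
  "gop (GE i) = ee i"
| "gop (GF i) = ff i"
| "gop (GK i) = kk (eps i)"
| "gop (GKinv i) = kk (\<lambda>x. - eps i x)"

definition wop :: "gword \<Rightarrow> endo" where
  "wop w = prod_list (map gop (letters w))"

definition op :: "free_alg \<Rightarrow> endo" where
  "op x = (\<Sum>w\<in>Poly_Mapping.keys x. scal (Poly_Mapping.lookup x w) * wop w)"

lemma wop_plus: "wop (u + w) = wop u * wop w"
  by (simp add: wop_def plus_gword_def)

lemma wop_zero [simp]: "wop 0 = 1"
  by (simp add: wop_def zero_gword_def)

lemma op_superset:
  assumes "finite W" "Poly_Mapping.keys x \<subseteq> W"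
  shows "op x = (\<Sum>w\<in>W. scal (Poly_Mapping.lookup x w) * wop w)"
  unfolding op_def
  by (rule sum.mono_neutral_left) (use assms in \<open>auto simp: in_keys_iff\<close>)

lemma op_add [simp]: "op (x + y) = op x + op y"
proof -
  let ?W = "Poly_Mapping.keys x \<union> Poly_Mapping.keys y"
  have "op (x + y) = (\<Sum>w\<in>?W. scal (Poly_Mapping.lookup (x + y) w) * wop w)"
    by (rule op_superset) (auto dest!: set_mp[OF Poly_Mapping.keys_add])
  then show ?thesis
    by (simp add: op_superset[of ?W x] op_superset[of ?W y] lookup_add scal_add
        distrib_right sum.distrib)
qed

lemma op_0 [simp]: "op 0 = 0"
  by (simp add: op_def)

lemma op_uminus [simp]: "op (- x) = - op x"
  using op_add[of x "- x"] by (simp add: eq_neg_iff_add_eq_0 add.commute)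

lemma op_diff [simp]: "op (x - y) = op x - op y"
  using op_add[of x "- y"] by simp

lemma op_single: "op (Poly_Mapping.single w c) = scal c * wop w"
  by (cases "c = 0") (simp_all add: op_def)

lemma op_cst [simp]: "op (cst c) = scal c"
  by (simp add: cst_def op_single)

lemma op_1 [simp]: "op 1 = 1"
  using op_cst[of 1] by (simp add: cst_def single_one)

lemma op_gen [simp]: "op (gen_elem g) = gop g"
  by (simp add: gen_elem_def op_single wop_def)

lemma free_alg_induct [case_names zero add]:
  fixes x :: free_alg
  assumes "P 0" "\<And>x w c. P x \<Longrightarrow> P (x + Poly_Mapping.single w c)"
  shows "P x"
proof (induction "card (Poly_Mapping.keys x)" arbitrary: x)
  case 0
  then show ?case using assms(1) by simp
next
  case (Suc m)
  then obtain w where w: "w \<in> Poly_Mapping.keys x" by (metis card.empty ex_in_conv nat.simps(3))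
  define y where "y = Poly_Mapping.update w 0 x"
  have "Poly_Mapping.keys y = Poly_Mapping.keys x - {w}"
    unfolding y_def by (rule Poly_Mapping.keys_update[of w 0 x, simplified])
  then have "P y" using Suc w by (simp add: card_Diff_singleton)
  moreover have "x = y + Poly_Mapping.single w (Poly_Mapping.lookup x w)"
    by (rule poly_mapping_eqI) (auto simp: y_def lookup_add lookup_update lookup_single when_def)
  ultimately show ?case using assms(2) by metis
qed

lemma op_mult [simp]: "op (x * y) = op x * op y"
proof (induction x rule: free_alg_induct)
  case (add x u a)
  have "op (Poly_Mapping.single u a * y) = op (Poly_Mapping.single u a) * op y"
  proof (induction y rule: free_alg_induct)
    case (add y w b)
    have "scal (a * b) * wop (u + w) = scal a * wop u * (scal b * wop w)"
      by (metis (no_types) mult.assoc scal_central scal_mult wop_plus)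
    with add show ?case by (simp add: distrib_left mult_single op_single)
  qed simp
  with add show ?case by (simp add: distrib_right)
qed simp

lemma op_power [simp]: "op (x ^ m) = op x ^ m"
  by (induction m) simp_all

section \<open>The defining relations act as zero\<close>

definition C :: "nat \<Rightarrow> free_alg set" where
  "C n = carrier (free_ring n)"

lemma C_iff: "x \<in> C n \<longleftrightarrow> (\<forall>w\<in>Poly_Mapping.keys x. set (letters w) \<subseteq> gens n)"
  by (simp add: C_def free_ring_def)

lemma C_0 [simp]: "0 \<in> C n" by (simp add: C_iff)

lemma C_cst [simp]: "cst c \<in> C n"
  by (simp add: C_iff cst_def zero_gword_def)

lemma C_1 [simp]: "1 \<in> C n"
  using C_cst[of 1 n] by (simp add: cst_def single_one)

lemma C_add [simp]: "x \<in> C n \<Longrightarrow> y \<in> C n \<Longrightarrow> x + y \<in> C n"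
  unfolding C_iff using Poly_Mapping.keys_add[of x y] by blast

lemma C_uminus [simp]: "x \<in> C n \<Longrightarrow> - x \<in> C n"
  by (simp add: C_iff)

lemma C_diff [simp]: "x \<in> C n \<Longrightarrow> y \<in> C n \<Longrightarrow> x - y \<in> C n"
  using C_add[of x n "- y"] by simp

lemma C_mult [simp]: "x \<in> C n \<Longrightarrow> y \<in> C n \<Longrightarrow> x * y \<in> C n"
  unfolding C_iff using keys_mult[of x y] by (fastforce simp: plus_gword_def)

lemma C_power [simp]: "x \<in> C n \<Longrightarrow> x ^ m \<in> C n"
  by (induction m) simp_all

lemma C_prod_list: "set xs \<subseteq> C n \<Longrightarrow> prod_list xs \<in> C n"
  by (induction xs) simp_all

lemma C_gen [simp]: "g \<in> gens n \<Longrightarrow> gen_elem g \<in> C n"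
  by (simp add: C_iff gen_elem_def)

lemma gens_iff [simp]:
  "GE i \<in> gens n \<longleftrightarrow> Suc i < n" "GF i \<in> gens n \<longleftrightarrow> Suc i < n"
  "GK i \<in> gens n \<longleftrightarrow> i < n" "GKinv i \<in> gens n \<longleftrightarrow> i < n"
  by (auto simp: gens_def)

lemma op_relators:
  assumes "r \<in> relators n" shows "r \<in> C n" "op r = 0"
proof -
  have C2: "x * x * y - cst c * x * y * x + y * (x * x) = 0"
    if "x * x * y - cst c * x * y * x + y * x * x = 0" for x y :: free_alg and c
    using that by (simp add: mult.assoc)
  have S: "op (serre (gen_elem g) (gen_elem h)) = serre_op (gop g) (gop h)" for g h
    by (simp add: serre_def serre_op_def power2_eq_square mult.assoc)
  have K: "kk (eps i) * kk (\<lambda>x. - eps i x) = 1" "kk (\<lambda>x. - eps i x) * kk (eps i) = 1" for i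
    by (simp_all add: kk_mult kk_zero)
  have KK: "kk c * kk d = kk d * kk c" for c d
    by (simp add: kk_mult add.commute)
  have KE: "kk (eps i) * ee j - scal (vv powi eps_alpha i j) * ee j * kk (eps i) = 0" for i j
    by (simp add: ee_kk mult.assoc scal_central flip: scal_mult power_int_add)
      (simp add: eps_def eps_alpha_def ee_kk flip: mult.assoc scal_mult power_int_add)
  have KF: "kk (eps i) * ff j - scal (vv powi - eps_alpha i j) * ff j * kk (eps i) = 0" for i j
    by (simp add: ff_kk mult.assoc scal_central flip: scal_mult power_int_add)
      (simp add: eps_def eps_alpha_def ff_kk flip: mult.assoc scal_mult power_int_add)
  have R: "rho i (Suc i) = (\<lambda>x. eps i x + - eps (Suc i) x)" "rho (Suc i) i = (\<lambda>x. - eps i x + eps (Suc i) x)" for i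
    by (auto simp: rho_def)
  have EF: "ee i * ff j - ff j * ee i
        - (if i = j then scal (inverse (vv - inverse vv)) * (kk (eps i) * kk (\<lambda>x. - eps (Suc i) x)
          - kk (\<lambda>x. - eps i x) * kk (eps (Suc i))) else 0) = 0" for i j
    by (simp add: ee_ff_comm kk_mult R)
  show "r \<in> C n" using assms unfolding relators_def serre_def by auto
  show "op r = 0"
    using assms unfolding relators_def
    by (auto simp: S serre_ee serre_ff K KK KE KF EF[simplified] intro: ee_comm ff_comm)
qed

lemma free_ring_simps:
  "carrier (free_ring n) = C n" "x \<oplus>\<^bsub>free_ring n\<^esub> y = x + y" "x \<otimes>\<^bsub>free_ring n\<^esub> y = x * y"
  "\<zero>\<^bsub>free_ring n\<^esub> = 0" "\<one>\<^bsub>free_ring n\<^esub> = 1"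
  by (simp_all add: C_def) (simp_all add: free_ring_def)

lemma ring_free_ring: "ring (free_ring n)"
proof (rule ringI)
  show "abelian_group (free_ring n)"
    by (rule abelian_groupI)
      (auto simp: free_ring_simps add.assoc add.commute intro!: bexI[of _ "- x" for x])
  show "Group.monoid (free_ring n)"
    by (rule monoidI) (simp_all add: free_ring_simps mult.assoc)
qed (simp_all add: free_ring_simps distrib_left distrib_right)

text \<open>The ideal generated by the relators is the least one containing them, hence it lies in
  this one, and the action is constant on its cosets.\<close>

lemma kernel_ideal: "ideal {x \<in> C n. op x = 0} (free_ring n)"
proof (rule idealI)
  show "ring (free_ring n)" by (rule ring_free_ring)
  interpret ring "free_ring n" by (rule ring_free_ring)
  have inv: "\<ominus>\<^bsub>free_ring n\<^esub> x = - x" if "x \<in> C n" for x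
  proof (rule minus_equality)
    show "- x \<oplus>\<^bsub>free_ring n\<^esub> x = \<zero>\<^bsub>free_ring n\<^esub>" by (simp add: free_ring_def)
  qed (use that C_uminus[OF that] in \<open>simp_all add: C_def\<close>)
  show "subgroup {x \<in> C n. op x = 0} (add_monoid (free_ring n))"
  proof (rule group.subgroupI[OF add.is_group])
    show "{x \<in> C n. op x = 0} \<subseteq> carrier (add_monoid (free_ring n))" by (auto simp: C_def)
    show "{x \<in> C n. op x = 0} \<noteq> {}" using C_0 op_0 by blast
    fix a assume a: "a \<in> {x \<in> C n. op x = 0}"
    have "inv\<^bsub>add_monoid (free_ring n)\<^esub> a = - a" using inv a by (simp add: a_inv_def)
    then show "inv\<^bsub>add_monoid (free_ring n)\<^esub> a \<in> {x \<in> C n. op x = 0}" using a by simp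
    fix b assume b: "b \<in> {x \<in> C n. op x = 0}"
    have "a \<otimes>\<^bsub>add_monoid (free_ring n)\<^esub> b = a + b" by (simp add: free_ring_def)
    then show "a \<otimes>\<^bsub>add_monoid (free_ring n)\<^esub> b \<in> {x \<in> C n. op x = 0}" using a b by simp
  qed
next
  fix a x assume ax: "a \<in> {x \<in> C n. op x = 0}" "x \<in> carrier (free_ring n)"
  have "x \<otimes>\<^bsub>free_ring n\<^esub> a = x * a" "a \<otimes>\<^bsub>free_ring n\<^esub> x = a * x"
    by (simp_all add: free_ring_def)
  with ax show "x \<otimes>\<^bsub>free_ring n\<^esub> a \<in> {x \<in> C n. op x = 0}" "a \<otimes>\<^bsub>free_ring n\<^esub> x \<in> {x \<in> C n. op x = 0}"
    by (simp_all flip: C_def)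
qed

lemma rel_ideal_kernel: "x \<in> rel_ideal n \<Longrightarrow> x \<in> C n \<and> op x = 0"
  using ring.genideal_minimal[OF ring_free_ring kernel_ideal, of "relators n" n] op_relators
  unfolding rel_ideal_def by blast

text \<open>It makes each representative a member of its own coset, so that the image of the coset
  under \<open>free_act\<close> is not empty.\<close>

lemma zero_in_rel_ideal: "0 \<in> rel_ideal n"
proof -
  interpret ideal "rel_ideal n" "free_ring n"
    unfolding rel_ideal_def
    by (rule ring.genideal_ideal[OF ring_free_ring]) (use op_relators in \<open>auto simp: C_def\<close>)
  show ?thesis using a_subset zero_closed additive_subgroup.zero_closed[OF is_additive_subgroup]
    by (simp add: free_ring_def)
qed

section \<open>Matrices on tensor space\<close>

definition words :: "nat \<Rightarrow> nat \<Rightarrow> nat list set" where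
  "words n d = {I. length I = d \<and> set I \<subseteq> {..<n}}"

text \<open>The first letter is the most significant digit, in agreement with the index convention
  of \<open>kron\<close>.\<close>

fun enc :: "nat \<Rightarrow> nat list \<Rightarrow> nat" where
  "enc n [] = 0"
| "enc n (x # I) = x * n ^ length I + enc n I"

lemma words_0 [simp]: "words n 0 = {[]}"
  by (auto simp: words_def)

lemma words_Cons [simp]: "x # I \<in> words n (Suc d) \<longleftrightarrow> x < n \<and> I \<in> words n d"
  by (auto simp: words_def)

lemma words_SucE:
  assumes "I \<in> words n (Suc d)" obtains x I' where "I = x # I'" "x < n" "I' \<in> words n d"
  using assms by (cases I) (auto simp: words_def)

lemma words_Suc: "words n (Suc d) = (\<lambda>(x, I). x # I) ` ({..<n} \<times> words n d)"
  by (auto elim!: words_SucE)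

lemma finite_words [simp]: "finite (words n d)"
  by (induction d) (auto simp: words_Suc)

lemma enc_less: "I \<in> words n d \<Longrightarrow> enc n I < n ^ d"
proof (induction d arbitrary: I)
  case (Suc d)
  from Suc.prems obtain x I' where I: "I = x # I'" "x < n" "I' \<in> words n d" by (rule words_SucE)
  have "x * n ^ d + enc n I' < (x + 1) * n ^ d" using Suc.IH[OF I(3)] by simp
  also have "\<dots> \<le> n * n ^ d" using I(2) by (intro mult_right_mono) auto
  finally show ?case using I by (simp add: words_def)
qed simp

lemma enc_div_mod:
  assumes "I \<in> words n d"
  shows "enc n (x # I) div n ^ d = x" "enc n (x # I) mod n ^ d = enc n I"
proof -
  have "enc n I < n ^ d" "length I = d" using enc_less[OF assms] assms by (auto simp: words_def)
  moreover from this have "n ^ d \<noteq> 0" by linarith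
  ultimately show "enc n (x # I) div n ^ d = x" "enc n (x # I) mod n ^ d = enc n I"
    by simp_all
qed

lemma bij_enc: "bij_betw (enc n) (words n d) {..<n ^ d}"
proof -
  have inj: "inj_on (enc n) (words n d)"
  proof (induction d)
    case (Suc d)
    show ?case
    proof (rule inj_onI)
      fix I J assume "I \<in> words n (Suc d)" "J \<in> words n (Suc d)" and e: "enc n I = enc n J"
      then obtain x I' y J' where "I = x # I'" "I' \<in> words n d" "J = y # J'" "J' \<in> words n d"
        by (metis words_SucE)
      then show "I = J"
        using e enc_div_mod[of I' n d x] enc_div_mod[of J' n d y] Suc by (metis inj_onD)
    qed
  qed simp
  have "card (words n d) = n ^ d"
    by (induction d) (auto simp: words_Suc card_image inj_on_def card_cartesian_product)
  then have "enc n ` words n d = {..<n ^ d}"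
    using enc_less by (intro card_subset_eq) (auto simp: card_image[OF inj])
  with inj show ?thesis by (simp add: bij_betw_def)
qed

lemma enc_inj: "I \<in> words n d \<Longrightarrow> J \<in> words n d \<Longrightarrow> enc n I = enc n J \<longleftrightarrow> I = J"
  using bij_enc[of n d] by (auto simp: bij_betw_def inj_on_def)

lemma enc_surj: assumes "r < n ^ d" obtains I where "I \<in> words n d" "r = enc n I"
proof -
  have "r \<in> enc n ` words n d" using bij_enc[of n d] assms by (simp add: bij_betw_def)
  then show thesis using that by blast
qed

lemma sum_enc: "(\<Sum>k<n ^ d. f k) = (\<Sum>K\<in>words n d. f (enc n K))"
  by (rule sum.reindex_bij_betw[OF bij_enc, symmetric])

definition delta :: "nat list \<Rightarrow> tens" where
  "delta J I = (if I = J then 1 else 0)"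

text \<open>Operators see words with arbitrary letters, matrices only those in
  \<open>words n d\<close>. This property lets the two be compared; for \<open>ee i\<close> it
  depends on Suc i < n, as this operator reads the letter Suc i.\<close>

definition local_op :: "nat \<Rightarrow> nat \<Rightarrow> endo \<Rightarrow> bool" where
  "local_op n d a \<longleftrightarrow> (\<forall>f g. (\<forall>I\<in>words n d. f I = g I) \<longrightarrow> (\<forall>I\<in>words n d. app a f I = app a g I))"

lemma local_opD:
  "local_op n d a \<Longrightarrow> (\<And>I. I \<in> words n d \<Longrightarrow> f I = g I) \<Longrightarrow> J \<in> words n d \<Longrightarrow> app a f J = app a g J"
  unfolding local_op_def by blast

lemma local_op_mult: "local_op n d a \<Longrightarrow> local_op n d b \<Longrightarrow> local_op n d (a * b)"
  unfolding local_op_def by (simp add: app_times)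

lemma local_op_sum: "(\<And>w. w \<in> W \<Longrightarrow> local_op n d (a w)) \<Longrightarrow> local_op n d (\<Sum>w\<in>W. a w)"
  unfolding local_op_def app_sum by (auto intro!: sum.cong)

lemma local_op_gop: assumes "g \<in> gens n" shows "local_op n d (gop g)"
proof -
  have "app (gop g) f I = app (gop g) h I"
    if "I \<in> words n d" "\<And>I. I \<in> words n d \<Longrightarrow> f I = h I" for f h I
    using that
  proof (induction d arbitrary: f h I)
    case 0
    then show ?case by (cases g) (simp_all add: app_kk)
  next
    case (Suc d)
    from Suc.prems(1) obtain x I' where I: "I = x # I'" "x < n" "I' \<in> words n d" by (rule words_SucE)
    have e: "app (gop g) (\<lambda>I. f (x # I)) I' = app (gop g) (\<lambda>I. h (x # I)) I'"
      by (rule Suc.IH) (use I Suc.prems in auto)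
    show ?case
    proof (cases g)
      case (GE i)
      then show ?thesis using e I assms Suc.prems(2) by simp
    next
      case (GF i)
      then show ?thesis using e I assms Suc.prems(2) by simp
    qed (use I Suc.prems in \<open>simp_all add: app_kk\<close>)
  qed
  then show ?thesis unfolding local_op_def by blast
qed

lemma local_op_op: assumes "x \<in> C n" shows "local_op n d (op x)"
  unfolding op_def
proof (rule local_op_sum, rule local_op_mult)
  fix w assume w: "w \<in> Poly_Mapping.keys x"
  show "local_op n d (scal c)" for c unfolding local_op_def by simp
  have "local_op n d (prod_list (map gop l))" if "set l \<subseteq> gens n" for l
    using that by (induction l) (auto simp: local_op_def[of _ _ 1] intro!: local_op_mult local_op_gop)
  then show "local_op n d (wop w)"
    using w assms by (simp add: wop_def C_iff)
qed

lemma app_expand: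
  assumes "local_op n d a" "I \<in> words n d"
  shows "app a f I = (\<Sum>K\<in>words n d. app a (delta K) I * f K)"
proof -
  have "app a (\<lambda>I. \<Sum>K\<in>S. f K * delta K I) = (\<lambda>I. \<Sum>K\<in>S. f K * app a (delta K) I)" for S
    by (induction S rule: infinite_finite_induct) (simp_all add: app_zero app_add app_cmult)
  moreover have "app a f I = app a (\<lambda>I. \<Sum>K\<in>words n d. f K * delta K I) I"
    by (rule local_opD[OF assms(1) _ assms(2)]) (simp add: delta_def if_distrib cong: if_cong)
  ultimately show ?thesis by (simp add: mult.commute)
qed

section \<open>Kronecker products and the matrices of the generators\<close>

lemma kron_carrier: "A \<in> carrier_mat a b \<Longrightarrow> B \<in> carrier_mat c d \<Longrightarrow> kron A B \<in> carrier_mat (a * c) (b * d)"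
  by (auto simp: kron_def)

lemma nat_mod_carrier [simp]: "nat_mod n g \<in> carrier_mat n n"
  by (cases g) simp_all

lemma nat_mod_mult_carrier [simp]: "nat_mod n g * nat_mod n h \<in> carrier_mat n n"
  by (rule mult_carrier_mat[OF nat_mod_carrier nat_mod_carrier])

lemma tensor_mod_carrier [simp]: "tensor_mod n d g \<in> carrier_mat (n ^ d) (n ^ d)"
proof (induction d arbitrary: g)
  case 0
  then show ?case by (cases g) simp_all
next
  case (Suc d)
  have "kron A B \<in> carrier_mat (n ^ Suc d) (n ^ Suc d)"
    if "A \<in> carrier_mat n n" "B \<in> carrier_mat (n ^ d) (n ^ d)" for A B :: "Qv mat"
    using kron_carrier[OF that] by simp
  then show ?case using Suc
    by (cases g) (auto simp del: nat_mod.simps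
        intro!: mult_carrier_mat[OF Suc Suc])
qed

lemma kron_entry:
  assumes "A \<in> carrier_mat n n" "B \<in> carrier_mat (n ^ d) (n ^ d)"
    "x < n" "y < n" "I \<in> words n d" "J \<in> words n d"
  shows "kron A B $$ (enc n (x # I), enc n (y # J)) = A $$ (x, y) * B $$ (enc n I, enc n J)"
proof -
  have "enc n (x # I) < n * n ^ d" "enc n (y # J) < n * n ^ d"
    using enc_less[of "x # I" n "Suc d"] enc_less[of "y # J" n "Suc d"] assms by auto
  then show ?thesis
    unfolding kron_def using assms enc_div_mod[OF assms(5)] enc_div_mod[OF assms(6)]
    by (auto simp del: enc.simps)
qed

lemma mat_mult_enc:
  assumes "A \<in> carrier_mat (n ^ d) (n ^ d)" "B \<in> carrier_mat (n ^ d) (n ^ d)"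
    "I \<in> words n d" "J \<in> words n d"
  shows "(A * B) $$ (enc n I, enc n J)
    = (\<Sum>K\<in>words n d. A $$ (enc n I, enc n K) * B $$ (enc n K, enc n J))"
proof -
  have "(A * B) $$ (enc n I, enc n J)
      = (\<Sum>k<n ^ d. A $$ (enc n I, k) * B $$ (k, enc n J))"
    using assms enc_less[of I n d] enc_less[of J n d]
    by (auto simp: scalar_prod_def intro!: sum.cong)
  then show ?thesis by (simp add: sum_enc)
qed

lemma delta_Cons: "(\<lambda>I. delta (y # J) (x # I)) = (if x = y then delta J else (\<lambda>I. 0))"
  by (auto simp: delta_def)

lemma delta_Cons': "delta (y # J) (x # I) = (if x = y then delta J I else 0)"
  by (auto simp: delta_def)

lemma delta_eq: "I = J \<Longrightarrow> delta J I = 1" "I \<noteq> J \<Longrightarrow> delta J I = 0"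
  by (auto simp: delta_def)

text \<open>Both sides follow the same comultiplication, once through Kronecker products and once
  through the first letter of a word, so the induction runs over the number of tensor
  factors.\<close>

lemma tensor_mod_entry:
  assumes "g \<in> gens n" "I \<in> words n d" "J \<in> words n d"
  shows "tensor_mod n d g $$ (enc n I, enc n J) = app (gop g) (delta J) I"
  using assms
proof (induction d arbitrary: g I J)
  case 0
  then show ?case by (cases g) (simp_all add: app_kk delta_def)
next
  case (Suc d)
  from Suc.prems obtain x I' y J' where I: "I = x # I'" "x < n" "I' \<in> words n d"
    and J: "J = y # J'" "y < n" "J' \<in> words n d"
    by (metis words_SucE)
  note ke = kron_entry[OF _ _ I(2) J(2) I(3) J(3)]
  have ld: "enc n I < n ^ Suc d" "enc n J < n ^ Suc d"
    using enc_less Suc.prems by blast+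
  have ld': "enc n I' < n ^ d" "enc n J' < n ^ d"
    using enc_less I J by auto
  have c: "kron A B \<in> carrier_mat (n ^ Suc d) (n ^ Suc d)"
    if "A \<in> carrier_mat n n" "B \<in> carrier_mat (n ^ d) (n ^ d)" for A B :: "Qv mat"
    using kron_carrier[OF that] by simp
  have tt: "tensor_mod n d g * tensor_mod n d h \<in> carrier_mat (n ^ d) (n ^ d)" for g h
    by (rule mult_carrier_mat[OF tensor_mod_carrier tensor_mod_carrier])
  have ks: "(kron A B + kron A' B') $$ (enc n I, enc n J)
      = A $$ (x, y) * B $$ (enc n I', enc n J') + A' $$ (x, y) * B' $$ (enc n I', enc n J')"
    if "A \<in> carrier_mat n n" "B \<in> carrier_mat (n ^ d) (n ^ d)"
      "A' \<in> carrier_mat n n" "B' \<in> carrier_mat (n ^ d) (n ^ d)" for A B A' B' :: "Qv mat"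
  proof -
    have "(kron A B + kron A' B') $$ (enc n I, enc n J)
        = kron A B $$ (enc n I, enc n J) + kron A' B' $$ (enc n I, enc n J)"
      by (rule index_add_mat(1)) (use ld c[OF that(3,4)] in auto)
    then show ?thesis unfolding I(1) J(1) ke[OF that(1,2)] ke[OF that(3,4)] .
  qed
  have kp: "(tensor_mod n d (GK i) * tensor_mod n d (GKinv j)) $$ (enc n I', enc n J')
      = (if I' = J' then vv powi (wt (rho i j) I') else 0)" if "i < n" "j < n" for i j
  proof -
    have "(tensor_mod n d (GK i) * tensor_mod n d (GKinv j)) $$ (enc n I', enc n J')
      = (\<Sum>K\<in>words n d. vv powi (wt (eps i) I') * delta K I' * (vv powi (- wt (eps j) K) * delta J' K))"
      using I J that by (subst mat_mult_enc[of _ n d])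
        (auto simp: Suc.IH app_kk wt_uminus intro!: sum.cong)
    also have "\<dots> = (\<Sum>K\<in>words n d. if I' = K then (if I' = J' then vv powi (wt (rho i j) I') else 0) else 0)"
      by (intro sum.cong) (auto simp: delta_def wt_rho power_int_diff power_int_minus field_simps)
    finally show ?thesis using I by simp
  qed
  have dz: "app a (\<lambda>I. 0) I = 0" for a I by (simp add: app_zero)
  show ?case
  proof (cases g)
    case (GE i)
    have "tensor_mod n (Suc d) g $$ (enc n I, enc n J) =
      nat_mod n (GE i) $$ (x, y) * (tensor_mod n d (GK i) * tensor_mod n d (GKinv (Suc i))) $$ (enc n I', enc n J')
      + 1\<^sub>m n $$ (x, y) * tensor_mod n d (GE i) $$ (enc n I', enc n J')"
      unfolding GE tensor_mod.simps by (rule ks) (simp_all add: tt del: nat_mod.simps)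
    also have "\<dots> = app (gop g) (delta J) I"
      using GE Suc.prems I J Suc.IH[of "GE i" I' J'] kp[of i "Suc i"]
      by (cases "x = y") (auto simp: delta_Cons delta_Cons' dz delta_eq)
    finally show ?thesis .
  next
    case (GF i)
    have m: "(nat_mod n (GKinv i) * nat_mod n (GK (Suc i))) $$ (x, y)
        = (if x = y then vv powi (rho (Suc i) i x) else 0)"
    proof -
      have "(nat_mod n (GKinv i) * nat_mod n (GK (Suc i))) $$ (x, y)
        = (\<Sum>k<n. nat_mod n (GKinv i) $$ (x, k) * nat_mod n (GK (Suc i)) $$ (k, y))"
        using I J by (auto simp: scalar_prod_def intro!: sum.cong)
      also have "\<dots> = (\<Sum>k<n. if x = k then (if x = y then vv powi (rho (Suc i) i x) else 0) else 0)"
        using I J by (intro sum.cong) (auto simp: rho_def eps_def power_int_minus)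
      finally show ?thesis using I by simp
    qed
    have "tensor_mod n (Suc d) g $$ (enc n I, enc n J) =
      nat_mod n (GF i) $$ (x, y) * 1\<^sub>m (n ^ d) $$ (enc n I', enc n J')
      + (nat_mod n (GKinv i) * nat_mod n (GK (Suc i))) $$ (x, y) * tensor_mod n d (GF i) $$ (enc n I', enc n J')"
      unfolding GF tensor_mod.simps by (rule ks) (simp_all del: nat_mod.simps)
    also have "\<dots> = app (gop g) (delta J) I"
      using GF Suc.prems I J Suc.IH[of "GF i" I' J'] m ld'
      by (cases "x = y") (auto simp: delta_Cons delta_Cons' dz delta_eq enc_inj simp del: nat_mod.simps(3,4))
    finally show ?thesis .
  next
    case (GK i)
    then show ?thesis
      using Suc.prems I J Suc.IH[of "GK i" I' J'] ke[of "nat_mod n (GK i)" "tensor_mod n d (GK i)"]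
      by (auto simp: app_kk delta_def eps_def power_int_add simp del: enc.simps)
  next
    case (GKinv i)
    then show ?thesis
      using Suc.prems I J Suc.IH[of "GKinv i" I' J'] ke[of "nat_mod n (GKinv i)" "tensor_mod n d (GKinv i)"]
      by (auto simp: app_kk delta_def eps_def power_int_add power_int_diff power_int_minus divide_inverse mult.commute simp del: enc.simps)
  qed
qed

section \<open>The free algebra acting by matrices\<close>

lemma word_act_carrier [simp]: "word_act n d w \<in> carrier_mat (n ^ d) (n ^ d)"
proof -
  have "foldr (\<lambda>g M. tensor_mod n d g * M) l (1\<^sub>m (n ^ d)) \<in> carrier_mat (n ^ d) (n ^ d)" for l
    by (induction l) (auto intro: mult_carrier_mat[OF tensor_mod_carrier])
  then show ?thesis by (simp add: word_act_def)
qed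

lemma word_act_entry:
  assumes "set (letters w) \<subseteq> gens n" "I \<in> words n d" "J \<in> words n d"
  shows "word_act n d w $$ (enc n I, enc n J) = app (wop w) (delta J) I"
proof -
  have "foldr (\<lambda>g M. tensor_mod n d g * M) l (1\<^sub>m (n ^ d)) $$ (enc n I, enc n J)
      = app (prod_list (map gop l)) (delta J) I" if "set l \<subseteq> gens n" for l
    using that assms(2)
  proof (induction l arbitrary: I)
    case Nil
    then show ?case using assms(3) enc_less by (auto simp: delta_def enc_inj)
  next
    case (Cons g l)
    have c: "foldr (\<lambda>g M. tensor_mod n d g * M) l (1\<^sub>m (n ^ d)) \<in> carrier_mat (n ^ d) (n ^ d)"
      using word_act_carrier[of n d "GWord l"] by (simp add: word_act_def)
    show ?case
      using Cons assms(3) app_expand[OF local_op_gop[of g n d] Cons.prems(2), of "app (prod_list (map gop l)) (delta J)"]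
      by (simp add: mat_mult_enc[OF tensor_mod_carrier c] tensor_mod_entry)
  qed
  then show ?thesis using assms by (simp add: word_act_def wop_def)
qed

lemma free_act_carrier [simp]: "free_act n d x \<in> carrier_mat (n ^ d) (n ^ d)"
  by (simp add: free_act_def)

lemma free_act_dim [simp]: "dim_row (free_act n d x) = n ^ d" "dim_col (free_act n d x) = n ^ d"
  by (simp_all add: free_act_def)

lemma free_act_entry:
  assumes "x \<in> C n" "I \<in> words n d" "J \<in> words n d"
  shows "free_act n d x $$ (enc n I, enc n J) = app (op x) (delta J) I"
  using assms enc_less by (auto simp: free_act_def op_def app_sum C_iff word_act_entry intro!: sum.cong)

lemma mat_eq_encI:
  assumes "A \<in> carrier_mat (n ^ d) (n ^ d)" "B \<in> carrier_mat (n ^ d) (n ^ d)"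
    "\<And>I J. I \<in> words n d \<Longrightarrow> J \<in> words n d \<Longrightarrow> A $$ (enc n I, enc n J) = B $$ (enc n I, enc n J)"
  shows "A = B"
proof (rule eq_matI)
  fix r c assume "r < dim_row B" "c < dim_col B"
  then obtain I J where "I \<in> words n d" "r = enc n I" "J \<in> words n d" "c = enc n J"
    using assms(2) by (metis carrier_matD enc_surj)
  then show "A $$ (r, c) = B $$ (r, c)" using assms(3) by simp
qed (use assms in auto)

lemma free_act_cong: "x \<in> C n \<Longrightarrow> y \<in> C n \<Longrightarrow> op x = op y \<Longrightarrow> free_act n d x = free_act n d y"
  by (rule mat_eq_encI[of _ n d]) (simp_all add: free_act_entry)

lemma free_act_add: "x \<in> C n \<Longrightarrow> y \<in> C n \<Longrightarrow> free_act n d (x + y) = free_act n d x + free_act n d y"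
  by (rule mat_eq_encI[of _ n d]) (simp_all add: free_act_entry index_add_mat enc_less)

lemma free_act_cst_mult: "x \<in> C n \<Longrightarrow> free_act n d (cst a * x) = a \<cdot>\<^sub>m free_act n d x"
  by (rule mat_eq_encI[of _ n d]) (simp_all add: free_act_entry enc_less)

lemma free_act_mult:
  assumes "x \<in> C n" "y \<in> C n"
  shows "free_act n d (x * y) = free_act n d x * free_act n d y"
proof (rule mat_eq_encI[of _ n d])
  show "free_act n d x * free_act n d y \<in> carrier_mat (n ^ d) (n ^ d)"
    by (rule mult_carrier_mat[OF free_act_carrier free_act_carrier])
  fix I J assume IJ: "I \<in> words n d" "J \<in> words n d"
  show "free_act n d (x * y) $$ (enc n I, enc n J) = (free_act n d x * free_act n d y) $$ (enc n I, enc n J)"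
    using assms IJ
    by (simp add: free_act_entry mat_mult_enc[OF free_act_carrier free_act_carrier]
        app_expand[OF local_op_op, of x n I d "app (op y) (delta J)"])
qed simp

lemma free_act_1: "free_act n d 1 = 1\<^sub>m (n ^ d)"
  by (rule mat_eq_encI[of _ n d]) (auto simp: free_act_entry delta_def enc_inj enc_less)

lemma free_act_0: "free_act n d 0 = 0\<^sub>m (n ^ d) (n ^ d)"
  by (rule mat_eq_encI[of _ n d]) (auto simp: free_act_entry enc_less)

lemma img_eq: assumes "x \<in> C n" shows "img n d x = free_act n d x"
proof -
  have "to_U n x = (\<lambda>h. h + x) ` rel_ideal n"
    by (auto simp: to_U_def a_r_coset_def r_coset_def free_ring_def)
  then have "free_act n d ` to_U n x = {free_act n d x}"
    using zero_in_rel_ideal[of n] rel_ideal_kernel assms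
    by (force simp: image_iff intro!: free_act_cong)
  then show ?thesis by (simp add: img_def U_act_def)
qed

lemma qSchur_eq: "qSchur n d = free_act n d ` C n"
proof -
  have "carrier (U_gl n) = to_U n ` C n"
    by (auto simp: U_gl_def FactRing_def A_RCOSETS_def' to_U_def C_def)
  then have "qSchur n d = (\<lambda>x. img n d x) ` C n"
    by (simp add: qSchur_def img_def image_image)
  then show ?thesis using img_eq by (simp cong: image_cong_simp)
qed

section \<open>The Hecke operators\<close>

text \<open>
  These commute with the action of every generator, and they move \<^term>\<open>delta J\<close> to all
  rearrangements of \<open>J\<close>. So an element of the \<open>q\<close>-Schur algebra is known once its
  columns at the sorted words \<open>J\<close> are.
\<close>

fun hecke :: "nat \<Rightarrow> tens \<Rightarrow> tens" where
  "hecke 0 f (a # b # I) = (if a = b then vv * f (a # b # I) else if a < b then f (b # a # I)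
     else f (b # a # I) + (vv - inverse vv) * f (a # b # I))"
| "hecke (Suc p) f (x # I) = hecke p (\<lambda>I. f (x # I)) I"
| "hecke p f I = f I"

lemma linear_hecke: "linear_op (hecke p)"
proof -
  have "hecke p (\<lambda>I. f I + g I) I = hecke p f I + hecke p g I" for f g I
  proof (induction p f I arbitrary: g rule: hecke.induct)
    case (2 p f x I)
    show ?case using 2[of "\<lambda>I. g (x # I)"] by simp
  qed (auto simp: algebra_simps)
  moreover have "hecke p (\<lambda>I. c * f I) I = c * hecke p f I" for c f I
    by (induction p f I rule: hecke.induct) (auto simp: algebra_simps)
  ultimately show ?thesis by (auto simp: linear_op_def)
qed

definition hk :: "nat \<Rightarrow> endo" where "hk p = Endo (hecke p)"

lemma app_hk [simp]:
  "app (hk 0) f (a # b # I) = (if a = b then vv * f (a # b # I) else if a < b then f (b # a # I)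
     else f (b # a # I) + (vv - inverse vv) * f (a # b # I))"
  "app (hk (Suc p)) f (x # I) = app (hk p) (\<lambda>I. f (x # I)) I"
  "app (hk p) f [] = f []" "app (hk 0) f [a] = f [a]"
  by (simp_all add: hk_def app_Endo linear_hecke)

lemma hk_wt: "app (hk p) (\<lambda>I. vv powi (wt c I) * f I) = (\<lambda>I. vv powi (wt c I) * app (hk p) f I)"
proof
  fix I
  have "hecke p (\<lambda>I. vv powi (wt c I + k) * f I) I = vv powi (wt c I + k) * hecke p f I" for k
  proof (induction p f I arbitrary: k rule: hecke.induct)
    case (1 f a b I)
    then show ?case by (auto simp: algebra_simps)
  next
    case (2 p f x I)
    show ?case using 2[of "k + c x"] by (simp add: ac_simps)
  qed auto
  from this[of 0] show "app (hk p) (\<lambda>I. vv powi (wt c I) * f I) I = vv powi (wt c I) * app (hk p) f I"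
    by (simp add: hk_def app_Endo linear_hecke)
qed

lemma hk_kk: "kk c * hk p = hk p * kk c"
  by (rule endo_eqI) (simp add: app_kk hk_wt)

text \<open>For an exchange at the front only the order of two letters and their relation to i and i
  + 1 matter. A deeper exchange passes through the first letter because the K-factor depends on the
  weight of the tail only, which exchanges preserve.\<close>

lemma hk_ee: "ee i * hk p = hk p * ee i"
proof (rule endo_eqI)
  fix f I
  have "app (ee i) (app (hk p) f) I = app (hk p) (app (ee i) f) I"
  proof (induction p arbitrary: f I)
    case 0
    show ?case
    proof (cases I)
      case (Cons a I')
      show ?thesis
      proof (cases I')
        case Nil
        then show ?thesis using Cons by simp
      next
        case (Cons b I'')
        note I = \<open>I = a # I'\<close> Cons
        consider "a = b" | "a < b" | "a > b" by linarith
        then show ?thesis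
        proof cases
          case 1
          then show ?thesis unfolding I
            by (cases "a = i") (simp_all add: app_cmult rho_def eps_def power_int_add power_int_diff power_int_minus field_simps)
        next
          case 2
          then show ?thesis unfolding I
            by (cases "a = i"; cases "b = i"; cases "b = Suc i")
              (simp_all add: app_add app_cmult rho_def eps_def power_int_add power_int_diff power_int_minus field_simps)
        next
          case 3
          have *: "app (ee i) (\<lambda>I. g I + (vv - inverse vv) * h I) I''
            = app (ee i) g I'' + (vv - inverse vv) * app (ee i) h I''" for g h
            by (simp only: app_add app_cmult)
          from 3 show ?thesis unfolding I
            by (cases "a = i"; cases "b = i"; cases "a = Suc i")
              (simp_all add: *, simp_all add: rho_def eps_def power_int_add power_int_diff power_int_minus field_simps)
        qed
      qed
    qed simp
  next
    case (Suc p)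
    show ?case
      by (cases I) (simp_all add: app_add Suc hk_wt app_zero)
  qed
  then show "app (ee i * hk p) f I = app (hk p * ee i) f I" by simp
qed

lemma hk_ff: "ff i * hk p = hk p * ff i"
proof (rule endo_eqI)
  fix f I
  have "app (ff i) (app (hk p) f) I = app (hk p) (app (ff i) f) I"
  proof (induction p arbitrary: f I)
    case 0
    show ?case
    proof (cases I)
      case (Cons a I')
      show ?thesis
      proof (cases I')
        case Nil
        then show ?thesis using Cons by simp
      next
        case (Cons b I'')
        note I = \<open>I = a # I'\<close> Cons
        consider "a = b" | "a < b" | "a > b" by linarith
        then show ?thesis
        proof cases
          case 1
          then show ?thesis unfolding I
            by (cases "a = i"; cases "a = Suc i")
              (simp_all add: app_cmult rho_def eps_def power_int_diff power_int_minus field_simps)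
        next
          case 2
          then show ?thesis unfolding I
            by (cases "a = i"; cases "b = i"; cases "b = Suc i"; cases "a = Suc i")
              (simp_all add: app_add app_cmult rho_def eps_def power_int_add power_int_diff power_int_minus field_simps)
        next
          case 3
          have *: "app (ff i) (\<lambda>I. g I + (vv - inverse vv) * h I) I''
            = app (ff i) g I'' + (vv - inverse vv) * app (ff i) h I''" for g h
            by (simp only: app_add app_cmult)
          from 3 show ?thesis unfolding I
            by (cases "a = i"; cases "b = i"; cases "a = Suc i"; cases "b = Suc i")
              (simp_all add: *, simp_all add: rho_def eps_def power_int_add power_int_diff power_int_minus field_simps)
        qed
      qed
    qed simp
  next
    case (Suc p)
    show ?case
      by (cases I) (simp_all add: app_add app_cmult Suc app_zero)
  qed
  then show "app (ff i * hk p) f I = app (hk p * ff i) f I" by simp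
qed

lemma hk_wop: "wop w * hk p = hk p * wop w"
proof -
  have g: "gop g * hk p = hk p * gop g" for g
    by (cases g) (simp_all add: hk_ee hk_ff hk_kk)
  have "prod_list (map gop l) * hk p = hk p * prod_list (map gop l)" for l
    by (induction l) (simp_all add: mult.assoc, simp flip: mult.assoc add: g)
  then show ?thesis by (simp add: wop_def)
qed

lemma hk_op: "op x * hk p = hk p * op x"
proof -
  have "scal c * wop w * hk p = hk p * (scal c * wop w)" for c w
    by (metis hk_wop mult.assoc scal_central)
  then show ?thesis by (simp add: op_def sum_distrib_left sum_distrib_right)
qed

lemma app_op_hk: "app (op x) (app (hk p) f) = app (hk p) (app (op x) f)"
  using hk_op[of x p] by (metis app_times)

lemma hk_at: "app (hk (length L)) f (L @ a # b # R)
    = (if a = b then vv * f (L @ a # b # R) else if a < b then f (L @ b # a # R)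
     else f (L @ b # a # R) + (vv - inverse vv) * f (L @ a # b # R))"
  by (induction L arbitrary: f) auto

lemma hk_not_at: "length I < length L + 2 \<Longrightarrow> app (hk (length L)) f I = f I"
proof (induction L arbitrary: f I)
  case Nil
  then show ?case by (cases I; cases "tl I") auto
next
  case (Cons x L)
  then show ?case by (cases I) auto
qed

lemma hk_cases:
  fixes I :: "nat list"
  obtains I1 a b I3 where "I = I1 @ a # b # I3" "length I1 = p" | "length I < p + 2"
proof (cases "length I < p + 2")
  case False
  then have "I = take p I @ I ! p # drop (Suc p) I" "drop (Suc p) I = I ! Suc p # drop (Suc (Suc p)) I"
    by (auto intro!: id_take_nth_drop Cons_nth_drop_Suc[symmetric])
  then have "I = take p I @ I ! p # I ! Suc p # drop (Suc (Suc p)) I" by simp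
  then show ?thesis using that(1)[of "take p I"] False by simp
qed (use that in blast)

text \<open>The operator is symmetric with respect to the basis of words, hence the same three cases
  as for coordinates.\<close>

lemma hk_delta:
  "app (hk (length L)) (delta (L @ a # b # R)) = (if a = b then (\<lambda>I. vv * delta (L @ a # b # R) I)
    else if a < b then delta (L @ b # a # R)
    else (\<lambda>I. delta (L @ b # a # R) I + (vv - inverse vv) * delta (L @ a # b # R) I))"
proof
  fix I
  show "app (hk (length L)) (delta (L @ a # b # R)) I = (if a = b then (\<lambda>I. vv * delta (L @ a # b # R) I)
    else if a < b then delta (L @ b # a # R)
    else (\<lambda>I. delta (L @ b # a # R) I + (vv - inverse vv) * delta (L @ a # b # R) I)) I"
  proof (rule hk_cases[of I "length L"])
    fix I1 c e I3 assume "I = I1 @ c # e # I3" "length I1 = length L"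
    then show ?thesis using hk_at[of I1 "delta (L @ a # b # R)" c e I3] by (auto simp: delta_def)
  next
    assume "length I < length L + 2"
    moreover from this have "I \<noteq> L @ c # e # R" for c e by auto
    ultimately show ?thesis by (simp add: hk_not_at delta_eq)
  qed
qed

text \<open>Adjacent transpositions generate all rearrangements: the tail is rearranged first, then
  the head is moved to its place step by step.\<close>

lemma swap_induct:
  fixes I J :: "'a list"
  assumes swap: "\<And>L a b R. P (L @ a # b # R) \<Longrightarrow> P (L @ b # a # R)"
    and "mset I = mset J" "P I"
  shows "P J"
  using assms
proof (induction I arbitrary: J P)
  case (Cons a I)
  note sw = Cons.prems(1)
  have "a \<in> set J" using Cons.prems(2) by (metis list.set_intros(1) set_mset_mset)
  then obtain L R where J: "J = L @ a # R" by (meson split_list)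
  have "P (a # (L @ R))"
  proof (rule Cons.IH[of "\<lambda>I. P (a # I)"])
    fix L b c R assume "P (a # L @ b # c # R)"
    then show "P (a # L @ c # b # R)" using Cons.prems(1)[of "a # L"] by simp
  qed (use Cons.prems J in auto)
  then have "P (a # L @ R)" by simp
  moreover have "P (K @ a # L @ R) \<Longrightarrow> P (K @ L @ a # R)" for K
  proof (induction L arbitrary: K)
    case (Cons b L)
    from sw[OF Cons.prems[unfolded append_Cons]] have "P ((K @ [b]) @ a # L @ R)" by simp
    from Cons.IH[OF this] show ?case by simp
  qed simp
  from this[of "[]"] show ?case using calculation J by simp
qed simp

lemma determined_by_rearrangement:
  assumes "mset J = mset J'" and J: "\<And>I. I \<in> words n d \<Longrightarrow> app (op x) (delta J) I = 0"
    and "I \<in> words n d"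
  shows "app (op x) (delta J') I = 0"
proof -
  have h: "app (hk (length L)) f I = 0" if f: "\<And>I. I \<in> words n d \<Longrightarrow> f I = 0" and I: "I \<in> words n d" for f I L
  proof (rule hk_cases[of I "length L"])
    fix I1 a b I3 assume e: "I = I1 @ a # b # I3" "length I1 = length L"
    then have "I1 @ b # a # I3 \<in> words n d" using I by (auto simp: words_def)
    from f[OF this] f[OF I] show ?thesis using hk_at[of I1 f a b I3] e by auto
  qed (use f I in \<open>simp add: hk_not_at\<close>)
  have "\<forall>I\<in>words n d. app (op x) (delta J') I = 0"
  proof (rule swap_induct[OF _ assms(1), where P = "\<lambda>J. \<forall>I\<in>words n d. app (op x) (delta J) I = 0"])
    fix L a b R
    assume *: "\<forall>I\<in>words n d. app (op x) (delta (L @ a # b # R)) I = 0"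
    let ?J = "L @ a # b # R"
    \<comment> \<open>\<open>hk_delta\<close> is solved for the basis vector of the exchanged word;
      the coefficient is the correction in each of its three cases.\<close>
    have "delta (L @ b # a # R) = (\<lambda>I. app (hk (length L)) (delta ?J) I
        + (if a = b then 1 - vv else if a < b then 0 else - (vv - inverse vv)) * delta ?J I)"
      unfolding hk_delta by (auto simp: fun_eq_iff algebra_simps)
    then have "app (op x) (delta (L @ b # a # R)) = (\<lambda>I. app (hk (length L)) (app (op x) (delta ?J)) I
        + (if a = b then 1 - vv else if a < b then 0 else - (vv - inverse vv)) * app (op x) (delta ?J) I)"
      by (simp only: app_add app_cmult app_op_hk)
    moreover have "app (hk (length L)) (app (op x) (delta ?J)) I = 0" if "I \<in> words n d" for I
      using * that by (intro h) blast+
    ultimately show "\<forall>I\<in>words n d. app (op x) (delta (L @ b # a # R)) I = 0"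
      using * by simp
  qed (use J in auto)
  then show ?thesis using assms(3) by blast
qed

text \<open>If J has equal neighbours, its basis vector is an eigenvector of the Hecke operator
  there, with eigenvalue v. Its image under an operator that commutes with the Hecke operators
  inherits this, and on coordinates it becomes the relation stated here.\<close>

definition qsym :: "tens \<Rightarrow> nat list \<Rightarrow> bool" where
  "qsym f J \<longleftrightarrow> (\<forall>J1 c J3 I1 a b I3. J = J1 @ c # c # J3 \<longrightarrow> length I1 = length J1 \<longrightarrow> a < b
     \<longrightarrow> f (I1 @ b # a # I3) = vv * f (I1 @ a # b # I3))"

lemma qsymD:
  "qsym f J \<Longrightarrow> J = J1 @ c # c # J3 \<Longrightarrow> length I1 = length J1 \<Longrightarrow> a < b
    \<Longrightarrow> f (I1 @ b # a # I3) = vv * f (I1 @ a # b # I3)"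
  unfolding qsym_def by blast

lemma qsym_op: "qsym (app (op x) (delta J)) J"
  unfolding qsym_def
proof (intro allI impI)
  fix J1 :: "nat list" and c J3 and I1 :: "nat list" and a b :: nat and I3
  assume J: "J = J1 @ c # c # J3" and l: "length I1 = length J1" and "a < b"
  have "app (hk (length J1)) (app (op x) (delta J)) = (\<lambda>I. vv * app (op x) (delta J) I)"
    by (simp add: J hk_delta app_cmult flip: app_op_hk)
  then have "app (hk (length I1)) (app (op x) (delta J)) (I1 @ a # b # I3) = vv * app (op x) (delta J) (I1 @ a # b # I3)"
    by (simp add: l)
  then show "app (op x) (delta J) (I1 @ b # a # I3) = vv * app (op x) (delta J) (I1 @ a # b # I3)"
    using \<open>a < b\<close> by (simp add: hk_at)
qed

section \<open>Divided powers\<close>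

definition dp :: "endo \<Rightarrow> nat \<Rightarrow> endo" where
  "dp a m = scal (inverse (qfact m)) * a ^ m"

lemma op_divpow [simp]: "op (divpow x m) = dp (op x) m"
  by (simp add: divpow_def dp_def)

lemma C_divpow [simp]: "x \<in> C n \<Longrightarrow> divpow x m \<in> C n"
  by (simp add: divpow_def)

lemma dp_0 [simp]: "dp a 0 = 1"
  by (simp add: dp_def)

text \<open>On the natural module E squares to zero, so at most one of the m factors meets the first
  letter. Summing over which one it is gives a geometric sum, a power of v times [m].\<close>

lemma ee_power: "app (ee i ^ m) f (x # I) = app (ee i ^ m) (\<lambda>I. f (x # I)) I
    + (if x = i then vv powi (1 - int m) * qint m * (vv powi (wt (rho i (Suc i)) I) * app (ee i ^ (m - 1)) (\<lambda>I. f (Suc i # I)) I) else 0)"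
proof (induction m arbitrary: f x I)
  case (Suc m)
  have q: "1 + vv powi (1 - int m) * qint m * vv powi (- 2) = vv powi (- int m) * qint (Suc m)"
  proof -
    have q: "qint (Suc m) = inverse vv * qint m + vv ^ m"
      using qint_add'[of 1 m] by (simp add: power_int_minus)
    show ?thesis unfolding q by (simp add: power_int_diff power_int_minus field_simps power2_eq_square)
  qed
  have s: "app (ee i ^ m) f (Suc i # I) = app (ee i ^ m) (\<lambda>I. f (Suc i # I)) I"
    by (simp add: Suc)
  show ?case
  proof (cases "x = i")
    case True
    have "app (ee i) (\<lambda>I. app (ee i ^ m) f (i # I)) I
      = app (ee i) (app (ee i ^ m) (\<lambda>I. f (i # I))) I
        + vv powi (1 - int m) * qint m * (vv powi (-2) * (vv powi (wt (rho i (Suc i)) I)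
          * app (ee i) (app (ee i ^ (m - 1)) (\<lambda>I. f (Suc i # I))) I))"
      by (simp add: Suc app_add app_cmult ee_wt' rho_def eps_def)
    moreover have "qint m * app (ee i) (app (ee i ^ (m - 1)) (\<lambda>I. f (Suc i # I))) I
      = qint m * app (ee i ^ m) (\<lambda>I. f (Suc i # I)) I"
      by (cases m) (simp_all add: power_Suc)
    ultimately have "app (ee i ^ Suc m) f (x # I) = app (ee i ^ Suc m) (\<lambda>I. f (x # I)) I
      + (1 + vv powi (1 - int m) * qint m * vv powi (-2)) * (vv powi (wt (rho i (Suc i)) I)
        * app (ee i ^ m) (\<lambda>I. f (Suc i # I)) I)"
      using True s by (simp add: algebra_simps)
    then show ?thesis unfolding q using True by simp
  next
    case False
    then show ?thesis by (simp add: Suc)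
  qed
qed simp

lemma ff_power: "app (ff i ^ m) f (x # I) = vv powi (int m * rho (Suc i) i x) * app (ff i ^ m) (\<lambda>I. f (x # I)) I
    + (if x = Suc i then qint m * app (ff i ^ (m - 1)) (\<lambda>I. f (i # I)) I else 0)"
proof (induction m arbitrary: f x I)
  case (Suc m)
  have q: "vv * qint m + vv powi (- int m) = qint (Suc m)"
    using qint_add[of 1 m] by simp
  have s: "app (ff i ^ m) f (i # I) = vv powi (- int m) * app (ff i ^ m) (\<lambda>I. f (i # I)) I"
    by (simp add: Suc rho_def eps_def)
  show ?case
  proof (cases "x = Suc i")
    case True
    have "app (ff i) (\<lambda>I. app (ff i ^ m) f (Suc i # I)) I
      = vv powi int m * app (ff i) (app (ff i ^ m) (\<lambda>I. f (Suc i # I))) I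
        + qint m * app (ff i) (app (ff i ^ (m - 1)) (\<lambda>I. f (i # I))) I"
      by (simp add: Suc app_add app_cmult rho_def eps_def)
    moreover have "qint m * app (ff i) (app (ff i ^ (m - 1)) (\<lambda>I. f (i # I))) I
      = qint m * app (ff i ^ m) (\<lambda>I. f (i # I)) I"
      by (cases m) (simp_all add: power_Suc)
    ultimately have "app (ff i ^ Suc m) f (x # I) = vv powi (1 + int m) * app (ff i ^ Suc m) (\<lambda>I. f (x # I)) I
      + (vv * qint m + vv powi (- int m)) * app (ff i ^ m) (\<lambda>I. f (i # I)) I"
      using True s by (simp add: rho_def eps_def power_int_add algebra_simps)
    then show ?thesis unfolding q using True by (simp add: rho_def eps_def)
  next
    case False
    then show ?thesis by (simp add: Suc app_cmult power_int_add algebra_simps)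
  qed
qed simp

lemma app_dp: "app (dp a m) f I = inverse (qfact m) * app (a ^ m) f I"
  by (simp add: dp_def)

definition lpres :: "endo \<Rightarrow> bool" where
  "lpres a \<longleftrightarrow> (\<forall>f. (\<forall>I. f I \<in> laurent) \<longrightarrow> (\<forall>I. app a f I \<in> laurent))"

lemma lpres_add: "lpres a \<Longrightarrow> lpres b \<Longrightarrow> lpres (a + b)"
  and lpres_mult: "lpres a \<Longrightarrow> lpres b \<Longrightarrow> lpres (a * b)"
  and lpres_scal: "c \<in> laurent \<Longrightarrow> lpres (scal c)"
  by (simp_all add: lpres_def)

lemma qfact_cancel: "inverse (qfact (Suc m)) * (c * qint (Suc m) * y) = c * (inverse (qfact m) * y)"
  using qint_nonzero[of "Suc m"] by (simp add: qfact_Suc field_simps)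

text \<open>The factor [m] in \<open>ee_power\<close> turns the denominator [m]! into [m - 1]!. The
  divided powers thus obey a recursion along the word whose coefficients are powers of v.\<close>

lemma lpres_dp_ee: "lpres (dp (ee i) m)"
proof -
  have "app (dp (ee i) m) f I \<in> laurent" if "\<And>I. f I \<in> laurent" for f I
    using that
  proof (induction I arbitrary: f m)
    case Nil
    then show ?case by (cases m) (simp_all add: dp_def)
  next
    case (Cons x I)
    show ?case
    proof (cases m)
      case (Suc k)
      have "app (dp (ee i) m) f (x # I) = app (dp (ee i) m) (\<lambda>I. f (x # I)) I
        + (if x = i then vv powi (- int k) * (vv powi (wt (rho i (Suc i)) I) * app (dp (ee i) k) (\<lambda>I. f (Suc i # I)) I) else 0)"
      proof -
        have k: "1 - int (Suc k) = - int k" by simp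
        show ?thesis unfolding Suc app_dp ee_power k diff_Suc_1
          by (cases "x = i") (simp_all only: if_True if_False distrib_left qfact_cancel add_0_right simp_thms
              mult.left_commute[of "inverse (qfact k)" "vv powi (wt c I)" for c])
      qed
      then show ?thesis using Cons by auto
    qed (use Cons in simp)
  qed
  then show ?thesis by (simp add: lpres_def)
qed

lemma lpres_dp_ff: "lpres (dp (ff i) m)"
proof -
  have "app (dp (ff i) m) f I \<in> laurent" if "\<And>I. f I \<in> laurent" for f I
    using that
  proof (induction I arbitrary: f m)
    case Nil
    then show ?case by (cases m) (simp_all add: dp_def)
  next
    case (Cons x I)
    show ?case
    proof (cases m)
      case (Suc k)
      have "app (dp (ff i) m) f (x # I) = vv powi (int m * rho (Suc i) i x) * app (dp (ff i) m) (\<lambda>I. f (x # I)) I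
        + (if x = Suc i then app (dp (ff i) k) (\<lambda>I. f (i # I)) I else 0)"
      proof -
        note q = qfact_cancel[of k 1, unfolded mult_1]
        show ?thesis unfolding Suc app_dp ff_power diff_Suc_1
          by (cases "x = Suc i") (simp_all only: if_True if_False distrib_left q add_0_right simp_thms
              mult.left_commute[of "inverse (qfact (Suc k))" "vv powi c" for c])
      qed
      then show ?thesis using Cons by auto
    qed (use Cons in simp)
  qed
  then show ?thesis by (simp add: lpres_def)
qed

section \<open>Weight idempotents\<close>

definition vdiff :: "int \<Rightarrow> Qv" where "vdiff k = vv powi k - vv powi (- k)"

text \<open>The Gaussian binomial coefficient, which is the eigenvalue of \<open>Kbinom i t\<close>
  at a word with c letters i.\<close>

definition qbin :: "nat \<Rightarrow> nat \<Rightarrow> Qv" where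
  "qbin c t = (\<Prod>s=1..t. vdiff (int c + 1 - int s) / vdiff (int s))"

lemma vdiff_nonzero: "k > 0 \<Longrightarrow> vdiff (int k) \<noteq> 0"
  using vv_powi_diff_nonzero[of k] by (simp add: vdiff_def)

lemma qbin_0 [simp]: "qbin c 0 = 1"
  by (simp add: qbin_def)

lemma qbin_Suc: "qbin c (Suc t) = qbin c t * (vdiff (int c - int t) / vdiff (int (Suc t)))"
  by (simp add: qbin_def)

lemma qbin_Suc': "qbin (Suc c) (Suc t) = qbin c t * (vdiff (int (Suc c)) / vdiff (int (Suc t)))"
proof (induction t)
  case 0
  then show ?case by (simp add: qbin_def)
next
  case (Suc t)
  have "qbin (Suc c) (Suc (Suc t)) = qbin (Suc c) (Suc t) * (vdiff (int (Suc c) - int (Suc t)) / vdiff (int (Suc (Suc t))))"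
    by (rule qbin_Suc)
  then show ?case unfolding Suc qbin_Suc[of c t] by simp
qed

text \<open>A quantum Pascal rule; it shows integrality in spite of the denominators in the
  definition.\<close>

lemma qbin_rec: "qbin (Suc c) (Suc t)
    = vv powi (int (Suc t)) * qbin c (Suc t) + vv powi (int t - int c) * qbin c t"
proof -
  have "vdiff (int (Suc c)) = vv powi (int (Suc t)) * vdiff (int c - int t) + vv powi (int t - int c) * vdiff (int (Suc t))"
    unfolding vdiff_def by (simp add: power_int_add power_int_diff power_int_minus field_simps)
  note * = this
  show ?thesis using * vdiff_nonzero[of "Suc t"]
    apply (subst qbin_Suc', subst qbin_Suc[of c])
    by (simp add: field_simps)
qed

lemma qbin_gt: "c < t \<Longrightarrow> qbin c t = 0"
  unfolding qbin_def by (auto simp: vdiff_def intro!: bexI[of _ "Suc c"])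

lemma qbin_self [simp]: "qbin c c = 1"
  by (induction c) (simp_all add: qbin_rec qbin_gt)

lemma qbin_laurent [simp]: "qbin c t \<in> laurent"
proof (induction c arbitrary: t)
  case 0
  then show ?case by (cases "t = 0") (simp_all add: qbin_gt)
next
  case (Suc c)
  then show ?case by (cases t) (simp_all add: qbin_rec)
qed

lemma app_Kbinom: "app (op (Kbinom i t)) f I = qbin (count_list I i) t * f I"
proof (induction t arbitrary: f)
  case (Suc t)
  have e: "[1..<Suc (Suc t)] = [1..<Suc t] @ [Suc t]" by simp
  have K: "Kbinom i (Suc t) = Kbinom i t * (cst (inverse (vv powi int (Suc t) - vv powi (- int (Suc t))))
     * (cst (vv powi (1 - int (Suc t))) * KK i - cst (vv powi (int (Suc t) - 1)) * KI i))"
    unfolding Kbinom_def e by (simp only: map_append prod_list.append list.map prod_list.Cons prod_list.Nil mult_1_right)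
  have 1: "app (op (cst c * (cst a * KK i - cst b * KI i))) f I
      = c * (a * vv powi (int (count_list I i)) - b * vv powi (- int (count_list I i))) * f I" for a b c
    by (simp add: app_kk wt_eps wt_uminus algebra_simps)
  have 2: "vv powi (1 - int (Suc t)) * vv powi (int c) - vv powi (int (Suc t) - 1) * vv powi (- int c)
      = vdiff (int c - int t)" for c
    unfolding vdiff_def by (simp add: power_int_diff power_int_minus field_simps)
  show ?case unfolding K op_mult[of "Kbinom i t"] app_times Suc 1 2 qbin_Suc vdiff_def[of "int (Suc t)", symmetric]
    by (simp add: field_simps)
qed (simp add: Kbinom_def)

lemma C_Kbinom [simp]: "i < n \<Longrightarrow> Kbinom i t \<in> C n"
  unfolding Kbinom_def by (rule C_prod_list) auto

lemma lpres_Kbinom: "lpres (op (Kbinom i t))"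
  by (simp add: lpres_def app_Kbinom)

definition has_weight :: "nat \<Rightarrow> (nat \<Rightarrow> nat) \<Rightarrow> nat list \<Rightarrow> bool" where
  "has_weight n l I \<longleftrightarrow> (\<forall>i<n. count_list I i = l i)"

lemma sum_count_words: "I \<in> words n d \<Longrightarrow> (\<Sum>i<n. count_list I i) = d"
proof (induction d arbitrary: I)
  case (Suc d)
  from Suc.prems obtain x I' where I: "I = x # I'" "x < n" "I' \<in> words n d" by (rule words_SucE)
  have "(\<Sum>i<n. count_list I i) = (\<Sum>i<n. count_list I' i + (if x = i then 1 else 0))"
    using I by (intro sum.cong) auto
  then show ?case using Suc.IH[OF I(3)] I(2) by (simp add: sum.distrib)
qed simp

text \<open>Each factor is 1 where the letter count equals \<open>l i\<close> and 0 where it is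
  smaller. The counts of a word and the entries of l have the same sum d, so if they differ
  anywhere, then some count is too small.\<close>

lemma app_one_wt:
  assumes "l \<in> Lambda n d" "I \<in> words n d"
  shows "app (op (one_wt n l)) f I = (if has_weight n l I then f I else 0)"
proof -
  have "app (op (\<Prod>i\<leftarrow>[0..<k]. Kbinom i (l i))) f I = (\<Prod>i<k. qbin (count_list I i) (l i)) * f I" for k f
    by (induction k arbitrary: f) (simp_all add: app_Kbinom)
  then have e: "app (op (one_wt n l)) f I = (\<Prod>i<n. qbin (count_list I i) (l i)) * f I"
    by (simp add: one_wt_def)
  show ?thesis
  proof (cases "has_weight n l I")
    case True
    then have "(\<Prod>i<n. qbin (count_list I i) (l i)) = 1"
      by (intro prod.neutral) (auto simp: has_weight_def)
    then show ?thesis using e True by simp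
  next
    case False
    have "\<exists>i<n. count_list I i < l i"
    proof (rule ccontr)
      assume "\<not> (\<exists>i<n. count_list I i < l i)"
      then have le: "\<And>i. i \<in> {..<n} \<Longrightarrow> l i \<le> count_list I i" by auto
      have "sum l {..<n} = (\<Sum>i<n. count_list I i)"
        using sum_count_words[OF assms(2)] assms(1) by (simp add: Lambda_def)
      from sum_mono_inv[OF this le] have "\<forall>i<n. count_list I i = l i" by force
      then show False using False by (simp add: has_weight_def)
    qed
    then obtain i where "i < n" "count_list I i < l i" by blast
    then have "(\<Prod>i<n. qbin (count_list I i) (l i)) = 0"
      by (intro prod_zero bexI[of _ i]) (simp_all add: qbin_gt)
    then show ?thesis using e False by simp
  qed
qed

section \<open>The integral form of the enveloping algebra\<close>

text \<open>Closure under equality of operators is built in, because divided powers of root vectors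
  are expressed through the generators by means of relations that hold for operators and not in the
  free algebra.\<close>

inductive_set GA :: "nat \<Rightarrow> free_alg set" for n where
  GA_cst: "a \<in> laurent \<Longrightarrow> cst a \<in> GA n"
| GA_E: "Suc i < n \<Longrightarrow> divpow (EE i) m \<in> GA n"
| GA_F: "Suc i < n \<Longrightarrow> divpow (FF i) m \<in> GA n"
| GA_K: "i < n \<Longrightarrow> Kbinom i m \<in> GA n"
| GA_add: "x \<in> GA n \<Longrightarrow> y \<in> GA n \<Longrightarrow> x + y \<in> GA n"
| GA_mult: "x \<in> GA n \<Longrightarrow> y \<in> GA n \<Longrightarrow> x * y \<in> GA n"
| GA_cong: "x \<in> GA n \<Longrightarrow> y \<in> C n \<Longrightarrow> op x = op y \<Longrightarrow> y \<in> GA n"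

lemma GA_C: "x \<in> GA n \<Longrightarrow> x \<in> C n"
  by (induction rule: GA.induct) auto

lemma GA_lpres: "x \<in> GA n \<Longrightarrow> lpres (op x)"
  by (induction rule: GA.induct)
    (auto simp: lpres_scal lpres_dp_ee lpres_dp_ff lpres_Kbinom lpres_add lpres_mult)

lemma GA_1: "1 \<in> GA n"
  using GA_cst[of 1 n] by (simp add: cst_def single_one)

lemma GA_prod_list: "set xs \<subseteq> GA n \<Longrightarrow> prod_list xs \<in> GA n"
  by (induction xs) (simp_all add: GA_1 GA_mult)

lemma GA_one_wt: "one_wt n l \<in> GA n"
  unfolding one_wt_def by (rule GA_prod_list) (auto intro: GA_K)

section \<open>Integrality of the root vectors\<close>

definition smul :: "Qv \<Rightarrow> endo \<Rightarrow> endo" (infixr "\<star>" 75) where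
  "c \<star> x = scal c * x"

lemma smul_simps:
  "(c \<star> x) * y = c \<star> (x * y)" "x * (c \<star> y) = c \<star> (x * y)" "c \<star> (d \<star> x) = (c * d) \<star> x"
  "c \<star> (x + y) = c \<star> x + c \<star> y" "c \<star> (x - y) = c \<star> x - c \<star> y" "1 \<star> x = x" "c \<star> 0 = 0" "c \<star> (- x) = - (c \<star> x)"
proof -
  show "x * (c \<star> y) = c \<star> (x * y)"
    by (metis mult.assoc scal_central smul_def)
qed (simp_all add: smul_def mult.assoc scal_mult algebra_simps)

lemma smul_add: "(c + d) \<star> x = c \<star> x + d \<star> x"
  and smul_diff: "(c - d) \<star> x = c \<star> x - d \<star> x"
  and smul_uminus: "(- c) \<star> x = - (c \<star> x)"
  by (simp_all add: smul_def scal_add scal_diff algebra_simps)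

lemma smul_cancel: "c \<noteq> 0 \<Longrightarrow> c \<star> x = c \<star> y \<longleftrightarrow> x = y"
proof
  assume "c \<noteq> 0" "c \<star> x = c \<star> y"
  then have "inverse c \<star> (c \<star> x) = inverse c \<star> (c \<star> y)" by simp
  then show "x = y" using \<open>c \<noteq> 0\<close> by (simp add: smul_simps)
qed simp

lemma smul_sum: "c \<star> (\<Sum>i\<in>S. f i) = (\<Sum>i\<in>S. c \<star> f i)"
  by (simp add: smul_def sum_distrib_left)

definition qcomm :: "endo \<Rightarrow> endo \<Rightarrow> endo" where
  "qcomm e x = inverse vv \<star> (e * x) - x * e"

text \<open>The Serre relation is the statement that e commutes with its bracket with x up to a
  power of v, multiplied by v.\<close>

lemma serre_left: "serre_op e x = 0 \<Longrightarrow> e * qcomm e x = inverse vv \<star> (qcomm e x * e)"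
proof -
  have "e * qcomm e x - inverse vv \<star> (qcomm e x * e) = inverse vv \<star> serre_op e x"
    by (simp add: qcomm_def serre_op_def smul_simps smul_add algebra_simps flip: smul_def)
  then show "serre_op e x = 0 \<Longrightarrow> ?thesis" by (simp add: smul_simps)
qed

lemma serre_right: "serre_op x e = 0 \<Longrightarrow> qcomm e x * x = inverse vv \<star> (x * qcomm e x)"
proof -
  have "qcomm e x * x - inverse vv \<star> (x * qcomm e x) = inverse vv \<star> serre_op x e"
    by (simp add: qcomm_def serre_op_def smul_simps smul_add algebra_simps flip: smul_def)
  then show "serre_op x e = 0 \<Longrightarrow> ?thesis" by (simp add: smul_simps)
qed

text \<open>The Serre expression is linear in its second argument and z can be moved past e, so the
  relation passes from f to the bracket of f with z.\<close>

lemma serre_qcomm: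
  assumes "serre_op e f = 0" "e * z = z * e"
  shows "serre_op e (qcomm f z) = 0"
proof -
  have ez: "e * (z * y) = z * (e * y)" for y using assms(2) by (metis mult.assoc)
  have "serre_op e (qcomm f z) = inverse vv \<star> (serre_op e f * z) - z * serre_op e f"
    by (simp add: qcomm_def serre_op_def smul_simps smul_add ez assms(2) mult.assoc algebra_simps flip: smul_def)
  then show ?thesis using assms(1) by (simp add: smul_simps)
qed

lemma one_plus_vv_square_nonzero: "1 + vv * vv \<noteq> 0"
proof
  assume "1 + vv * vv = 0"
  then have "vv * vv = - 1" by (simp add: eq_neg_iff_add_eq_0 add.commute)
  then have "(vv * vv) * (vv * vv) = 1" by simp
  then have "vv ^ 4 = 1" by (simp add: eval_nat_numeral mult.assoc)
  then show False by (simp only: vv_power_eq_1_iff)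
qed

text \<open>
  With \<open>x = [f, z]\<close>, \<open>g = [e, f]\<close> and \<open>y = [e, x] = [g, z]\<close> the product \<open>y x\<close> is computed in two
  ways; the crossing relation \<open>[g, x]\<close> produces \<open>y f\<close>, and \<open>f\<close> commutes with \<open>y\<close>.
\<close>

lemma qcomm_chain:
  assumes ez: "e * z = z * e" and x: "x = qcomm f z" and y: "y = qcomm e x"
    and gf: "qcomm e f * f = inverse vv \<star> (f * qcomm e f)"
    and fx: "f * x = inverse vv \<star> (x * f)"
    and xz: "x * z = inverse vv \<star> (z * x)"
  shows "y * x = inverse vv \<star> (x * y)"
proof -
  define g where "g = qcomm e f"
  note simps = smul_simps distrib_left distrib_right left_diff_distrib right_diff_distrib mult.assoc
  have iv: "inverse vv * (vv * c) = c" for c by (simp flip: mult.assoc)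
  have ez': "e * (z * w) = z * (e * w)" for w using ez by (metis mult.assoc)
  have fg: "f * g = vv \<star> (g * f)"
    using gf by (simp add: g_def smul_simps)
  have fg': "f * (g * w) = vv \<star> (g * (f * w))" for w
    using arg_cong[OF fg, of "\<lambda>a. a * w"] by (simp add: smul_simps mult.assoc)
  have zx: "z * x = vv \<star> (x * z)" using xz by (simp add: smul_simps)
  have zx': "z * (x * w) = vv \<star> (x * (z * w))" for w
    using arg_cong[OF zx, of "\<lambda>a. a * w"] by (simp add: smul_simps mult.assoc)
  have fx': "f * (x * w) = inverse vv \<star> (x * (f * w))" for w
    using arg_cong[OF fx, of "\<lambda>a. a * w"] by (simp add: smul_simps mult.assoc)
  \<comment> \<open>The second description of y, as a bracket of g with z: since e and z commute,
    the two ways of nesting the brackets agree.\<close>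
  have y2: "y = inverse vv \<star> (g * z) - z * g"
    unfolding y x g_def qcomm_def by (simp add: simps ez ez')
  have ex: "e * x = vv \<star> y + vv \<star> (x * e)"
    unfolding y qcomm_def by (simp add: simps)
  have ex': "e * (x * w) = vv \<star> (y * w) + vv \<star> (x * (e * w))" for w
    using arg_cong[OF ex, of "\<lambda>a. a * w"] by (simp add: simps)
  have fz: "f * z = vv \<star> x + vv \<star> (z * f)"
    unfolding x qcomm_def by (simp add: simps)
  have fz': "f * (z * w) = vv \<star> (x * w) + vv \<star> (z * (f * w))" for w
    using arg_cong[OF fz, of "\<lambda>a. a * w"] by (simp add: simps)
  have gx: "g * x = x * g + inverse vv \<star> (y * f) - vv \<star> (f * y)"
    unfolding g_def qcomm_def by (simp add: simps fx fx' ex ex')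
  \<comment> \<open>Moving f through this second description brings f * y back by way of
    \<open>gx\<close>, and what remains is a multiple by 1 + v^2 of the commutator of f and
    y.\<close>
  have "f * y = inverse vv \<star> (f * (g * z)) - f * (z * g)"
    unfolding y2 by (simp add: simps)
  also have "\<dots> = g * (f * z) - f * (z * g)" by (simp add: fg' smul_simps)
  also have "\<dots> = vv \<star> (g * x - x * g) + (vv * vv) \<star> (y * f)"
    unfolding fz fz' fg y2 by (simp add: simps)
  also have "\<dots> = y * f - (vv * vv) \<star> (f * y) + (vv * vv) \<star> (y * f)"
    unfolding gx by (simp add: simps)
  finally have "(1 + vv * vv) \<star> (f * y) = (1 + vv * vv) \<star> (y * f)"
    by (simp add: smul_add smul_simps algebra_simps)
  then have fy: "f * y = y * f"
    using one_plus_vv_square_nonzero by (simp add: smul_cancel)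
  have gx2: "g * x = x * g + (inverse vv - vv) \<star> (y * f)"
    unfolding gx fy smul_diff by simp
  have gx2': "g * (x * w) = x * (g * w) + (inverse vv - vv) \<star> (y * (f * w))" for w
    using arg_cong[OF gx2, of "\<lambda>a. a * w"] by (simp add: simps)
  have xz': "x * (z * w) = inverse vv \<star> (z * (x * w))" for w
    using arg_cong[OF xz, of "\<lambda>a. a * w"] by (simp add: smul_simps mult.assoc)
  have "y * z = inverse vv \<star> (z * y)"
    unfolding y qcomm_def by (simp add: simps ez ez' xz xz')
  then have zy: "z * y = vv \<star> (y * z)" by (simp add: smul_simps)
  have zy': "z * (y * w) = vv \<star> (y * (z * w))" for w
    using arg_cong[OF zy, of "\<lambda>a. a * w"] by (simp add: smul_simps mult.assoc)
  define c where "c = inverse vv - vv"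
  \<comment> \<open>When x has been moved past z and g, the product y * x reappears with coefficient
    c * v = 1 - v^2. Subtracting it leaves v^2 times y * x on the left.\<close>
  have "y * x = inverse vv \<star> (g * (z * x)) - z * (g * x)"
    by (subst y2) (simp add: simps)
  also have "\<dots> = x * (g * z) + c \<star> (y * (f * z)) - vv \<star> (x * (z * g)) - (c * vv) \<star> (y * (z * f))"
    unfolding zx gx2 c_def by (simp add: simps gx2' zx' zy' iv)
  also have "\<dots> = vv \<star> (x * y) + (c * vv) \<star> (y * x)"
    unfolding fz by (subst (2) y2) (simp add: simps iv)
  finally have "y * x - (c * vv) \<star> (y * x) = vv \<star> (x * y)" by (simp only: diff_eq_eq)
  moreover have "c * vv = 1 - vv * vv" by (simp add: c_def algebra_simps)
  ultimately have "(vv * vv) \<star> (y * x) = vv \<star> (x * y)"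
    by (simp add: smul_diff smul_simps)
  then have "inverse (vv * vv) \<star> ((vv * vv) \<star> (y * x)) = inverse (vv * vv) \<star> (vv \<star> (x * y))" by simp
  moreover have "inverse (vv * vv) * (vv * vv) = 1" "inverse (vv * vv) * vv = inverse vv"
    by (simp_all add: field_simps)
  ultimately show ?thesis by (simp only: smul_simps)
qed

section \<open>Root vectors of a family that satisfies the Serre relations\<close>

function rvec :: "(nat \<Rightarrow> endo) \<Rightarrow> nat \<Rightarrow> nat \<Rightarrow> endo" where
  "rvec e i k = (if Suc i < k then qcomm (e i) (rvec e (Suc i) k) else e i)"
  by pat_completeness auto
termination by (relation "measure (\<lambda>(e, i, k). k - i)") auto

declare rvec.simps [simp del]

lemma rvec_Suc: "Suc i < k \<Longrightarrow> rvec e i k = qcomm (e i) (rvec e (Suc i) k)"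
  and rvec_simple: "rvec e i (Suc i) = e i"
  by (simp_all add: rvec.simps[of e i])

definition serre_family :: "(nat \<Rightarrow> endo) \<Rightarrow> bool" where
  "serre_family e \<longleftrightarrow> (\<forall>i j. adjacent i j \<longrightarrow> serre_op (e i) (e j) = 0)
     \<and> (\<forall>i j. \<not> adjacent i j \<longrightarrow> e i * e j = e j * e i)"

lemma rvec_commute:
  assumes "serre_family e" "Suc j < i" "i < k"
  shows "e j * rvec e i k = rvec e i k * e j"
  using assms(2,3)
proof (induction "k - i" arbitrary: i)
  case (Suc m)
  have ji: "e j * e i = e i * e j" "e j * (e i * w) = e i * (e j * w)" for w
    using assms(1) Suc.prems unfolding serre_family_def adjacent_def by (auto simp flip: mult.assoc)
  show ?case
  proof (cases "Suc i < k")
    case True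
    have IH: "e j * rvec e (Suc i) k = rvec e (Suc i) k * e j"
      by (rule Suc.hyps(1)) (use Suc True in auto)
    then have IH': "e j * (rvec e (Suc i) k * w) = rvec e (Suc i) k * (e j * w)" for w
      by (metis mult.assoc)
    show ?thesis unfolding rvec_Suc[OF True] qcomm_def
      by (simp add: smul_simps algebra_simps ji IH IH')
  next
    case False
    then have "k = Suc i" using Suc.prems by simp
    then show ?thesis using ji by (simp add: rvec_simple)
  qed
qed simp

lemma rvec_left:
  assumes "serre_family e" "Suc i < k"
  shows "e i * rvec e i k = inverse vv \<star> (rvec e i k * e i)"
proof -
  have s: "serre_op (e i) (e (Suc i)) = 0"
    using assms(1) by (simp add: serre_family_def adjacent_def)
  have "serre_op (e i) (rvec e (Suc i) k) = 0"
  proof (cases "Suc (Suc i) < k")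
    case True
    show ?thesis unfolding rvec_Suc[OF True]
      by (rule serre_qcomm[OF s]) (rule rvec_commute[OF assms(1)], use True in auto)
  next
    case False
    then have "k = Suc (Suc i)" using assms by simp
    then show ?thesis using s by (simp add: rvec_simple)
  qed
  from serre_left[OF this] show ?thesis unfolding rvec_Suc[OF assms(2)] .
qed

text \<open>Downward induction on i: \<open>qcomm_chain\<close> applies with z the root vector that
  starts at i + 2, and its last hypothesis is the claim for i + 1.\<close>

lemma rvec_right:
  assumes "serre_family e" "Suc i < k"
  shows "rvec e i k * rvec e (Suc i) k = inverse vv \<star> (rvec e (Suc i) k * rvec e i k)"
  using assms(2)
proof (induction "k - i" arbitrary: i)
  case (Suc m)
  have s: "serre_op (e (Suc i)) (e i) = 0"
    using assms(1) by (simp add: serre_family_def adjacent_def)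
  show ?case
  proof (cases "Suc (Suc i) < k")
    case True
    show ?thesis
    proof (rule qcomm_chain)
      show "rvec e (Suc i) k = qcomm (e (Suc i)) (rvec e (Suc (Suc i)) k)" by (rule rvec_Suc[OF True])
      show "rvec e i k = qcomm (e i) (rvec e (Suc i) k)" by (rule rvec_Suc) (use True in simp)
      show "e i * rvec e (Suc (Suc i)) k = rvec e (Suc (Suc i)) k * e i"
        by (rule rvec_commute[OF assms(1)]) (use True in auto)
      show "qcomm (e i) (e (Suc i)) * e (Suc i) = inverse vv \<star> (e (Suc i) * qcomm (e i) (e (Suc i)))"
        by (rule serre_right[OF s])
      show "e (Suc i) * rvec e (Suc i) k = inverse vv \<star> (rvec e (Suc i) k * e (Suc i))"
        by (rule rvec_left[OF assms(1) True])
      show "rvec e (Suc i) k * rvec e (Suc (Suc i)) k = inverse vv \<star> (rvec e (Suc (Suc i)) k * rvec e (Suc i) k)"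
        by (rule Suc.hyps(1)) (use Suc True in auto)
    qed
  next
    case False
    then have k: "k = Suc (Suc i)" using Suc.prems by simp
    then have "rvec e (Suc i) k = e (Suc i)" "rvec e i k = qcomm (e i) (e (Suc i))"
      using rvec_Suc[of i k e] by (simp_all add: rvec_simple)
    then show ?thesis using serre_right[OF s] by simp
  qed
qed simp

section \<open>Divided powers of root vectors\<close>

lemma dp_smul: "dp a m = inverse (qfact m) \<star> a ^ m"
  by (simp add: dp_def smul_def)

lemma dp_Suc: "dp a m * a = qint (Suc m) \<star> dp a (Suc m)"
proof -
  have "qint (Suc m) * inverse (qfact (Suc m)) = inverse (qfact m)"
    using qint_nonzero[of "Suc m"] by (simp add: qfact_Suc)
  then show ?thesis by (simp add: dp_smul smul_simps power_commutes)
qed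

lemma dp_Suc': "dp a m * (a * b) = qint (Suc m) \<star> (dp a (Suc m) * b)"
  by (simp only: dp_Suc smul_simps flip: mult.assoc)

text \<open>The hypotheses are the relations between a simple root vector e, a root vector x and
  their bracket y. The conclusion moves a single e to the left through a divided power.\<close>

lemma dp_qcomm:
  assumes "x * e = inverse vv \<star> (e * x) - y" "y * e = vv \<star> (e * y)" "x * y = vv \<star> (y * x)"
  shows "dp x (Suc m) * e = vv powi (- int (Suc m)) \<star> (e * dp x (Suc m)) - y * dp x m"
    and "dp y j * e = vv powi (int j) \<star> (e * dp y j)"
proof -
  have xy: "x ^ m * y = vv powi (int m) \<star> (y * x ^ m)" for m
  proof (induction m)
    case (Suc m)
    have "x ^ Suc m * y = x * (x ^ m * y)" by (simp add: mult.assoc)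
    also have "\<dots> = vv powi (int m) \<star> ((x * y) * x ^ m)" by (simp add: Suc smul_simps mult.assoc)
    finally show ?case unfolding assms by (simp add: smul_simps mult.assoc power_int_add mult.commute)
  qed (simp add: smul_simps)
  have xe: "x ^ Suc m * e = vv powi (- int (Suc m)) \<star> (e * x ^ Suc m) - qint (Suc m) \<star> (y * x ^ m)" for m
  proof (induction m)
    case 0
    then show ?case using assms by (simp add: smul_simps power_int_minus)
  next
    case (Suc m)
    have q: "qint (Suc (Suc m)) = vv powi (int (Suc m)) + inverse vv * qint (Suc m)"
      using qint_add[of "Suc m" 1] by (simp add: power_int_minus)
    have p: "vv powi (- int (Suc (Suc m))) = inverse vv * vv powi (- int (Suc m))"
      using power_int_add[of vv "- 1" "- int (Suc m)"] by (simp add: power_int_minus)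
    have "x ^ Suc (Suc m) * e = x ^ Suc m * (inverse vv \<star> (e * x) - y)"
      using assms(1) by (simp only: power_Suc2[of x "Suc m"] mult.assoc)
    also have "\<dots> = inverse vv \<star> (x ^ Suc m * e * x) - x ^ Suc m * y"
      by (simp only: right_diff_distrib smul_simps mult.assoc)
    also have "\<dots> = vv powi (- int (Suc (Suc m))) \<star> (e * (x ^ Suc m * x))
        - (inverse vv * qint (Suc m)) \<star> (y * (x ^ m * x)) - vv powi (int (Suc m)) \<star> (y * x ^ Suc m)"
      unfolding Suc xy p by (simp only: left_diff_distrib smul_simps mult.assoc)
    finally show ?case unfolding q smul_add by (simp only: power_Suc2[symmetric] diff_diff_eq add.commute)
  qed
  have f: "inverse (qfact (Suc m)) * qint (Suc m) = inverse (qfact m)"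
    using qint_nonzero[of "Suc m"] by (simp add: qfact_Suc)
  show "dp x (Suc m) * e = vv powi (- int (Suc m)) \<star> (e * dp x (Suc m)) - y * dp x m"
    unfolding dp_smul smul_simps xe f by (simp only: mult.commute)
  have "y ^ j * e = vv powi (int j) \<star> (e * y ^ j)"
  proof (induction j)
    case (Suc j)
    have "y ^ Suc j * e = y * (y ^ j * e)" by (simp add: mult.assoc)
    also have "\<dots> = vv powi (int j) \<star> ((y * e) * y ^ j)" by (simp add: Suc smul_simps mult.assoc)
    finally show ?case unfolding assms by (simp add: smul_simps mult.assoc power_int_add mult.commute)
  qed (simp add: smul_simps)
  then show "dp y j * e = vv powi (int j) \<star> (e * dp y j)"
    by (simp add: dp_smul smul_simps mult.commute)
qed

text \<open>Multiplying the formula for k by e on the right and moving e to its place gives [k + 1]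
  times the formula for k + 1; that factor is then cancelled.\<close>

lemma dp_qcomm_expand:
  assumes "x * e = inverse vv \<star> (e * x) - y" "y * e = vv \<star> (e * y)" "x * y = vv \<star> (y * x)" "k \<le> m"
  shows "dp x m * dp e k = (\<Sum>j\<le>k. ((- 1) ^ j * vv powi (- (int (m - j) * int (k - j))))
      \<star> (dp e (k - j) * dp y j * dp x (m - j)))"
  using assms(4)
proof (induction k)
  case 0
  then show ?case by (simp add: smul_simps)
next
  case (Suc k)
  define T where "T = (\<lambda>j. dp e (Suc k - j) * dp y j * dp x (m - j))"
  define c where "c = (\<lambda>k j. (- 1) ^ j * vv powi (- (int (m - j) * int (k - j))))"
  have step: "dp e (k - j) * dp y j * dp x (m - j) * e
      = (vv powi (2 * int j - int m) * qint (Suc k - j)) \<star> T j - qint (Suc j) \<star> T (Suc j)" if jk: "j \<le> k" for j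
  proof -
    obtain r where r: "m - j = Suc r" using jk Suc.prems by (cases "m - j") auto
    then have r': "m - Suc j = r" by simp
    have kj: "Suc k - j = Suc (k - j)" using jk by simp
    have "dp e (k - j) * dp y j * dp x (m - j) * e
      = vv powi (- int (Suc r)) \<star> (dp e (k - j) * (dp y j * e) * dp x (Suc r))
        - dp e (k - j) * (dp y j * y) * dp x r"
      unfolding r by (simp only: mult.assoc dp_qcomm(1)[OF assms(1-3)] right_diff_distrib smul_simps)
    also have "\<dots> = (vv powi (- int (Suc r)) * vv powi int j) \<star> ((dp e (k - j) * e) * dp y j * dp x (Suc r))
        - qint (Suc j) \<star> (dp e (k - j) * dp y (Suc j) * dp x r)"
      unfolding dp_qcomm(2)[OF assms(1-3)] dp_Suc by (simp only: smul_simps mult.assoc dp_Suc')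
    also have "vv powi (- int (Suc r)) * vv powi int j = vv powi (2 * int j - int m)"
    proof -
      have "- int (Suc r) + int j = 2 * int j - int m" using r jk Suc.prems by linarith
      then show ?thesis by (metis power_int_add vv_nonzero)
    qed
    finally show ?thesis unfolding T_def dp_Suc r r' kj diff_Suc_Suc by (simp only: smul_simps)
  qed
  \<comment> \<open>The monomial T j arises from term j by enlarging the power of e and from term j
    - 1 by enlarging the power of y. The two contributions add up to [k + 1], split as j + (k + 1 -
    j) by \<open>qint_add\<close>.\<close>
  have coef: "c k j * (vv powi (2 * int j - int m) * qint (Suc k - j)) + (if j = 0 then 0 else - (c k (j - 1) * qint j))
      = qint (Suc k) * c (Suc k) j" if j: "j \<le> Suc k" for j
  proof (cases j)
    case 0
    then show ?thesis
      by (simp add: c_def power_int_diff power_int_minus power_int_add field_simps)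
  next
    case (Suc i)
    define Z where "Z = vv powi (- (int (m - j) * int (Suc k - j)))"
    define W where "W = vv powi (- (int (m - j) * int (k - j)))"
    define V where "V = vv powi (2 * int j - int m)"
    define Q where "Q = qint (Suc k - j)"
    define A where "A = vv powi int j"
    define B where "B = vv powi (- int (Suc k - j))"
    \<comment> \<open>At j = Suc k the difference k - j is truncated and the exponents do not match,
      but then Q is [0] = 0.\<close>
    have a: "W * (V * Q) = Z * (A * Q)"
    proof (cases "j = Suc k")
      case False
      then have "int (Suc k - j) = int (k - j) + 1" "int (m - j) = int m - int j"
        using j Suc.prems by linarith+
      then have "- (int (m - j) * int (k - j)) + (2 * int j - int m) = - (int (m - j) * int (Suc k - j)) + int j"
        by (simp add: algebra_simps)
      then have "W * V = Z * A"
        unfolding W_def Z_def V_def A_def by (metis power_int_add vv_nonzero)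
      then show ?thesis by (simp only: flip: mult.assoc)
    qed (simp add: Q_def)
    have ij: "int (m - i) = int (m - j) + 1" "k - i = Suc k - j"
      using Suc Suc.prems j by linarith+
    have "- (int (m - i) * int (k - i)) = - (int (m - j) * int (Suc k - j)) + - int (Suc k - j)"
      unfolding ij by (simp add: algebra_simps)
    then have b: "vv powi (- (int (m - i) * int (k - i))) = Z * B"
      unfolding Z_def B_def by (metis power_int_add vv_nonzero)
    have q: "qint (Suc k) = A * Q + B * qint j"
      using qint_add[of j "Suc k - j"] j by (simp add: A_def B_def Q_def)
    have c: "c k j = (- 1) ^ j * W"
      "c k (j - 1) = - ((- 1) ^ j * (Z * B))" "c (Suc k) j = (- 1) ^ j * Z"
      using Suc b by (simp_all add: c_def Z_def W_def)
    have j0: "j \<noteq> 0" using Suc by simp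
    have "c k j * (V * Q) + (if j = 0 then 0 else - (c k (j - 1) * qint j)) = qint (Suc k) * c (Suc k) j"
      unfolding c q mult.assoc a using j0 by (simp add: algebra_simps)
    then show ?thesis by (simp add: V_def Q_def)
  qed
  have "qint (Suc k) \<star> (dp x m * dp e (Suc k)) = (dp x m * dp e k) * e"
    by (simp only: mult.assoc dp_Suc smul_simps)
  also have "\<dots> = (\<Sum>j\<le>k. c k j \<star> (dp e (k - j) * dp y j * dp x (m - j) * e))"
    using Suc by (simp add: c_def sum_distrib_right smul_simps)
  also have "\<dots> = (\<Sum>j\<le>k. c k j \<star> ((vv powi (2 * int j - int m) * qint (Suc k - j)) \<star> T j - qint (Suc j) \<star> T (Suc j)))"
    by (intro sum.cong refl) (simp add: step)
  also have "\<dots> = (\<Sum>j\<le>k. (c k j * (vv powi (2 * int j - int m) * qint (Suc k - j))) \<star> T j)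
      + (\<Sum>j\<le>k. (- (c k j * qint (Suc j))) \<star> T (Suc j))"
    by (simp add: smul_simps smul_uminus sum_subtractf sum_negf)
  \<comment> \<open>The additional summand j = Suc k carries the factor [0] = 0.\<close>
  also have "(\<Sum>j\<le>k. (c k j * (vv powi (2 * int j - int m) * qint (Suc k - j))) \<star> T j)
      = (\<Sum>j\<le>Suc k. (c k j * (vv powi (2 * int j - int m) * qint (Suc k - j))) \<star> T j)"
    by (simp add: smul_def)
  also have "(\<Sum>j\<le>k. (- (c k j * qint (Suc j))) \<star> T (Suc j))
      = (\<Sum>j\<le>Suc k. (if j = 0 then 0 else - (c k (j - 1) * qint j)) \<star> T j)"
    by (simp add: sum.atMost_Suc_shift smul_def del: sum.atMost_Suc)
  also have "(\<Sum>j\<le>Suc k. (c k j * (vv powi (2 * int j - int m) * qint (Suc k - j))) \<star> T j)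
      + (\<Sum>j\<le>Suc k. (if j = 0 then 0 else - (c k (j - 1) * qint j)) \<star> T j)
      = (\<Sum>j\<le>Suc k. (qint (Suc k) * c (Suc k) j) \<star> T j)"
    unfolding sum.distrib[symmetric] smul_add[symmetric]
    by (intro sum.cong refl) (simp only: coef atMost_iff)
  also have "\<dots> = qint (Suc k) \<star> (\<Sum>j\<le>Suc k. c (Suc k) j \<star> T j)"
    by (simp only: smul_sum smul_simps)
  finally have "qint (Suc k) \<star> (dp x m * dp e (Suc k)) = qint (Suc k) \<star> (\<Sum>j\<le>Suc k. c (Suc k) j \<star> T j)" .
  then have "dp x m * dp e (Suc k) = (\<Sum>j\<le>Suc k. c (Suc k) j \<star> T j)"
    using qint_nonzero[of "Suc k"] by (simp add: smul_cancel)
  then show ?case by (simp add: c_def T_def mult.assoc)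
qed

definition GOP :: "nat \<Rightarrow> endo set" where "GOP n = op ` GA n"

lemma GOP_add: "a \<in> GOP n \<Longrightarrow> b \<in> GOP n \<Longrightarrow> a + b \<in> GOP n"
  and GOP_mult: "a \<in> GOP n \<Longrightarrow> b \<in> GOP n \<Longrightarrow> a * b \<in> GOP n"
  unfolding GOP_def by (auto simp flip: op_add op_mult intro!: imageI GA_add GA_mult)

lemma GOP_smul: "c \<in> laurent \<Longrightarrow> a \<in> GOP n \<Longrightarrow> c \<star> a \<in> GOP n"
  unfolding smul_def using GA_cst[of c n] by (intro GOP_mult) (force simp: GOP_def)

lemma GOP_uminus: "a \<in> GOP n \<Longrightarrow> - a \<in> GOP n"
  using GOP_smul[of "-1" a n] by (simp add: smul_uminus smul_simps)

lemma GOP_sum: "(\<And>i. i \<in> S \<Longrightarrow> a i \<in> GOP n) \<Longrightarrow> (\<Sum>i\<in>S. a i) \<in> GOP n"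
proof (induction S rule: infinite_finite_induct)
  case (insert x F)
  then show ?case by (simp add: GOP_add)
qed (use GA_cst[of 0 n] in \<open>force simp: GOP_def\<close>)+

text \<open>In the expansion of the product of the m-th divided powers of x and e, the term j = m is
  the m-th divided power of y up to sign, and all others contain smaller divided powers of y only.
  Solving for it gives an integral expression.\<close>

lemma dp_rvec_GOP:
  assumes "serre_family e" "\<And>i m. Suc i < n \<Longrightarrow> dp (e i) m \<in> GOP n" "i < k" "k < n"
  shows "dp (rvec e i k) m \<in> GOP n"
  using assms(3)
proof (induction "k - i" arbitrary: i m)
  case (Suc r)
  show ?case
  proof (cases "Suc i < k")
    case True
    define x where "x = rvec e (Suc i) k"
    define y where "y = rvec e i k"
    have y: "y = qcomm (e i) x" unfolding x_def y_def by (rule rvec_Suc[OF True])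
    have x: "dp x m \<in> GOP n" for m
      unfolding x_def by (rule Suc.hyps(1)) (use Suc True in auto)
    have E: "dp (e i) m \<in> GOP n" for m
      by (rule assms(2)) (use True assms(4) in simp)
    have 1: "x * e i = inverse vv \<star> (e i * x) - y" unfolding y qcomm_def by simp
    have 2: "y * e i = vv \<star> (e i * y)" using rvec_left[OF assms(1) True] by (simp add: y_def smul_simps)
    have 3: "x * y = vv \<star> (y * x)" using rvec_right[OF assms(1) True] by (simp add: x_def y_def smul_simps)
    have "dp y m \<in> GOP n" for m
    proof (induction m rule: less_induct)
      case (less m)
      define t where "t = (\<lambda>j. ((- 1) ^ j * vv powi (- (int (m - j) * int (m - j))))
        \<star> (dp (e i) (m - j) * dp y j * dp x (m - j)))"
      have "dp x m * dp (e i) m = (\<Sum>j\<le>m. t j)"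
        unfolding t_def by (rule dp_qcomm_expand[OF 1 2 3 order_refl])
      also have "\<dots> = (\<Sum>j<m. t j) + (- 1) ^ m \<star> dp y m"
        by (simp add: t_def lessThan_Suc_atMost[symmetric])
      finally have "(- 1) ^ m \<star> dp y m = dp x m * dp (e i) m + - (\<Sum>j<m. t j)" by simp
      then have "(- 1) ^ m \<star> ((- 1) ^ m \<star> dp y m) = (- 1) ^ m \<star> (dp x m * dp (e i) m + - (\<Sum>j<m. t j))"
        by simp
      then have "dp y m = (- 1) ^ m \<star> (dp x m * dp (e i) m + - (\<Sum>j<m. t j))"
        by (simp add: smul_simps(3,6) flip: power_add mult_2)
      moreover have "t j \<in> GOP n" if "j < m" for j
        unfolding t_def using that by (intro GOP_smul GOP_mult E x less) simp_all
      ultimately show ?case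
        by (auto intro!: GOP_smul GOP_add GOP_mult GOP_uminus GOP_sum E x simp del: add_uminus_conv_diff)
    qed
    then show ?thesis by (simp add: y_def)
  next
    case False
    then have "k = Suc i" using Suc.prems by simp
    then show ?thesis using assms(2)[of i m] assms(4) by (simp add: rvec_simple)
  qed
qed simp

lemma op_pos_vec: "i < k \<Longrightarrow> op (pos_vec i k) = rvec ee i k"
proof (induction "k - i" arbitrary: i)
  case (Suc r)
  then show ?case
    by (cases "Suc i < k") (simp_all add: pos_vec.simps[of i] rvec.simps[of _ i] qcomm_def smul_def mult.assoc)
qed simp

lemma vv_inverse_cancel: "vv * (inverse vv * c) = c"
  by (simp flip: mult.assoc)

text \<open>The recursion for negative root vectors is -v times the bracket \<open>qcomm\<close>. So
  they agree with \<open>rvec ff\<close> up to a unit, and one integrality proof serves both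
  signs.\<close>

lemma op_neg_vec: "i < k \<Longrightarrow> op (neg_vec i k) = (- vv) ^ (k - Suc i) \<star> rvec ff i k"
proof (induction "k - i" arbitrary: i)
  case (Suc r)
  show ?case
  proof (cases "Suc i < k")
    case True
    then have IH: "op (neg_vec (Suc i) k) = (- vv) ^ (k - Suc (Suc i)) \<star> rvec ff (Suc i) k"
      using Suc by auto
    have k: "k - Suc i = Suc (k - Suc (Suc i))" using True by simp
    have "op (neg_vec i k) = vv \<star> (op (neg_vec (Suc i) k) * ff i) - ff i * op (neg_vec (Suc i) k)"
      using True by (simp add: neg_vec.simps[of i] smul_def mult.assoc)
    then show ?thesis unfolding IH k rvec_Suc[OF True] qcomm_def
      by (simp add: smul_simps smul_uminus mult_ac vv_inverse_cancel)
  next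
    case False
    then have "k = Suc i" using Suc.prems by simp
    then show ?thesis by (simp add: neg_vec.simps[of i] rvec_simple smul_simps)
  qed
qed simp

lemma dp_smul_left: "dp (c \<star> a) m = c ^ m \<star> dp a m"
proof -
  have "(c \<star> a) ^ m = c ^ m \<star> a ^ m"
    by (induction m) (simp_all add: smul_simps mult_ac)
  then show ?thesis by (simp add: dp_smul smul_simps mult.commute)
qed

lemma C_pos_vec: "i < k \<Longrightarrow> k < n \<Longrightarrow> pos_vec i k \<in> C n"
proof (induction "k - i" arbitrary: i)
  case (Suc r)
  then show ?case by (cases "Suc i < k") (simp_all add: pos_vec.simps[of i])
qed simp

lemma C_neg_vec: "i < k \<Longrightarrow> k < n \<Longrightarrow> neg_vec i k \<in> C n"
proof (induction "k - i" arbitrary: i)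
  case (Suc r)
  then show ?case by (cases "Suc i < k") (simp_all add: neg_vec.simps[of i])
qed simp

lemma C_root_vec: "i \<noteq> j \<Longrightarrow> i < n \<Longrightarrow> j < n \<Longrightarrow> root_vec (i, j) \<in> C n"
  by (simp add: root_vec_def C_pos_vec C_neg_vec)

lemma GA_iff: "x \<in> C n \<Longrightarrow> op x \<in> GOP n \<Longrightarrow> x \<in> GA n"
  unfolding GOP_def by (auto intro: GA_cong)

lemma GA_divpow_root_vec:
  assumes "i \<noteq> j" "i < n" "j < n"
  shows "divpow (root_vec (i, j)) m \<in> GA n"
proof (rule GA_iff)
  show "divpow (root_vec (i, j)) m \<in> C n" using assms by (simp add: C_root_vec)
  have e: "serre_family ee" "serre_family ff"
    by (auto simp: serre_family_def serre_ee serre_ff intro: ee_comm ff_comm)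
  have E: "dp (ee i) m \<in> GOP n" "dp (ff i) m \<in> GOP n" if "Suc i < n" for i m
    using GA_E[OF that, of m] GA_F[OF that, of m] unfolding GOP_def by (force simp: image_iff)+
  show "op (divpow (root_vec (i, j)) m) \<in> GOP n"
  proof (cases "i < j")
    case True
    then show ?thesis
      using assms by (simp add: root_vec_def op_pos_vec dp_rvec_GOP[OF e(1) E(1)])
  next
    case False
    then show ?thesis
      using assms by (simp add: root_vec_def op_neg_vec dp_smul_left GOP_smul dp_rvec_GOP[OF e(2) E(2)])
  qed
qed

section \<open>Root vectors on words\<close>

lemma app_smul [simp]: "app (c \<star> a) f I = c * app a f I"
  by (simp add: smul_def)

lemma app_sum_fun: "app a (\<lambda>I. \<Sum>j\<in>S. f j I) = (\<lambda>I. \<Sum>j\<in>S. app a (f j) I)"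
  by (induction S rule: infinite_finite_induct) (simp_all add: app_zero app_add)

lemma rvec_ee_wt:
  assumes "i < k"
  shows "app (rvec ee i k) (\<lambda>I. vv powi (wt c I) * f I)
    = (\<lambda>I. vv powi (c k - c i) * (vv powi (wt c I) * app (rvec ee i k) f I))"
  using assms
proof (induction "k - i" arbitrary: i f)
  case (Suc m)
  show ?case
  proof (cases "Suc i < k")
    case True
    have IH: "app (rvec ee (Suc i) k) (\<lambda>I. vv powi (wt c I) * f I)
      = (\<lambda>I. vv powi (c k - c (Suc i)) * (vv powi (wt c I) * app (rvec ee (Suc i) k) f I))" for f
      by (rule Suc.hyps(1)) (use Suc True in auto)
    show ?thesis unfolding rvec_Suc[OF True] qcomm_def
      by (rule ext) (simp add: IH ee_wt' app_cmult, simp add: power_int_diff field_simps)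
  next
    case False
    then have "k = Suc i" using Suc.prems by simp
    then show ?thesis by (simp add: rvec_simple ee_wt')
  qed
qed simp

lemma rvec_ee_Nil: "i < k \<Longrightarrow> app (rvec ee i k) f [] = 0"
proof (induction "k - i" arbitrary: i f)
  case (Suc m)
  then show ?case by (cases "Suc i < k") (simp_all add: rvec.simps[of _ i] qcomm_def)
qed simp

text \<open>This is the comultiplication of a root vector on coordinates: either the whole root acts
  on the tail, or the first letter i is read from k directly, or it is read from an intermediate j
  while the rest of the root, from j to k, acts on the tail.\<close>

lemma rvec_ee_Cons:
  assumes "i < k"
  shows "app (rvec ee i k) f (x # I) = app (rvec ee i k) (\<lambda>I. f (x # I)) I
    + (if x = i then vv powi (int i + 1 - int k) * (vv powi (wt (rho i k) I) * f (k # I))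
        + (\<Sum>j\<in>{i<..<k}. (inverse vv - vv) * (vv powi (int i + 1 - int j)
            * (vv powi (wt (rho i j) I) * app (rvec ee j k) (\<lambda>I. f (j # I)) I))) else 0)"
  using assms
proof (induction "k - i" arbitrary: i f x I)
  case (Suc m)
  show ?case
  proof (cases "Suc i < k")
    case True
    define Y where "Y = rvec ee (Suc i) k"
    define S where "S = (\<lambda>f I. vv powi (int i + 2 - int k) * (vv powi (wt (rho (Suc i) k) I) * f (k # I))
        + (\<Sum>j\<in>{Suc i<..<k}. (inverse vv - vv) * (vv powi (int i + 2 - int j)
            * (vv powi (wt (rho (Suc i) j) I) * app (rvec ee j k) (\<lambda>I. f (j # I)) I))))"
    have Y: "app Y f (x # I) = app Y (\<lambda>I. f (x # I)) I + (if x = Suc i then S f I else 0)" for f x I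
      unfolding Y_def S_def using Suc.hyps(1)[of "Suc i" f x I] Suc.hyps(2) True
      by (simp add: algebra_simps)
    have c: "app (ee i) (app (rvec ee j k) g) = app (rvec ee j k) (app (ee i) g)" if "Suc i < j" "j < k" for j g
    proof -
      have "serre_family ee" by (auto simp: serre_family_def serre_ee intro: ee_comm)
      from rvec_commute[OF this that] show ?thesis by (metis app_times)
    qed
    \<comment> \<open>Only letters beyond i + 1 and roots that start there occur in S, so
      \<open>ee i\<close> passes through it with a single factor v from the weights. That factor
      cancels the inverse v of the bracket, and no terms for the first letter i + 1 survive.\<close>
    have eS: "app (ee i) (S f) I = vv * S (app (ee i) f) I" for f I
    proof -
      have "app (ee i) (S f) I = vv powi (int i + 2 - int k) * (vv * (vv powi (wt (rho (Suc i) k) I) * app (ee i) (\<lambda>I. f (k # I)) I))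
        + (\<Sum>j\<in>{Suc i<..<k}. (inverse vv - vv) * (vv powi (int i + 2 - int j)
            * (vv * (vv powi (wt (rho (Suc i) j) I) * app (ee i) (app (rvec ee j k) (\<lambda>I. f (j # I))) I))))"
        unfolding S_def app_add app_sum_fun app_cmult ee_wt' using True
        by (intro arg_cong2[of _ _ _ _ "(+)"] sum.cong) (auto simp: rho_def eps_def)
      moreover have "app (ee i) f (j # I) = app (ee i) (\<lambda>I. f (j # I)) I" if "Suc i < j" for j I
        using that by simp
      ultimately show ?thesis unfolding S_def using True
        by (simp add: c distrib_left sum_distrib_left mult_ac)
    qed
    have split: "{i<..<k} = insert (Suc i) {Suc i<..<k}" using True by auto
    have yw: "app Y (\<lambda>I. vv powi (wt (rho i (Suc i)) I) * g I) I
        = vv * (vv powi (wt (rho i (Suc i)) I) * app Y g I)" for g I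
      unfolding Y_def rvec_ee_wt[OF True] using True by (simp add: rho_def eps_def)
    have eq: "app (qcomm (ee i) Y) f (x # I)
      = inverse vv * app (ee i) (app Y f) (x # I) - app Y (app (ee i) f) (x # I)"
      by (simp add: qcomm_def)
    have e1: "app (ee i) (app Y f) (x # I) = app (ee i) (app Y (\<lambda>I. f (x # I))) I
        + (if x = Suc i then app (ee i) (S f) I else 0)
        + (if x = i then vv powi (wt (rho i (Suc i)) I) * (app Y (\<lambda>I. f (Suc i # I)) I + S f I) else 0)"
      by (simp add: Y app_add app_zero)
    have e2: "app Y (app (ee i) f) (x # I) = app Y (app (ee i) (\<lambda>I. f (x # I))) I
        + (if x = i then vv * (vv powi (wt (rho i (Suc i)) I) * app Y (\<lambda>I. f (Suc i # I)) I) else 0)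
        + (if x = Suc i then S (app (ee i) f) I else 0)"
      by (simp add: Y app_add app_zero yw)
    have "app (qcomm (ee i) Y) f (x # I) = app (qcomm (ee i) Y) (\<lambda>I. f (x # I)) I
      + (if x = i then (inverse vv - vv) * (vv powi (wt (rho i (Suc i)) I) * app Y (\<lambda>I. f (Suc i # I)) I)
          + inverse vv * (vv powi (wt (rho i (Suc i)) I) * S f I) else 0)"
      unfolding eq e1 e2 eS by (simp add: qcomm_def algebra_simps)
    also have "inverse vv * (vv powi (wt (rho i (Suc i)) I) * S f I)
      = vv powi (int i + 1 - int k) * (vv powi (wt (rho i k) I) * f (k # I))
        + (\<Sum>j\<in>{Suc i<..<k}. (inverse vv - vv) * (vv powi (int i + 1 - int j)
            * (vv powi (wt (rho i j) I) * app (rvec ee j k) (\<lambda>I. f (j # I)) I)))"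
    proof -
      have p: "inverse vv * (vv powi (wt (rho i (Suc i)) I) * (vv powi (int i + 2 - int j) * (vv powi (wt (rho (Suc i) j) I) * z)))
        = vv powi (int i + 1 - int j) * (vv powi (wt (rho i j) I) * z)" for j z
        by (simp add: wt_rho power_int_diff power_int_add field_simps power2_eq_square)
      show ?thesis unfolding S_def distrib_left sum_distrib_left p
        by (intro arg_cong2[of _ _ _ _ "(+)"] sum.cong refl)
          (simp only: mult.left_commute[of _ "inverse vv - vv"] p)
    qed
    finally show ?thesis unfolding rvec_Suc[OF True] split Y_def[symmetric]
      by (simp add: Y_def algebra_simps)
  next
    case False
    then have "k = Suc i" using Suc.prems by simp
    moreover have "{i<..<Suc i} = {}" by auto
    ultimately show ?thesis by (simp add: rvec_simple)
  qed
qed simp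

lemma op_neg_vec_Suc: "Suc i < k \<Longrightarrow> op (neg_vec i k) = vv \<star> (op (neg_vec (Suc i) k) * ff i) - ff i * op (neg_vec (Suc i) k)"
  by (simp add: neg_vec.simps[of i] smul_def mult.assoc)

lemma op_neg_vec_simple: "op (neg_vec i (Suc i)) = ff i"
  by (simp add: neg_vec.simps[of i])

lemma neg_vec_Nil: "i < k \<Longrightarrow> app (op (neg_vec i k)) f [] = 0"
proof (induction "k - i" arbitrary: i f)
  case (Suc m)
  then show ?case by (cases "Suc i < k") (simp_all add: neg_vec.simps[of i])
qed simp

text \<open>The counterpart for negative roots. Here the first tensor factor carries the K-factor,
  so it is the letter x, not the tail, that determines the power of v.\<close>

lemma neg_vec_Cons:
  assumes "i < k"
  shows "app (op (neg_vec i k)) f (x # I) = vv powi (rho k i x) * app (op (neg_vec i k)) (\<lambda>I. f (x # I)) I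
    + (if x = k then vv powi (int k - int i - 1) * f (i # I)
        + (\<Sum>j\<in>{i<..<k}. (vv * vv - 1) * (vv powi (int k - int j - 1) * app (op (neg_vec i j)) (\<lambda>I. f (j # I)) I)) else 0)"
  using assms
proof (induction "k - i" arbitrary: i f x I)
  case (Suc m)
  show ?case
  proof (cases "Suc i < k")
    case True
    define Y where "Y = op (neg_vec (Suc i) k)"
    define S where "S = (\<lambda>f I. vv powi (int k - int i - 2) * f (Suc i # I)
        + (\<Sum>j\<in>{Suc i<..<k}. (vv * vv - 1) * (vv powi (int k - int j - 1) * app (op (neg_vec (Suc i) j)) (\<lambda>I. f (j # I)) I)))"
    have Y: "app Y f (x # I) = vv powi (rho k (Suc i) x) * app Y (\<lambda>I. f (x # I)) I + (if x = k then S f I else 0)" for f x I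
      unfolding Y_def S_def using Suc.hyps(1)[of "Suc i" f x I] Suc.hyps(2) True
      by (simp add: algebra_simps)
    have split: "{i<..<k} = insert (Suc i) {Suc i<..<k}" using True by auto
    \<comment> \<open>The term \<open>f (Suc i # I)\<close> of S yields two: the direct term with i,
      and the chain term j = Suc i, whose factor v^2 - 1 comes from passing the first letter in two
      orders. All other chain terms have their root extended by i.\<close>
    have S1: "vv * S (app (ff i) f) I - app (ff i) (S f) I = vv powi (int k - int i - 1) * f (i # I)
        + (\<Sum>j\<in>{i<..<k}. (vv * vv - 1) * (vv powi (int k - int j - 1) * app (op (neg_vec i j)) (\<lambda>I. f (j # I)) I))" for f I
    proof -
      have f1: "(\<lambda>I. app (ff i) f (Suc i # I)) = (\<lambda>I. vv * app (ff i) (\<lambda>I. f (Suc i # I)) I + f (i # I))"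
        by (simp add: rho_def eps_def)
      have f2: "(\<lambda>I. app (ff i) f (j # I)) = app (ff i) (\<lambda>I. f (j # I))" if "Suc i < j" for j
        using that by (simp add: rho_def eps_def)
      have n: "app (op (neg_vec i j)) g I = vv * app (op (neg_vec (Suc i) j)) (app (ff i) g) I
          - app (ff i) (app (op (neg_vec (Suc i) j)) g) I" if "Suc i < j" for j g I
        by (simp add: op_neg_vec_Suc[OF that])
      have p: "vv powi (int k - int i - 1) = vv * vv powi (int k - int i - 2)"
        "vv powi (int k - int (Suc i) - 1) = vv powi (int k - int i - 2)"
        by (simp_all add: power_int_diff power2_eq_square)
      have "app (ff i) (S f) I = vv powi (int k - int i - 2) * app (ff i) (\<lambda>I. f (Suc i # I)) I
        + (\<Sum>j\<in>{Suc i<..<k}. (vv * vv - 1) * (vv powi (int k - int j - 1) * app (ff i) (app (op (neg_vec (Suc i) j)) (\<lambda>I. f (j # I))) I))"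
        unfolding S_def app_add app_sum_fun app_cmult ..
      moreover have "S (app (ff i) f) I = vv powi (int k - int i - 2) * (vv * app (ff i) (\<lambda>I. f (Suc i # I)) I + f (i # I))
        + (\<Sum>j\<in>{Suc i<..<k}. (vv * vv - 1) * (vv powi (int k - int j - 1) * app (op (neg_vec (Suc i) j)) (app (ff i) (\<lambda>I. f (j # I))) I))"
        unfolding S_def using fun_cong[OF f1, of I]
        by (intro arg_cong2[of _ _ _ _ "(+)"] sum.cong) (auto simp: f2 simp del: app_ff)
      moreover have "(\<Sum>j\<in>{Suc i<..<k}. (vv * vv - 1) * (vv powi (int k - int j - 1) * app (op (neg_vec i j)) (\<lambda>I. f (j # I)) I))
        = vv * (\<Sum>j\<in>{Suc i<..<k}. (vv * vv - 1) * (vv powi (int k - int j - 1) * app (op (neg_vec (Suc i) j)) (app (ff i) (\<lambda>I. f (j # I))) I))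
         - (\<Sum>j\<in>{Suc i<..<k}. (vv * vv - 1) * (vv powi (int k - int j - 1) * app (ff i) (app (op (neg_vec (Suc i) j)) (\<lambda>I. f (j # I))) I))"
        unfolding sum_distrib_left sum_subtractf[symmetric]
        by (intro sum.cong refl) (simp add: n right_diff_distrib mult_ac)
      moreover have "(\<Sum>j\<in>{i<..<k}. h j) = h (Suc i) + (\<Sum>j\<in>{Suc i<..<k}. h j)" for h :: "nat \<Rightarrow> Qv"
        by (simp add: split)
      ultimately show ?thesis unfolding p op_neg_vec_simple
        by (simp only: p op_neg_vec_simple) (simp add: algebra_simps)
    qed
    have eq: "app (op (neg_vec i k)) f (x # I) = vv * app Y (app (ff i) f) (x # I) - app (ff i) (app Y f) (x # I)" for f x I
      by (simp add: op_neg_vec_Suc[OF True] Y_def del: app_ff)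
    have eq': "app (op (neg_vec i k)) f I = vv * app Y (app (ff i) f) I - app (ff i) (app Y f) I" for f I
      by (simp add: op_neg_vec_Suc[OF True] Y_def)
    have Yl: "app Y (\<lambda>I. c * f I + g I) = (\<lambda>I. c * app Y f I + app Y g I)" for c f g
      by (simp add: app_add app_cmult)
    consider "x = k" | "x = i" | "x = Suc i" | "x \<noteq> k" "x \<noteq> i" "x \<noteq> Suc i" by blast
    then show ?thesis
    proof cases
      case 1
      have k: "k \<noteq> i" "k \<noteq> Suc i" using True by auto
      have "app (op (neg_vec i k)) f (k # I) = vv * (vv * app Y (app (ff i) (\<lambda>I. f (k # I))) I - app (ff i) (app Y (\<lambda>I. f (k # I))) I)
        + (vv * S (app (ff i) f) I - app (ff i) (S f) I)"
        unfolding eq Y using k by (simp add: Y app_add app_cmult rho_def eps_def algebra_simps)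
      then show ?thesis unfolding S1 eq' using 1 k by (simp add: rho_def eps_def)
    next
      case 2
      then show ?thesis unfolding eq Y eq' using True
        by (simp add: Y app_add app_cmult rho_def eps_def) (simp add: power_int_minus field_simps)
    next
      case 3
      then show ?thesis unfolding eq Y eq' using True
        by (simp add: Y app_add app_cmult rho_def eps_def power_int_minus Yl) (simp add: field_simps)
    next
      case 4
      then show ?thesis unfolding eq Y eq' using True
        by (simp add: Y app_add app_cmult rho_def eps_def)
    qed
  next
    case False
    then have "k = Suc i" using Suc.prems by simp
    moreover have "{i<..<Suc i} = {}" by auto
    ultimately show ?thesis by (simp add: op_neg_vec_simple)
  qed
qed simp

section \<open>A common description of root vectors of both signs\<close>

definition btw :: "nat \<Rightarrow> nat \<Rightarrow> nat \<Rightarrow> bool" where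
  "btw t j s \<longleftrightarrow> (t < j \<and> j < s) \<or> (s < j \<and> j < t)"

text \<open>The arguments are source and target: this root vector sends the basis vector s of the
  natural module to a multiple of the basis vector t, whatever the order of s and t.\<close>

definition rv :: "nat \<Rightarrow> nat \<Rightarrow> endo" where
  "rv s t = op (root_vec (t, s))"

text \<open>The coefficient of a direct replacement at the head of a word; \<open>rv_beta\<close>
  below is that of passing over a letter. Both are powers of v.\<close>

definition rv_alpha :: "nat \<Rightarrow> nat \<Rightarrow> nat list \<Rightarrow> Qv" where
  "rv_alpha s t I = (if t < s then vv powi (int t + 1 - int s + wt (rho t s) I) else vv powi (int t - int s - 1))"

definition rv_beta :: "nat \<Rightarrow> nat \<Rightarrow> nat \<Rightarrow> Qv" where
  "rv_beta s t x = (if t < s then 1 else vv powi (rho t s x))"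

lemma rv_Nil: "s \<noteq> t \<Longrightarrow> app (rv s t) f [] = 0"
  by (auto simp: rv_def root_vec_def op_pos_vec rvec_ee_Nil neg_vec_Nil)

text \<open>The coefficients of the longer chains are left unspecified: for leading terms it matters
  only which words such chains reach.\<close>

lemma rv_Cons:
  assumes "s \<noteq> t"
  shows "\<exists>\<gamma>. \<forall>f x I. app (rv s t) f (x # I) = rv_beta s t x * app (rv s t) (\<lambda>I. f (x # I)) I
    + (if x = t then rv_alpha s t I * f (s # I)
        + (\<Sum>j | btw t j s. \<gamma> j I * app (rv s j) (\<lambda>I. f (j # I)) I) else 0)"
proof (cases "t < s")
  case True
  have b: "{j. btw t j s} = {t<..<s}" using True by (auto simp: btw_def)
  have r: "rv s j = rvec ee j s" if "j < s" for j
    using that by (simp add: rv_def root_vec_def op_pos_vec)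
  have a: "rv_alpha s t I = vv powi (int t + 1 - int s) * vv powi (wt (rho t s) I)" for I
    using True by (simp add: rv_alpha_def flip: power_int_add)
  show ?thesis
    by (rule exI[of _ "\<lambda>j I. (inverse vv - vv) * (vv powi (int t + 1 - int j) * vv powi (wt (rho t j) I))"])
      (use True in \<open>simp add: b r a rvec_ee_Cons rv_beta_def mult.assoc\<close>)
next
  case False
  have b: "{j. btw t j s} = {s<..<t}" using False by (auto simp: btw_def)
  have r: "rv s j = op (neg_vec s j)" if "s < j" for j
    using that by (simp add: rv_def root_vec_def)
  show ?thesis
    by (rule exI[of _ "\<lambda>j I. (vv * vv - 1) * vv powi (int t - int j - 1)"])
      (use False assms in \<open>simp add: b r rv_alpha_def neg_vec_Cons rv_beta_def mult.assoc\<close>)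
qed

text \<open>
  The words contributing to a coordinate of the image under a root vector: read from right to
  left, the source letter \<open>s\<close> moves towards \<open>t\<close> in steps taken at different positions.
\<close>

inductive ch :: "nat \<Rightarrow> nat \<Rightarrow> nat list \<Rightarrow> nat list \<Rightarrow> bool" for s where
  ch_direct: "ch s t (t # I) (s # I)"
| ch_skip: "ch s t I I' \<Longrightarrow> ch s t (x # I) (x # I')"
| ch_chain: "ch s j I I' \<Longrightarrow> btw t j s \<Longrightarrow> ch s t (t # I) (j # I')"

lemma rv_cong:
  assumes "s \<noteq> t" "\<And>I'. ch s t I I' \<Longrightarrow> f I' = g I'"
  shows "app (rv s t) f I = app (rv s t) g I"
  using assms
proof (induction I arbitrary: t f g)
  case Nil
  then show ?case by (simp add: rv_Nil)
next
  case (Cons x I)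
  have 1: "app (rv s t) (\<lambda>I. f (x # I)) I = app (rv s t) (\<lambda>I. g (x # I)) I"
    by (rule Cons.IH) (use Cons.prems ch_skip in auto)
  have 2: "f (s # I) = g (s # I)" if "x = t"
    using that Cons.prems(2) ch_direct by auto
  have 3: "app (rv s j) (\<lambda>I. f (j # I)) I = app (rv s j) (\<lambda>I. g (j # I)) I" if "x = t" "btw t j s" for j
    by (rule Cons.IH) (use that Cons.prems(2) ch_chain in \<open>auto simp: btw_def\<close>)
  obtain \<gamma> where "\<forall>f x I. app (rv s t) f (x # I) = rv_beta s t x * app (rv s t) (\<lambda>I. f (x # I)) I
    + (if x = t then rv_alpha s t I * f (s # I)
        + (\<Sum>j | btw t j s. \<gamma> j I * app (rv s j) (\<lambda>I. f (j # I)) I) else 0)"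
    using rv_Cons[OF Cons.prems(1)] ..
  then show ?case using 1 2 3 by simp
qed

lemma rv_nonzero:
  assumes "s \<noteq> t" "app (rv s t) f I \<noteq> 0"
  obtains I' where "ch s t I I'" "f I' \<noteq> 0"
  using rv_cong[OF assms(1), of I f "\<lambda>I. 0"] assms(2) by (auto simp: app_zero)

text \<open>Direct replacements and chains both alter the letter at which they act. If the support
  of g prescribes the prefix P, all its letters can only be passed over.\<close>

lemma rv_prefix:
  assumes "s \<noteq> t" "\<And>I'. g I' \<noteq> 0 \<Longrightarrow> \<exists>R. I' = P @ R"
  shows "app (rv s t) g (P @ L) = prod_list (map (rv_beta s t) P) * app (rv s t) (\<lambda>I. g (P @ I)) L"
  using assms(2)
proof (induction P arbitrary: g)
  case (Cons x P)
  obtain \<gamma> where e: "\<forall>f x I. app (rv s t) f (x # I) = rv_beta s t x * app (rv s t) (\<lambda>I. f (x # I)) I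
    + (if x = t then rv_alpha s t I * f (s # I)
        + (\<Sum>j | btw t j s. \<gamma> j I * app (rv s j) (\<lambda>I. f (j # I)) I) else 0)"
    using rv_Cons[OF assms(1)] ..
  have z: "g (y # I) = 0" if "y \<noteq> x" for y I
    using Cons.prems[of "y # I"] that by auto
  have "app (rv s t) (\<lambda>I. g (x # I)) (P @ L) = prod_list (map (rv_beta s t) P) * app (rv s t) (\<lambda>I. g (x # P @ I)) L"
    by (rule Cons.IH) (use Cons.prems in fastforce)
  moreover have "g (s # P @ L) = 0" if "x = t" using z that assms(1) by simp
  moreover have "app (rv s j) (\<lambda>I. g (j # I)) (P @ L) = 0" if "x = t" "btw t j s" for j
  proof -
    have "(\<lambda>I. g (j # I)) = (\<lambda>I. 0)" using z that by (auto simp: btw_def)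
    then show ?thesis by (simp add: app_zero)
  qed
  ultimately show ?case by (simp add: e)
qed simp

lemma rv_group:
  assumes "s \<noteq> t" "\<And>I'. h I' \<noteq> 0 \<Longrightarrow> \<exists>l<j. I' = replicate l t @ s # replicate (j - 1 - l) t @ R"
  shows "app (rv s t) h (replicate j t @ R)
    = (\<Sum>l<j. rv_beta s t t ^ l * rv_alpha s t (replicate (j - 1 - l) t @ R) * h (replicate l t @ s # replicate (j - 1 - l) t @ R))"
  using assms(2)
proof (induction j arbitrary: h)
  case 0
  then have "h = (\<lambda>I. 0)" by auto
  then show ?case by (simp add: app_zero)
next
  case (Suc j)
  obtain \<gamma> where e: "\<forall>f x I. app (rv s t) f (x # I) = rv_beta s t x * app (rv s t) (\<lambda>I. f (x # I)) I
    + (if x = t then rv_alpha s t I * f (s # I)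
        + (\<Sum>j | btw t j s. \<gamma> j I * app (rv s j) (\<lambda>I. f (j # I)) I) else 0)"
    using rv_Cons[OF assms(1)] ..
  have "app (rv s i) (\<lambda>I. h (i # I)) (replicate j t @ R) = 0" if "btw t i s" for i
  proof -
    have "h (i # I) = 0" for I
    proof (rule ccontr)
      assume "h (i # I) \<noteq> 0"
      from Suc.prems[OF this] obtain l where "i # I = replicate l t @ s # replicate (Suc j - 1 - l) t @ R" by blast
      then show False using that by (cases l) (auto simp: btw_def)
    qed
    then show ?thesis by (simp add: app_zero)
  qed
  moreover have "app (rv s t) (\<lambda>I. h (t # I)) (replicate j t @ R)
    = (\<Sum>l<j. rv_beta s t t ^ l * rv_alpha s t (replicate (j - 1 - l) t @ R) * h (t # replicate l t @ s # replicate (j - 1 - l) t @ R))"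
  proof (rule Suc.IH)
    fix I' assume "h (t # I') \<noteq> 0"
    from Suc.prems[OF this] obtain l where l: "l < Suc j" "t # I' = replicate l t @ s # replicate (Suc j - 1 - l) t @ R" by blast
    then obtain m where "l = Suc m" using assms(1) by (cases l) auto
    then show "\<exists>l<j. I' = replicate l t @ s # replicate (j - 1 - l) t @ R" using l by auto
  qed
  ultimately show ?case
    by (simp add: e sum.lessThan_Suc_shift sum_distrib_left mult_ac del: sum.lessThan_Suc)
qed

lemma geometric_qint:
  "(\<Sum>l<j. vv powi (2 * int l)) = vv powi (int j - 1) * qint j"
  "(\<Sum>l<j. vv powi (- 2 * int l)) = vv powi (1 - int j) * qint j"
proof -
  have "vv powi (int (Suc j) - 1) * qint (Suc j) = vv powi (int j - 1) * qint j + vv powi (2 * int j)" for j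
  proof -
    have q: "qint (Suc j) = inverse vv * qint j + vv ^ j"
      using qint_add'[of 1 j] by (simp add: power_int_minus)
    have p: "vv powi (2 * int j) = vv powi int j * vv powi int j"
      by (simp only: mult_2 power_int_add vv_nonzero simp_thms)
    show ?thesis unfolding q p by (simp add: power_int_diff field_simps)
  qed
  then show "(\<Sum>l<j. vv powi (2 * int l)) = vv powi (int j - 1) * qint j"
    by (induction j) (simp_all del: of_nat_Suc)
  have "vv powi (1 - int (Suc j)) * qint (Suc j) = vv powi (1 - int j) * qint j + vv powi (- 2 * int j)" for j
  proof -
    have q: "qint (Suc j) = vv * qint j + vv powi (- int j)"
      using qint_add[of 1 j] by simp
    have e: "- 2 * int j = - int j + - int j" by simp
    have p: "vv powi (- 2 * int j) = vv powi (- int j) * vv powi (- int j)"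
      by (simp only: e power_int_add vv_nonzero simp_thms)
    show ?thesis unfolding q p by (simp add: power_int_diff power_int_minus field_simps)
  qed
  then show "(\<Sum>l<j. vv powi (- 2 * int l)) = vv powi (1 - int j) * qint j"
    by (induction j) (simp_all del: of_nat_Suc)
qed

text \<open>Within a block of equal column letters, moving s to the left past one letter t costs one
  power of v, whose sign depends on the order of s and t.\<close>

lemma qsym_move:
  assumes "qsym f (J1 @ replicate (Suc l) c @ J3)" "length I1 = length J1" "s \<noteq> t"
  shows "f (I1 @ replicate l t @ s # R) = vv powi (if t < s then - int l else int l) * f (I1 @ s # replicate l t @ R)"
  using assms(1,2)
proof (induction l arbitrary: I1 J1)
  case (Suc l)
  have "f ((I1 @ [t]) @ replicate l t @ s # R) = vv powi (if t < s then - int l else int l) * f ((I1 @ [t]) @ s # replicate l t @ R)"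
    by (rule Suc.IH[of "J1 @ [c]"]) (use Suc.prems in auto)
  moreover have J: "J1 @ replicate (Suc (Suc l)) c @ J3 = J1 @ c # c # replicate l c @ J3" by simp
  have "f (I1 @ t # s # replicate l t @ R) = vv powi (if t < s then -1 else 1) * f (I1 @ s # t # replicate l t @ R)"
  proof (cases "t < s")
    case True
    from qsymD[OF Suc.prems(1) J Suc.prems(2) this] show ?thesis using True by (simp add: power_int_minus)
  next
    case False
    then have "s < t" using assms(3) by simp
    from qsymD[OF Suc.prems(1) J Suc.prems(2) this] show ?thesis using False by simp
  qed
  ultimately show ?case
    by (simp add: power_int_add power_int_diff power_int_minus field_simps)
qed simp

text \<open>If only direct replacements within a group of j letters t contribute,
  \<open>qsym\<close> makes their j values equal up to powers of v. These powers form a geometric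
  progression, whose sum is a unit times [j].\<close>

lemma rv_leading:
  assumes st: "s \<noteq> t" and q: "qsym f (J1 @ replicate j s @ J3)" and l: "length I1 = length J1"
    and sup: "\<And>I'. ch s t (I1 @ replicate j t @ R) I' \<Longrightarrow> f I' \<noteq> 0
      \<Longrightarrow> \<exists>l<j. I' = I1 @ replicate l t @ s # replicate (j - 1 - l) t @ R"
    and "j > 0"
  obtains u where "is_unit_laurent u" "app (rv s t) f (I1 @ replicate j t @ R) = u * qint j * f (I1 @ s # replicate (j - 1) t @ R)"
proof -
  define G where "G = (\<lambda>I'. \<exists>l<j. I' = I1 @ replicate l t @ s # replicate (j - 1 - l) t @ R)"
  define g where "g = (\<lambda>I'. if G I' then f I' else 0)"
  define b where "b = prod_list (map (rv_beta s t) I1)"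
  have ub: "is_unit_laurent b"
    unfolding b_def by (induction I1) (simp_all add: rv_beta_def)
  have "app (rv s t) f (I1 @ replicate j t @ R) = app (rv s t) g (I1 @ replicate j t @ R)"
    by (rule rv_cong[OF st]) (use sup in \<open>auto simp: g_def G_def\<close>)
  also have "\<dots> = b * app (rv s t) (\<lambda>I. g (I1 @ I)) (replicate j t @ R)"
    unfolding b_def by (rule rv_prefix[OF st]) (auto simp: g_def G_def split: if_splits)
  also have "app (rv s t) (\<lambda>I. g (I1 @ I)) (replicate j t @ R)
    = (\<Sum>l<j. rv_beta s t t ^ l * rv_alpha s t (replicate (j - 1 - l) t @ R) * g (I1 @ replicate l t @ s # replicate (j - 1 - l) t @ R))"
    by (rule rv_group[OF st]) (auto simp: g_def G_def split: if_splits)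
  also have "\<dots> = (\<Sum>l<j. rv_beta s t t ^ l * rv_alpha s t (replicate (j - 1 - l) t @ R)
      * (vv powi (if t < s then - int l else int l) * f (I1 @ s # replicate (j - 1) t @ R)))"
  proof (intro sum.cong refl)
    fix l assume "l \<in> {..<j}"
    then have lj: "l < j" by simp
    then have J: "J1 @ replicate j s @ J3 = J1 @ replicate (Suc l) s @ replicate (j - 1 - l) s @ J3"
      by (simp flip: replicate_add add: replicate_append_same) (simp flip: append_assoc replicate_add replicate_Suc)
    have "replicate (j - 1) t = replicate l t @ replicate (j - 1 - l) t"
      using lj by (simp flip: replicate_add)
    moreover have "g (I1 @ replicate l t @ s # replicate (j - 1 - l) t @ R) = f (I1 @ replicate l t @ s # replicate (j - 1 - l) t @ R)"
      using lj by (auto simp: g_def G_def)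
    ultimately show "rv_beta s t t ^ l * rv_alpha s t (replicate (j - 1 - l) t @ R) * g (I1 @ replicate l t @ s # replicate (j - 1 - l) t @ R)
      = rv_beta s t t ^ l * rv_alpha s t (replicate (j - 1 - l) t @ R) * (vv powi (if t < s then - int l else int l) * f (I1 @ s # replicate (j - 1) t @ R))"
      using qsym_move[OF q[unfolded J] l st, of "replicate (j - 1 - l) t @ R"] by simp
  qed
  also have "\<dots> = (\<Sum>l<j. rv_beta s t t ^ l * rv_alpha s t (replicate (j - 1 - l) t @ R) * vv powi (if t < s then - int l else int l))
      * f (I1 @ s # replicate (j - 1) t @ R)"
    by (simp add: sum_distrib_right mult.assoc)
  finally have 1: "app (rv s t) f (I1 @ replicate j t @ R)
    = b * (\<Sum>l<j. rv_beta s t t ^ l * rv_alpha s t (replicate (j - 1 - l) t @ R) * vv powi (if t < s then - int l else int l))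
      * f (I1 @ s # replicate (j - 1) t @ R)" by simp
  \<comment> \<open>For t < s the letters t to the right of the replaced one contribute v^(j-1-l)
    and the move v^(-l); for t > s the letters passed over contribute v^l and the move another v^l.
    So the ratio is v^(-2) or v^2.\<close>
  have "\<exists>u. is_unit_laurent u \<and> (\<Sum>l<j. rv_beta s t t ^ l * rv_alpha s t (replicate (j - 1 - l) t @ R)
      * vv powi (if t < s then - int l else int l)) = u * qint j"
  proof (cases "t < s")
    case True
    define c where "c = vv powi (int t + 1 - int s + wt (rho t s) R + int (j - 1))"
    have w: "wt (rho t s) (replicate m t) = int m" for m
      using True by (induction m) (simp_all add: rho_def eps_def)
    have "(\<Sum>l<j. rv_beta s t t ^ l * rv_alpha s t (replicate (j - 1 - l) t @ R) * vv powi (if t < s then - int l else int l))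
      = (\<Sum>l<j. c * vv powi (- 2 * int l))"
    proof (intro sum.cong refl)
      fix l assume "l \<in> {..<j}"
      then have e: "int (j - Suc l) = int (j - Suc 0) - int l" by simp
      show "rv_beta s t t ^ l * rv_alpha s t (replicate (j - 1 - l) t @ R) * vv powi (if t < s then - int l else int l) = c * vv powi (- 2 * int l)"
        using True unfolding c_def rv_alpha_def rv_beta_def by (simp add: w e algebra_simps flip: power_int_add)
    qed
    then show ?thesis
      by (intro exI[of _ "c * vv powi (1 - int j)"]) (simp only: geometric_qint flip: sum_distrib_left, simp add: c_def)
  next
    case False
    have "rv_beta s t t = vv" using False st by (simp add: rv_beta_def rho_def eps_def)
    moreover have p: "vv ^ l * (c * vv powi int l) = c * vv powi (2 * int l)" for l c
    proof -
      have e: "vv powi (2 * int l) = vv powi int l * vv powi int l"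
        by (simp only: mult_2 power_int_add vv_nonzero simp_thms)
      show ?thesis unfolding e by (simp add: mult_ac)
    qed
    ultimately have "(\<Sum>l<j. rv_beta s t t ^ l * rv_alpha s t (replicate (j - 1 - l) t @ R) * vv powi (if t < s then - int l else int l))
      = (\<Sum>l<j. vv powi (int t - int s - 1) * vv powi (2 * int l))"
      using False by (intro sum.cong refl) (simp only: rv_alpha_def p if_False mult.assoc)
    then show ?thesis
      by (intro exI[of _ "vv powi (int t - int s - 1) * vv powi (int j - 1)"]) (simp only: geometric_qint flip: sum_distrib_left, simp)
  qed
  then obtain u where u: "is_unit_laurent u" "(\<Sum>l<j. rv_beta s t t ^ l * rv_alpha s t (replicate (j - 1 - l) t @ R)
      * vv powi (if t < s then - int l else int l)) = u * qint j" by blast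
  show thesis
    by (rule that[of "b * u"]) (use 1 u ub in simp_all)
qed

section \<open>Classes of pairs of words\<close>

text \<open>
  A pair of words \<open>(I, J)\<close> of equal length is classified by the matrix whose entry \<open>(a, b)\<close>
  counts the positions where \<open>I\<close> has the letter \<open>a\<close> and \<open>J\<close> the letter \<open>b\<close>; it is stored as a multiset.
  The sign \<open>\<epsilon>\<close> exchanges the roles of raising and lowering root vectors.
\<close>

definition cls :: "nat list \<Rightarrow> nat list \<Rightarrow> (nat \<times> nat) multiset" where
  "cls I J = mset (zip I J)"

lemma cls_simps [simp]: "cls [] J = {#}" "cls (a # I) (b # J) = add_mset (a, b) (cls I J)"
  by (simp_all add: cls_def)

lemma cls_append: "length I = length J \<Longrightarrow> cls (I @ I') (J @ J') = cls I J + cls I' J'"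
  by (simp add: cls_def)

definition srt :: "int \<Rightarrow> nat list \<Rightarrow> bool" where
  "srt \<epsilon> J \<longleftrightarrow> sorted_wrt (\<lambda>a b. \<epsilon> * int a \<le> \<epsilon> * int b) J"

lemma srt_Cons [simp]: "srt \<epsilon> (b # J) \<longleftrightarrow> (\<forall>c\<in>set J. \<epsilon> * int b \<le> \<epsilon> * int c) \<and> srt \<epsilon> J"
  by (simp add: srt_def)

lemma srt_block:
  assumes "srt \<epsilon> J" "\<epsilon> \<noteq> 0"
  obtains J1 m J3 where "J = J1 @ replicate m s @ J3" "s \<notin> set J1" "s \<notin> set J3"
proof -
  have "\<exists>J1 m J3. J = J1 @ replicate m s @ J3 \<and> s \<notin> set J1 \<and> s \<notin> set J3"
    using assms(1)
  proof (induction J)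
    case (Cons b J)
    then obtain J1 m J3 where J: "J = J1 @ replicate m s @ J3" "s \<notin> set J1" "s \<notin> set J3" by auto
    show ?case
    proof (cases "b = s")
      case False
      then show ?thesis using J by (intro exI[of _ "b # J1"] exI[of _ m] exI[of _ J3]) simp
    next
      case True
      show ?thesis
      proof (cases "m = 0")
        case True
        then show ?thesis using J \<open>b = s\<close> by (intro exI[of _ "[]"] exI[of _ 1] exI[of _ J]) simp
      next
        case False
        have "J1 = []"
        proof (rule ccontr)
          assume "J1 \<noteq> []"
          then obtain c J1' where J1: "J1 = c # J1'" by (cases J1) auto
          have "srt \<epsilon> (c # J1' @ replicate m s @ J3)" "\<epsilon> * int b \<le> \<epsilon> * int c" using Cons.prems J J1 by auto
          then have "\<epsilon> * int c \<le> \<epsilon> * int s" using False by auto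
          moreover have "\<epsilon> * int s \<le> \<epsilon> * int c" using \<open>\<epsilon> * int b \<le> \<epsilon> * int c\<close> True by simp
          ultimately have "\<epsilon> * int c = \<epsilon> * int s" by (rule order_antisym)
          then have "c = s" using assms(2) by simp
          then show False using J(2) J1 by simp
        qed
        then show ?thesis using J True by (intro exI[of _ "[]"] exI[of _ "Suc m"] exI[of _ J3]) simp
      qed
    qed
  qed (auto intro!: exI[of _ "[]"] exI[of _ 0])
  then show thesis using that by blast
qed

lemma qsym_Cons: "qsym f (b # J) \<Longrightarrow> qsym (\<lambda>I. f (a # I)) J"
  unfolding qsym_def
proof (intro allI impI)
  fix J1 :: "nat list" and c J3 and I1 :: "nat list" and x y :: nat and I3
  assume *: "\<forall>J1 c J3 I1 x y I3. b # J = J1 @ c # c # J3 \<longrightarrow> length I1 = length J1 \<longrightarrow> x < y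
     \<longrightarrow> f (I1 @ y # x # I3) = vv * f (I1 @ x # y # I3)"
    and "J = J1 @ c # c # J3" "length I1 = length J1" "x < y"
  then show "f (a # I1 @ y # x # I3) = vv * f (a # I1 @ x # y # I3)"
    using *[rule_format, of "b # J1" c J3 "a # I1" x y I3] by simp
qed

lemma qsym_unit_move:
  assumes "qsym f (M @ replicate (Suc (length L)) b @ J3)" "length P = length M"
  shows "\<exists>u. is_unit_laurent u \<and> f (P @ L @ a # R) = u * f (P @ a # L @ R)"
  using assms
proof (induction L arbitrary: P M)
  case Nil
  then show ?case using unit_1 by force
next
  case (Cons c L)
  have "\<exists>u. is_unit_laurent u \<and> f ((P @ [c]) @ L @ a # R) = u * f ((P @ [c]) @ a # L @ R)"
    by (rule Cons.IH[of "M @ [b]"]) (use Cons.prems in auto)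
  then obtain u where u: "is_unit_laurent u" "f (P @ c # L @ a # R) = u * f (P @ c # a # L @ R)" by auto
  have J: "M @ replicate (Suc (length (c # L))) b @ J3 = M @ b # b # replicate (length L) b @ J3" by simp
  have "\<exists>w. is_unit_laurent w \<and> f (P @ c # a # L @ R) = w * f (P @ a # c # L @ R)"
  proof (cases c a rule: linorder_cases)
    case less
    then have "f (P @ c # a # L @ R) = inverse vv * f (P @ a # c # L @ R)"
      using qsymD[OF Cons.prems(1) J Cons.prems(2), of c a] by simp
    moreover have "is_unit_laurent (inverse vv)" using unit_powi[of "-1"] by (simp add: power_int_minus)
    ultimately show ?thesis by blast
  next
    case equal
    then show ?thesis by (intro exI[of _ 1]) simp
  next
    case greater
    then have "f (P @ c # a # L @ R) = vv * f (P @ a # c # L @ R)"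
      using qsymD[OF Cons.prems(1) J Cons.prems(2), of a c] by simp
    moreover have "is_unit_laurent vv" using unit_powi[of 1] by simp
    ultimately show ?thesis by blast
  qed
  then obtain w where "is_unit_laurent w" "f (P @ c # a # L @ R) = w * f (P @ a # c # L @ R)" by blast
  then show ?case using u by (intro exI[of _ "u * w"]) simp
qed

text \<open>When J is sorted, equal column letters are adjacent, and two words in the same class
  differ by permutations inside these blocks. Each exchange there costs a unit by
  \<open>qsym\<close>.\<close>

lemma qsym_class:
  assumes "qsym f J" "srt \<epsilon> J" "\<epsilon> \<noteq> 0" "length I = length J" "length I' = length J" "cls I J = cls I' J"
  shows "\<exists>u. is_unit_laurent u \<and> f I' = u * f I"
  using assms(1,2,4,5,6)
proof (induction J arbitrary: I I' f)
  case Nil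
  then show ?case by (intro exI[of _ 1]) simp
next
  case (Cons b J)
  then obtain a I0 where I: "I = a # I0" by (cases I) auto
  have "(a, b) \<in> set (zip I' (b # J))"
    using Cons.prems(5) unfolding I by (metis cls_def cls_simps(2) set_mset_mset union_single_eq_member)
  then obtain p where p: "p < length I'" "I' ! p = a" "(b # J) ! p = b"
    using Cons.prems(4) by (auto simp: in_set_conv_nth)
  define L where "L = take p I'"
  define R where "R = drop (Suc p) I'"
  define J3 where "J3 = drop (Suc p) (b # J)"
  have I': "I' = L @ a # R" and lL: "length L = p"
    using p by (auto simp: L_def R_def id_take_nth_drop)
  \<comment> \<open>Sortedness squeezes all column letters between two occurrences of b, so the
    letter at p can travel to the front inside one block.\<close>
  have "(b # J) ! q = b" if "q \<le> p" for q
  proof -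
    have q: "q < length (b # J)" using that p(1) Cons.prems(4) by simp
    have "\<epsilon> * int b \<le> \<epsilon> * int ((b # J) ! q)"
      using Cons.prems(2) q by (cases q) auto
    moreover have "\<epsilon> * int ((b # J) ! q) \<le> \<epsilon> * int ((b # J) ! p)"
    proof (cases "q = p")
      case False
      then show ?thesis
        using sorted_wrt_nth_less[OF Cons.prems(2)[unfolded srt_def], of q p] that p(1) Cons.prems(4) by simp
    qed simp
    ultimately show ?thesis using p(3) assms(3) by simp
  qed
  then have "take (Suc p) (b # J) = replicate (Suc p) b"
    using p(1) Cons.prems(4) by (intro nth_equalityI) (auto simp del: take_Suc_Cons replicate_Suc)
  then have bJ: "b # J = replicate (Suc p) b @ J3"
    unfolding J3_def by (metis append_take_drop_id)
  then have J: "J = replicate p b @ J3" by simp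
  obtain u where u: "is_unit_laurent u" "f (L @ a # R) = u * f (a # L @ R)"
    using qsym_unit_move[of f "[]" L b J3 "[]"] Cons.prems(1) bJ lL by auto
  have bJ': "b # J = replicate p b @ b # J3" using bJ by (simp add: replicate_app_Cons_same)
  have "cls (L @ a # R) (replicate p b @ b # J3) = add_mset (a, b) (cls (L @ R) (replicate p b @ J3))"
    using lL by (simp only: cls_append length_replicate cls_simps union_mset_add_mset_right)
  then have "cls I' (b # J) = add_mset (a, b) (cls (L @ R) J)"
    unfolding I' bJ' unfolding J .
  then have "cls I0 J = cls (L @ R) J"
    using Cons.prems(5) I by simp
  then have "\<exists>w. is_unit_laurent w \<and> f (a # L @ R) = w * f (a # I0)"
    using Cons.prems I I' by (intro Cons.IH qsym_Cons) auto
  then obtain w where w: "is_unit_laurent w" "f (a # L @ R) = w * f (a # I0)" by blast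
  show ?case using u w I I' by (intro exI[of _ "u * w"]) simp
qed

section \<open>The statistic on classes and its change along a replacement\<close>

definition Hm :: "(nat \<times> nat) multiset \<Rightarrow> int" where
  "Hm M = (\<Sum>p\<in>#M. int (fst p) * int (snd p))"

lemma Hm_add [simp]: "Hm (add_mset (a, b) M) = int a * int b + Hm M"
  by (simp add: Hm_def)

text \<open>These are the possibilities that remain when the statistic takes its extreme value: one
  direct replacement opposite s, or a chain with at least two positions opposite s. The second is
  later excluded by choosing a suitable word in the class.\<close>

definition shape :: "nat \<Rightarrow> nat \<Rightarrow> nat list \<Rightarrow> nat list \<Rightarrow> nat list \<Rightarrow> bool" where
  "shape s t J I I' \<longleftrightarrow> (\<exists>p<length I. I ! p = t \<and> J ! p = s \<and> I' = I[p := s])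
     \<or> (\<exists>p q. p < q \<and> q < length I \<and> I ! p = t \<and> J ! p = s \<and> btw t (I ! q) s \<and> J ! q = s)"

lemma shape_skip: "shape s t J I I' \<Longrightarrow> shape s t (b # J) (x # I) (x # I')"
proof -
  assume "shape s t J I I'"
  then consider p where "p < length I" "I ! p = t" "J ! p = s" "I' = I[p := s]"
    | p q where "p < q" "q < length I" "I ! p = t" "J ! p = s" "btw t (I ! q) s" "J ! q = s"
    unfolding shape_def by blast
  then show ?thesis
  proof cases
    case 1
    then show ?thesis unfolding shape_def by (intro disjI1 exI[of _ "Suc p"]) simp
  next
    case 2
    then show ?thesis unfolding shape_def by (intro disjI2 exI[of _ "Suc p"] exI[of _ "Suc q"]) simp
  qed
qed

lemma shape_chain: "shape s j J I I' \<Longrightarrow> btw t j s \<Longrightarrow> shape s t (s # J) (t # I) K"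
proof -
  assume "shape s j J I I'" and b: "btw t j s"
  then obtain p where "p < length I" "I ! p = j" "J ! p = s"
    unfolding shape_def using order.strict_trans by blast
  then show ?thesis using b unfolding shape_def by (intro disjI2 exI[of _ 0] exI[of _ "Suc p"]) simp
qed

lemma shape_direct: "shape s t (s # J) (t # I) (s # I)"
  unfolding shape_def by (intro disjI1 exI[of _ 0]) simp

lemma step_le:
  fixes \<epsilon> :: int
  assumes "\<epsilon> = 1 \<or> \<epsilon> = -1" "\<epsilon> * int t < \<epsilon> * int s" "\<epsilon> * int c \<le> \<epsilon> * int b"
  shows "(int t - int s) * int b \<le> (int t - int s) * int c"
    and "(int t - int s) * int b = (int t - int s) * int c \<Longrightarrow> b = c"
proof -
  show "(int t - int s) * int b \<le> (int t - int s) * int c"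
    using assms by (auto intro: mult_left_mono mult_left_mono_neg)
  show "(int t - int s) * int b = (int t - int s) * int c \<Longrightarrow> b = c"
    using assms(2) by auto
qed

lemma btw_eps: "(\<epsilon> :: int) = 1 \<or> \<epsilon> = -1 \<Longrightarrow> btw t j s \<Longrightarrow> \<epsilon> * int t < \<epsilon> * int s
    \<Longrightarrow> \<epsilon> * int t < \<epsilon> * int j \<and> \<epsilon> * int j < \<epsilon> * int s"
  by (auto simp: btw_def)

lemma ch_length: "ch s t I I' \<Longrightarrow> length I = length I'"
  by (induction rule: ch.induct) auto

text \<open>By triangularity a source letter s stands opposite some b with \<epsilon> s \<le>
  \<epsilon> b, which makes the change at most (t - s) * s. Since the column word falls in the
  \<epsilon>-order, earlier steps of a chain meet still larger b, and the bounds telescope. A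
  diagonal entry can be lost only at s.\<close>

lemma ch_clean:
  fixes \<epsilon> :: int
  assumes "ch s t I I'" "\<epsilon> = 1 \<or> \<epsilon> = -1" "\<epsilon> * int t < \<epsilon> * int s"
    and "srt (- \<epsilon>) J" "length I' = length J" "\<forall>(a, b)\<in>set (zip I' J). \<epsilon> * int a \<le> \<epsilon> * int b"
  shows "(\<forall>(a, b)\<in>set (zip I J). \<epsilon> * int a \<le> \<epsilon> * int b) \<and> (\<exists>b\<in>set J. \<epsilon> * int s \<le> \<epsilon> * int b)
    \<and> Hm (cls I J) - Hm (cls I' J) \<le> (int t - int s) * int s
    \<and> (Hm (cls I J) - Hm (cls I' J) = (int t - int s) * int s \<longrightarrow>
        add_mset (s, s) (cls I J) = add_mset (t, s) (cls I' J) \<and> shape s t J I I')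
    \<and> (\<forall>k. count (cls I' J) (k, k) \<le> count (cls I J) (k, k) + (if k = s then 1 else 0))"
  using assms(1,3-6)
proof (induction arbitrary: J rule: ch.induct)
  case (ch_direct t I)
  then obtain b J' where J: "J = b # J'" by (cases J) auto
  have sb: "\<epsilon> * int s \<le> \<epsilon> * int b" using ch_direct.prems J by simp
  note st = step_le[OF assms(2) ch_direct.prems(1) sb]
  have "Hm (cls (t # I) J) - Hm (cls (s # I) J) = (int t - int s) * int b"
    by (simp add: J algebra_simps)
  then show ?case using st sb ch_direct.prems unfolding J
    by (auto simp: shape_direct)
next
  case (ch_skip t I I' x)
  then obtain b J' where J: "J = b # J'" by (cases J) auto
  have IH: "(\<forall>(a, b)\<in>set (zip I J'). \<epsilon> * int a \<le> \<epsilon> * int b) \<and> (\<exists>b\<in>set J'. \<epsilon> * int s \<le> \<epsilon> * int b)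
    \<and> Hm (cls I J') - Hm (cls I' J') \<le> (int t - int s) * int s
    \<and> (Hm (cls I J') - Hm (cls I' J') = (int t - int s) * int s \<longrightarrow>
        add_mset (s, s) (cls I J') = add_mset (t, s) (cls I' J') \<and> shape s t J' I I')
    \<and> (\<forall>k. count (cls I' J') (k, k) \<le> count (cls I J') (k, k) + (if k = s then 1 else 0))"
    by (rule ch_skip.IH) (use ch_skip.prems J in auto)
  have "\<forall>k. count (cls (x # I') J) (k, k) \<le> count (cls (x # I) J) (k, k) + (if k = s then 1 else 0)"
  proof
    fix k
    have "count (cls I' J') (k, k) \<le> count (cls I J') (k, k) + (if k = s then 1 else 0)" using IH by blast
    then show "count (cls (x # I') J) (k, k) \<le> count (cls (x # I) J) (k, k) + (if k = s then 1 else 0)"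
      unfolding J by (simp only: cls_simps count_add_mset) (simp split: if_splits)
  qed
  moreover have "\<forall>(a, b)\<in>set (zip (x # I) J). \<epsilon> * int a \<le> \<epsilon> * int b" "\<exists>b\<in>set J. \<epsilon> * int s \<le> \<epsilon> * int b"
    using IH ch_skip.prems J by auto
  moreover have "Hm (cls (x # I) J) - Hm (cls (x # I') J) = Hm (cls I J') - Hm (cls I' J')" by (simp add: J)
  moreover have "add_mset (s, s) (cls I J') = add_mset (t, s) (cls I' J') \<Longrightarrow>
      add_mset (s, s) (cls (x # I) J) = add_mset (t, s) (cls (x # I') J)"
    unfolding J cls_simps by (metis add_mset_commute)
  moreover have "shape s t J' I I' \<Longrightarrow> shape s t J (x # I) (x # I')"
    unfolding J by (rule shape_skip)
  ultimately show ?case using IH by simp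
next
  case (ch_chain j I I' t)
  then obtain b J' where J: "J = b # J'" by (cases J) auto
  have tj: "\<epsilon> * int t < \<epsilon> * int j" and js: "\<epsilon> * int j < \<epsilon> * int s"
    using btw_eps[OF assms(2) ch_chain.hyps(2) ch_chain.prems(1)] by auto
  have IH: "(\<forall>(a, b)\<in>set (zip I J'). \<epsilon> * int a \<le> \<epsilon> * int b) \<and> (\<exists>b\<in>set J'. \<epsilon> * int s \<le> \<epsilon> * int b)
    \<and> Hm (cls I J') - Hm (cls I' J') \<le> (int j - int s) * int s
    \<and> (Hm (cls I J') - Hm (cls I' J') = (int j - int s) * int s \<longrightarrow>
        add_mset (s, s) (cls I J') = add_mset (j, s) (cls I' J') \<and> shape s j J' I I')
    \<and> (\<forall>k. count (cls I' J') (k, k) \<le> count (cls I J') (k, k) + (if k = s then 1 else 0))"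
    by (rule ch_chain.IH) (use ch_chain.prems J js in auto)
  then obtain b' where "b' \<in> set J'" "\<epsilon> * int s \<le> \<epsilon> * int b'" by blast
  \<comment> \<open>The rest of the chain provides a column letter b' that is not below s, and the
    head b of the sorted column is not below b'.\<close>
  then have sb: "\<epsilon> * int s \<le> \<epsilon> * int b" using ch_chain.prems J by force
  note st = step_le[OF assms(2) tj sb]
  have H: "Hm (cls (t # I) J) - Hm (cls (j # I') J) = (int t - int j) * int b + (Hm (cls I J') - Hm (cls I' J'))"
    by (simp add: J algebra_simps)
  have split: "(int t - int s) * int s = (int t - int j) * int s + (int j - int s) * int s"
    by (simp add: algebra_simps)
  have le: "Hm (cls (t # I) J) - Hm (cls (j # I') J) \<le> (int t - int s) * int s"
    using IH st(1) unfolding H split by linarith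
  have eq: "add_mset (s, s) (cls (t # I) J) = add_mset (t, s) (cls (j # I') J) \<and> shape s t J (t # I) (j # I')"
    if "Hm (cls (t # I) J) - Hm (cls (j # I') J) = (int t - int s) * int s"
  proof -
    have "(int t - int j) * int b = (int t - int j) * int s" and e: "Hm (cls I J') - Hm (cls I' J') = (int j - int s) * int s"
      using IH st(1) that unfolding H split by linarith+
    then have b: "b = s" using st(2) by blast
    have "add_mset (s, s) (cls I J') = add_mset (j, s) (cls I' J')" "shape s j J' I I'" using IH e by auto
    then show ?thesis unfolding J b using shape_chain[OF _ ch_chain.hyps(2)] by simp
  qed
  \<comment> \<open>The letter j that the head had before stands strictly below its column letter,
    so the head contributes nothing to the old diagonal.\<close>
  have bj: "b \<noteq> j" "\<epsilon> * int t \<le> \<epsilon> * int b" using sb js tj by auto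
  have "\<forall>k. count (cls (j # I') J) (k, k) \<le> count (cls (t # I) J) (k, k) + (if k = s then 1 else 0)"
  proof
    fix k
    have "count (cls (j # I') J) (k, k) = count (cls I' J') (k, k)" using bj J by auto
    also have "\<dots> \<le> count (cls I J') (k, k) + (if k = s then 1 else 0)" using IH by blast
    also have "\<dots> \<le> count (cls (t # I) J) (k, k) + (if k = s then 1 else 0)" using J by simp
    finally show "count (cls (j # I') J) (k, k) \<le> count (cls (t # I) J) (k, k) + (if k = s then 1 else 0)" .
  qed
  moreover have "\<forall>(a, b)\<in>set (zip (t # I) J). \<epsilon> * int a \<le> \<epsilon> * int b" using IH bj J by auto
  moreover have "\<exists>b\<in>set J. \<epsilon> * int s \<le> \<epsilon> * int b" using sb J by auto
  ultimately show ?case using le eq by blast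
qed

text \<open>In the other direction the hypothesis concerns only the columns beyond s, where it keeps
  the source letter s away. Hence replaced letters stand opposite b with \<epsilon> b \<le>
  \<epsilon> s, and every estimate is reversed. The columns up to s are left unrestricted, which is
  the reason for a threshold.\<close>

lemma ch_good:
  fixes \<epsilon> :: int
  assumes "ch s t I I'" "\<epsilon> = 1 \<or> \<epsilon> = -1" "\<epsilon> * int t < \<epsilon> * int s"
    and "srt \<epsilon> J" "length I' = length J"
    and "\<forall>(a, b)\<in>set (zip I' J). \<epsilon> * int s < \<epsilon> * int b \<longrightarrow> \<epsilon> * int b \<le> \<epsilon> * int a"
  shows "(\<forall>(a, b)\<in>set (zip I J). \<epsilon> * int s < \<epsilon> * int b \<longrightarrow> \<epsilon> * int b \<le> \<epsilon> * int a)
    \<and> (\<exists>b\<in>set J. \<epsilon> * int b \<le> \<epsilon> * int s)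
    \<and> Hm (cls I J) - Hm (cls I' J) \<ge> (int t - int s) * int s
    \<and> (Hm (cls I J) - Hm (cls I' J) = (int t - int s) * int s \<longrightarrow>
        add_mset (s, s) (cls I J) = add_mset (t, s) (cls I' J) \<and> shape s t J I I')"
  using assms(1,3-6)
proof (induction arbitrary: J rule: ch.induct)
  case (ch_direct t I)
  then obtain b J' where J: "J = b # J'" by (cases J) auto
  have sb: "\<epsilon> * int b \<le> \<epsilon> * int s" using ch_direct.prems J by force
  note st = step_le[OF assms(2) ch_direct.prems(1) sb]
  have "Hm (cls (t # I) J) - Hm (cls (s # I) J) = (int t - int s) * int b"
    by (simp add: J algebra_simps)
  then show ?case using st sb ch_direct.prems unfolding J
    by (auto simp: shape_direct)
next
  case (ch_skip t I I' x)
  then obtain b J' where J: "J = b # J'" by (cases J) auto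
  have "(\<forall>(a, b)\<in>set (zip I J'). \<epsilon> * int s < \<epsilon> * int b \<longrightarrow> \<epsilon> * int b \<le> \<epsilon> * int a)
    \<and> (\<exists>b\<in>set J'. \<epsilon> * int b \<le> \<epsilon> * int s)
    \<and> Hm (cls I J') - Hm (cls I' J') \<ge> (int t - int s) * int s
    \<and> (Hm (cls I J') - Hm (cls I' J') = (int t - int s) * int s \<longrightarrow>
        add_mset (s, s) (cls I J') = add_mset (t, s) (cls I' J') \<and> shape s t J' I I')"
    by (rule ch_skip.IH) (use ch_skip.prems J in auto)
  then show ?case using ch_skip.prems unfolding J
    by (auto simp: shape_skip add_mset_commute)
next
  case (ch_chain j I I' t)
  then obtain b J' where J: "J = b # J'" by (cases J) auto
  have tj: "\<epsilon> * int t < \<epsilon> * int j" and js: "\<epsilon> * int j < \<epsilon> * int s"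
    using btw_eps[OF assms(2) ch_chain.hyps(2) ch_chain.prems(1)] by auto
  have IH: "(\<forall>(a, b)\<in>set (zip I J'). \<epsilon> * int s < \<epsilon> * int b \<longrightarrow> \<epsilon> * int b \<le> \<epsilon> * int a)
    \<and> (\<exists>b\<in>set J'. \<epsilon> * int b \<le> \<epsilon> * int s)
    \<and> Hm (cls I J') - Hm (cls I' J') \<ge> (int j - int s) * int s
    \<and> (Hm (cls I J') - Hm (cls I' J') = (int j - int s) * int s \<longrightarrow>
        add_mset (s, s) (cls I J') = add_mset (j, s) (cls I' J') \<and> shape s j J' I I')"
    by (rule ch_chain.IH) (use ch_chain.prems J js in auto)
  then obtain b' where "b' \<in> set J'" "\<epsilon> * int b' \<le> \<epsilon> * int s" by blast
  then have sb: "\<epsilon> * int b \<le> \<epsilon> * int s" using ch_chain.prems J by force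
  note st = step_le[OF assms(2) tj sb]
  have H: "Hm (cls (t # I) J) - Hm (cls (j # I') J) = (int t - int j) * int b + (Hm (cls I J') - Hm (cls I' J'))"
    by (simp add: J algebra_simps)
  have split: "(int t - int s) * int s = (int t - int j) * int s + (int j - int s) * int s"
    by (simp add: algebra_simps)
  have le: "Hm (cls (t # I) J) - Hm (cls (j # I') J) \<ge> (int t - int s) * int s"
    using IH st(1) unfolding H split by linarith
  have eq: "add_mset (s, s) (cls (t # I) J) = add_mset (t, s) (cls (j # I') J) \<and> shape s t J (t # I) (j # I')"
    if "Hm (cls (t # I) J) - Hm (cls (j # I') J) = (int t - int s) * int s"
  proof -
    have "(int t - int j) * int s = (int t - int j) * int b" and e: "Hm (cls I J') - Hm (cls I' J') = (int j - int s) * int s"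
      using IH st(1) that unfolding H split by linarith+
    then have b: "b = s" using st(2) by blast
    have "add_mset (s, s) (cls I J') = add_mset (j, s) (cls I' J')" "shape s j J' I I'" using IH e by auto
    then show ?thesis unfolding J b using shape_chain[OF _ ch_chain.hyps(2)] by simp
  qed
  have "\<forall>(a, b)\<in>set (zip (t # I) J). \<epsilon> * int s < \<epsilon> * int b \<longrightarrow> \<epsilon> * int b \<le> \<epsilon> * int a" using IH sb J by auto
  moreover have "\<exists>b\<in>set J. \<epsilon> * int b \<le> \<epsilon> * int s" using sb J by auto
  ultimately show ?case using le eq by blast
qed

section \<open>Leading terms\<close>

text \<open>The effect of one replacement on the leading class: an entry leaves the diagonal cell of
  the source and stays in its column.\<close>

definition mv :: "nat \<Rightarrow> nat \<Rightarrow> (nat \<times> nat) multiset \<Rightarrow> (nat \<times> nat) multiset" where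
  "mv s t M = add_mset (t, s) (M - {#(s, s)#})"

lemma Hm_mv: "(s, s) \<in># M \<Longrightarrow> Hm (mv s t M) = Hm M + (int t - int s) * int s"
proof -
  assume "(s, s) \<in># M"
  then obtain M' where "M = add_mset (s, s) M'" by (metis multi_member_split)
  then show ?thesis by (simp add: mv_def algebra_simps)
qed

lemma mv_eqI: "(s, s) \<in># M \<Longrightarrow> add_mset (s, s) X = add_mset (t, s) M \<Longrightarrow> X = mv s t M"
proof -
  assume "(s, s) \<in># M" and e: "add_mset (s, s) X = add_mset (t, s) M"
  then obtain M' where "M = add_mset (s, s) M'" by (metis multi_member_split)
  with e show ?thesis by (simp add: mv_def add_mset_commute)
qed

text \<open>The unit may vary with I, as entries in one class are related by units anyway.\<close>

definition lead :: "nat list \<Rightarrow> (nat \<times> nat) multiset \<Rightarrow> tens \<Rightarrow> Qv \<Rightarrow> bool" where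
  "lead J M f c \<longleftrightarrow> (\<forall>I. length I = length J \<longrightarrow> cls I J = M \<longrightarrow> (\<exists>u. is_unit_laurent u \<and> f I = u * c))"

text \<open>The last clause, a lower bound for the diagonal, later turns into an upper bound for the
  content of every monomial that elimination produces.\<close>

definition clean :: "int \<Rightarrow> nat list \<Rightarrow> (nat \<times> nat) multiset \<Rightarrow> tens \<Rightarrow> bool" where
  "clean \<epsilon> J M f \<longleftrightarrow> (\<forall>I. f I \<noteq> 0 \<longrightarrow> length I = length J
     \<and> (\<forall>(a, b)\<in>set (zip I J). \<epsilon> * int a \<le> \<epsilon> * int b) \<and> (cls I J = M \<or> Hm (cls I J) < Hm M)
     \<and> (\<forall>k. count M (k, k) \<le> count (cls I J) (k, k)))"

text \<open>The columns beyond the threshold c are those that no root vector with source up to c has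
  touched; only they are required to be triangular.\<close>

definition good :: "int \<Rightarrow> nat list \<Rightarrow> nat \<Rightarrow> (nat \<times> nat) multiset \<Rightarrow> tens \<Rightarrow> bool" where
  "good \<epsilon> J c M f \<longleftrightarrow> (\<forall>I. f I \<noteq> 0 \<longrightarrow> length I = length J
     \<and> (\<forall>(a, b)\<in>set (zip I J). \<epsilon> * int c < \<epsilon> * int b \<longrightarrow> \<epsilon> * int b \<le> \<epsilon> * int a)
     \<and> (cls I J = M \<or> Hm (cls I J) > Hm M))"

definition shaped :: "nat \<Rightarrow> nat \<Rightarrow> nat list \<Rightarrow> (nat \<times> nat) multiset \<Rightarrow> tens \<Rightarrow> bool" where
  "shaped s t J M f \<longleftrightarrow> (\<forall>I I'. length I = length J \<longrightarrow> cls I J = mv s t M \<longrightarrow> ch s t I I' \<longrightarrow> f I' \<noteq> 0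
     \<longrightarrow> shape s t J I I')"

lemma clean_step:
  fixes \<epsilon> :: int
  assumes e: "\<epsilon> = 1 \<or> \<epsilon> = -1" and ts: "\<epsilon> * int t < \<epsilon> * int s" and J: "srt (- \<epsilon>) J"
    and f: "clean \<epsilon> J M f" and M: "(s, s) \<in># M"
  shows "clean \<epsilon> J (mv s t M) (app (rv s t) f)" "shaped s t J M f"
proof -
  have st: "s \<noteq> t" using ts by auto
  have *: "(\<forall>(a, b)\<in>set (zip I J). \<epsilon> * int a \<le> \<epsilon> * int b) \<and> length I = length J
      \<and> (cls I J = mv s t M \<or> Hm (cls I J) < Hm (mv s t M))
      \<and> (\<forall>k. count (mv s t M) (k, k) \<le> count (cls I J) (k, k))
      \<and> (cls I J = mv s t M \<longrightarrow> shape s t J I I')"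
    if c: "ch s t I I'" and f0: "f I' \<noteq> 0" for I I'
  proof -
    have l: "length I' = length J" and tri: "\<forall>(a, b)\<in>set (zip I' J). \<epsilon> * int a \<le> \<epsilon> * int b"
      and H: "cls I' J = M \<or> Hm (cls I' J) < Hm M" and d: "\<And>k. count M (k, k) \<le> count (cls I' J) (k, k)"
      using f f0 unfolding clean_def by auto
    note cc = ch_clean[OF c e ts J l tri]
    have k: "count (mv s t M) (k, k) \<le> count (cls I J) (k, k)" for k
    proof -
      have "count (mv s t M) (k, k) = count M (k, k) - (if k = s then 1 else 0)"
        using st by (simp add: mv_def)
      then show ?thesis using d[of k] cc by (metis diff_le_mono le_diff_conv order_trans)
    qed
    have "Hm (cls I J) \<le> Hm (mv s t M)" using cc H unfolding Hm_mv[OF M] by auto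
    moreover have *: "cls I J = mv s t M \<and> shape s t J I I'" if "Hm (cls I J) = Hm (mv s t M)"
    proof -
      have "Hm (cls I J) - Hm (cls I' J) = (int t - int s) * int s" "cls I' J = M"
        using cc H that unfolding Hm_mv[OF M] by auto
      then show ?thesis using cc mv_eqI[OF M] by blast
    qed
    ultimately have H': "cls I J = mv s t M \<or> Hm (cls I J) < Hm (mv s t M)"
      by (metis order_le_imp_less_or_eq)
    have "cls I J = mv s t M \<longrightarrow> shape s t J I I'"
      using *[THEN conjunct2] by metis
    with H' show ?thesis using cc k l ch_length[OF c] by simp
  qed
  show "clean \<epsilon> J (mv s t M) (app (rv s t) f)"
    unfolding clean_def
  proof (intro allI impI)
    fix I assume "app (rv s t) f I \<noteq> 0"
    then obtain I' where "ch s t I I'" "f I' \<noteq> 0" by (rule rv_nonzero[OF st])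
    from *[OF this] show "length I = length J
     \<and> (\<forall>(a, b)\<in>set (zip I J). \<epsilon> * int a \<le> \<epsilon> * int b) \<and> (cls I J = mv s t M \<or> Hm (cls I J) < Hm (mv s t M))
     \<and> (\<forall>k. count (mv s t M) (k, k) \<le> count (cls I J) (k, k))" by blast
  qed
  show "shaped s t J M f" unfolding shaped_def using * by blast
qed

lemma good_step:
  fixes \<epsilon> :: int
  assumes e: "\<epsilon> = 1 \<or> \<epsilon> = -1" and ts: "\<epsilon> * int t < \<epsilon> * int s" and J: "srt \<epsilon> J"
    and f: "good \<epsilon> J s M f" and M: "(s, s) \<in># M"
  shows "good \<epsilon> J s (mv s t M) (app (rv s t) f)" "shaped s t J M f"
proof -
  have st: "s \<noteq> t" using ts by auto
  have *: "(\<forall>(a, b)\<in>set (zip I J). \<epsilon> * int s < \<epsilon> * int b \<longrightarrow> \<epsilon> * int b \<le> \<epsilon> * int a) \<and> length I = length J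
      \<and> (cls I J = mv s t M \<or> Hm (cls I J) > Hm (mv s t M))
      \<and> (cls I J = mv s t M \<longrightarrow> shape s t J I I')"
    if c: "ch s t I I'" and f0: "f I' \<noteq> 0" for I I'
  proof -
    have l: "length I' = length J"
      and tri: "\<forall>(a, b)\<in>set (zip I' J). \<epsilon> * int s < \<epsilon> * int b \<longrightarrow> \<epsilon> * int b \<le> \<epsilon> * int a"
      and H: "cls I' J = M \<or> Hm (cls I' J) > Hm M"
      using f f0 unfolding good_def by auto
    note cc = ch_good[OF c e ts J l tri]
    have "Hm (cls I J) \<ge> Hm (mv s t M)" using cc H unfolding Hm_mv[OF M] by auto
    moreover have *: "cls I J = mv s t M \<and> shape s t J I I'" if "Hm (cls I J) = Hm (mv s t M)"
    proof -
      have "Hm (cls I J) - Hm (cls I' J) = (int t - int s) * int s" "cls I' J = M"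
        using cc H that unfolding Hm_mv[OF M] by auto
      then show ?thesis using cc mv_eqI[OF M] by blast
    qed
    ultimately have H': "cls I J = mv s t M \<or> Hm (cls I J) > Hm (mv s t M)"
      by (metis order_le_imp_less_or_eq)
    have "cls I J = mv s t M \<longrightarrow> shape s t J I I'"
      using *[THEN conjunct2] by metis
    with H' show ?thesis using cc l ch_length[OF c] by simp
  qed
  show "good \<epsilon> J s (mv s t M) (app (rv s t) f)"
    unfolding good_def
  proof (intro allI impI)
    fix I assume "app (rv s t) f I \<noteq> 0"
    then obtain I' where "ch s t I I'" "f I' \<noteq> 0" by (rule rv_nonzero[OF st])
    from *[OF this] show "length I = length J
     \<and> (\<forall>(a, b)\<in>set (zip I J). \<epsilon> * int s < \<epsilon> * int b \<longrightarrow> \<epsilon> * int b \<le> \<epsilon> * int a)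
     \<and> (cls I J = mv s t M \<or> Hm (cls I J) > Hm (mv s t M))" by blast
  qed
  show "shaped s t J M f" unfolding shaped_def using * by blast
qed

text \<open>
  To read off the leading coefficient, the letters \<open>t\<close> of the block of \<open>s\<close> are placed at the
  end of that block; then only direct replacements of one \<open>t\<close> contribute.
\<close>

lemma lead_step:
  assumes st: "s \<noteq> t" and J: "srt \<eta> J" "\<eta> \<noteq> 0" and q: "qsym f J" "qsym (app (rv s t) f) J"
    and M: "(s, s) \<in># M" and f: "lead J M f c" and sh: "shaped s t J M f"
  shows "lead J (mv s t M) (app (rv s t) f) (qint (count (mv s t M) (t, s)) * c)"
  unfolding lead_def
proof (intro allI impI)
  fix I assume l: "length I = length J" and cI: "cls I J = mv s t M"
  define j where "j = count (mv s t M) (t, s)"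
  have j0: "j > 0" by (simp add: j_def mv_def)
  obtain J1 m J3 where J': "J = J1 @ replicate m s @ J3" and sJ: "s \<notin> set J1" "s \<notin> set J3"
    using srt_block[OF J] .
  define Ia where "Ia = take (length J1) I"
  define Im where "Im = take m (drop (length J1) I)"
  define Ib where "Ib = drop m (drop (length J1) I)"
  have I: "I = Ia @ Im @ Ib" unfolding Ia_def Im_def Ib_def by (simp only: append_take_drop_id)
  have la: "length Ia = length J1" and lm: "length Im = m" and lb: "length Ib = length J3"
    using l J' by (auto simp: Ia_def Im_def Ib_def)
  have cr: "cls L (replicate (length L) s) = image_mset (\<lambda>a. (a, s)) (mset L)" for L
    by (induction L) auto
  have cI': "cls I J = cls Ia J1 + (image_mset (\<lambda>a. (a, s)) (mset Im) + cls Ib J3)"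
    unfolding I J' using la lm lb cr[of Im] by (simp add: cls_append)
  have z: "count (cls L K) (a, s) = 0" if "s \<notin> set K" for L K a
    unfolding cls_def using that by (auto simp: count_eq_zero_iff dest: set_zip_rightD)
  have cm: "count (image_mset (\<lambda>a. (a, s)) X) (t, s) = count X t" for X
    by (induction X) auto
  have jm: "count (mset Im) t = j"
    unfolding j_def cI[symmetric] cI' by (simp add: z sJ cm)
  define Io where "Io = filter (\<lambda>a. a \<noteq> t) Im"
  have mIm: "mset Im = mset Io + replicate_mset j t"
    unfolding Io_def jm[symmetric] by (simp add: multiset_eq_iff)
  have jmle: "j \<le> m" and lo: "length Io = m - j"
    using arg_cong[OF mIm, of size] lm by auto
  define I1 where "I1 = Ia @ Io"
  define J1' where "J1' = J1 @ replicate (m - j) s"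
  define I0 where "I0 = I1 @ replicate j t @ Ib"
  have J'': "J = J1' @ replicate j s @ J3"
    unfolding J' J1'_def using jmle by (simp flip: replicate_add)
  have l1: "length I1 = length J1'" using la lo by (simp add: I1_def J1'_def)
  have cr': "cls L (replicate k s) = image_mset (\<lambda>a. (a, s)) (mset L)" if "length L = k" for L k
    using cr[of L] that by simp
  have cI1: "cls I1 J1' = cls Ia J1 + image_mset (\<lambda>a. (a, s)) (mset Io)"
    unfolding I1_def J1'_def using la cr'[OF lo] by (simp add: cls_append)
  have cI0: "cls I0 J = mv s t M"
    unfolding cI[symmetric] cI' mIm unfolding I0_def J'' using l1
    by (simp add: cls_append cI1 cr')
  have l0: "length I0 = length J" unfolding I0_def J'' using l1 lb by simp
  have sup: "\<exists>l<j. I' = I1 @ replicate l t @ s # replicate (j - 1 - l) t @ Ib"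
    if ch: "ch s t (I1 @ replicate j t @ Ib) I'" and f0: "f I' \<noteq> 0" for I'
  proof -
    have pos: "length I1 \<le> p \<and> p < length I1 + j" if "p < length I0" "I0 ! p = t" "J ! p = s" for p
    proof (rule ccontr)
      assume "\<not> ?thesis"
      then consider "p < length Ia" | "length Ia \<le> p" "p < length I1" | "length I1 + j \<le> p" by linarith
      then show False
      proof cases
        case 1
        then show False using that(3) sJ(1) la unfolding J' by (auto simp: nth_append in_set_conv_nth)
      next
        case 2
        then have "I0 ! p = Io ! (p - length Ia)" "p - length Ia < length Io"
          by (auto simp: I0_def I1_def nth_append)
        then have "t \<in> set Io" using that(2) by (metis nth_mem)
        then show False by (simp add: Io_def)
      next
        case 3
        then have "J ! p = J3 ! (p - length I1 - j)" "p - length I1 - j < length J3"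
          using l1 that(1) l0 unfolding J'' by (auto simp: nth_append)
        then show False using that(3) sJ(2) by (metis nth_mem)
      qed
    qed
    have grp: "I0 ! q = t" if "length I1 \<le> q" "q < length I1 + j" for q
    proof -
      have "q - length I1 < j" using that by linarith
      then show ?thesis using that by (simp add: I0_def nth_append)
    qed
    have "shape s t J I0 I'"
      using sh l0 cI0 ch f0 unfolding shaped_def I0_def by blast
    then consider p where "p < length I0" "I0 ! p = t" "J ! p = s" "I' = I0[p := s]"
      | p q where "p < q" "q < length I0" "I0 ! p = t" "J ! p = s" "btw t (I0 ! q) s" "J ! q = s"
      unfolding shape_def by blast
    then show ?thesis
    proof cases
      case 1
      define l where "l = p - length I1"
      have p: "p = length I1 + l" "l < j" using pos[OF 1(1-3)] by (auto simp: l_def)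
      have "replicate j t = replicate l t @ t # replicate (j - 1 - l) t"
      proof -
        have "j = l + Suc (j - 1 - l)" using p(2) by simp
        then have "replicate j t = replicate (l + Suc (j - 1 - l)) t" by simp
        then show ?thesis by (simp only: replicate_add replicate_Suc)
      qed
      then have "I' = I1 @ replicate l t @ s # replicate (j - 1 - l) t @ Ib"
        unfolding 1(4) I0_def p(1) by (simp add: list_update_append)
      then show ?thesis using p(2) by blast
    next
      \<comment> \<open>A chain needs a later position in the block of s with a letter strictly
        between s and t, but from p to the end of the block all letters are t.\<close>
      case 2
      have "length I1 \<le> q" using pos[of p] 2 by auto
      moreover have "q < length I1 + j"
      proof (rule ccontr)
        assume "\<not> ?thesis"
        then have "J ! q = J3 ! (q - length I1 - j)" "q - length I1 - j < length J3"
          using l1 2(2) l0 unfolding J'' by (auto simp: nth_append)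
        then show False using 2(6) sJ(2) by (metis nth_mem)
      qed
      ultimately have "I0 ! q = t" by (rule grp)
      then show ?thesis using 2(5) by (auto simp: btw_def)
    qed
  qed
  obtain u where u: "is_unit_laurent u"
    "app (rv s t) f (I1 @ replicate j t @ Ib) = u * qint j * f (I1 @ s # replicate (j - 1) t @ Ib)"
    using rv_leading[OF st q(1)[unfolded J''] l1 sup j0] .
  define W where "W = I1 @ s # replicate (j - 1) t @ Ib"
  have rj: "replicate j x = x # replicate (j - 1) x" for x :: nat using j0 by (cases j) auto
  have lW: "length W = length J" unfolding W_def J'' using l1 lb j0 by simp
  have "add_mset (t, s) (cls W J) = add_mset (s, s) (cls I0 J)"
    unfolding W_def I0_def J'' rj using l1 by (simp add: cls_append)
  then have "cls W J = M"
    unfolding cI0 mv_def using M by simp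
  then obtain w where w: "is_unit_laurent w" "f W = w * c"
    using f lW unfolding lead_def by blast
  obtain x where x: "is_unit_laurent x" "app (rv s t) f I = x * app (rv s t) f I0"
    using qsym_class[OF q(2) J l0 l] cI cI0 by metis
  have "app (rv s t) f I = (x * u * w) * (qint j * c)"
    unfolding x(2) unfolding I0_def u(2) W_def[symmetric] w(2) by simp
  then show "\<exists>u. is_unit_laurent u \<and> app (rv s t) f I = u * (qint (count (mv s t M) (t, s)) * c)"
    unfolding j_def[symmetric] using x(1) u(1) w(1) by (intro exI[of _ "x * u * w"]) simp
qed

lemma count_mv_iter:
  assumes "s \<noteq> t" "m \<le> count M (s, s)"
  shows "count ((mv s t ^^ m) M) p = (if p = (s, s) then count M p - m else if p = (t, s) then count M p + m else count M p)"
  using assms(2)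
proof (induction m)
  case (Suc m)
  then show ?case using assms(1) by (auto simp: mv_def)
qed simp

text \<open>The cell of the root starts empty, so the r-th application contributes [r], and the
  product of these is the denominator of the divided power. The predicate Q stands for either of the
  two notions of leading term.\<close>

lemma lead_divpow:
  assumes Q: "\<And>M f. Q M f \<Longrightarrow> (s, s) \<in># M \<Longrightarrow> Q (mv s t M) (app (rv s t) f) \<and> shaped s t J M f"
    and scale: "\<And>M f c. Q M f \<Longrightarrow> Q M (\<lambda>I. c * f I)"
    and st: "s \<noteq> t" and J: "srt \<eta> J" "\<eta> \<noteq> 0"
    and f: "Q M (app (op x) (delta J))" "lead J M (app (op x) (delta J)) c"
    and M: "m \<le> count M (s, s)" "count M (t, s) = 0"
  shows "Q ((mv s t ^^ m) M) (app (dp (rv s t) m) (app (op x) (delta J)))"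
    and "lead J ((mv s t ^^ m) M) (app (dp (rv s t) m) (app (op x) (delta J))) c"
proof -
  have "Q ((mv s t ^^ r) M) (app (rv s t ^ r) (app (op x) (delta J)))
      \<and> lead J ((mv s t ^^ r) M) (app (rv s t ^ r) (app (op x) (delta J))) (qfact r * c)" if "r \<le> m" for r
    using that
  proof (induction r)
    case 0
    then show ?case using f by simp
  next
    case (Suc r)
    let ?M = "(mv s t ^^ r) M"
    let ?f = "app (rv s t ^ r) (app (op x) (delta J))"
    have IH: "Q ?M ?f" "lead J ?M ?f (qfact r * c)" using Suc by auto
    have "count ?M (s, s) = count M (s, s) - r"
      using count_mv_iter[OF st, of r M] Suc.prems M(1) by simp
    then have mem: "(s, s) \<in># ?M" using Suc.prems M(1) by (simp flip: count_greater_zero_iff)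
    have q1: "?f = app (op (root_vec (t, s) ^ r * x)) (delta J)"
      and q2: "app (rv s t) ?f = app (op (root_vec (t, s) ^ Suc r * x)) (delta J)"
      by (simp_all add: rv_def)
    have cnt: "count (mv s t ?M) (t, s) = Suc r"
      using count_mv_iter[OF st, of "Suc r" M] Suc.prems M by (simp add: st[symmetric])
    have "Q (mv s t ?M) (app (rv s t) ?f)" "shaped s t J ?M ?f" using Q[OF IH(1) mem] by auto
    moreover have "lead J (mv s t ?M) (app (rv s t) ?f) (qint (Suc r) * (qfact r * c))"
      using lead_step[OF st J _ _ mem IH(2)] calculation(2) q1 q2 cnt qsym_op by metis
    ultimately show ?case by (simp add: qfact_Suc mult.assoc)
  qed
  from this[of m] have 1: "Q ((mv s t ^^ m) M) (app (rv s t ^ m) (app (op x) (delta J)))"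
    and 2: "lead J ((mv s t ^^ m) M) (app (rv s t ^ m) (app (op x) (delta J))) (qfact m * c)" by auto
  have d: "app (dp (rv s t) m) g = (\<lambda>I. inverse (qfact m) * app (rv s t ^ m) g I)" for g
    by (rule ext) (rule app_dp)
  show "Q ((mv s t ^^ m) M) (app (dp (rv s t) m) (app (op x) (delta J)))"
    unfolding d using 1 by (rule scale)
  show "lead J ((mv s t ^^ m) M) (app (dp (rv s t) m) (app (op x) (delta J))) c"
    unfolding d lead_def
  proof (intro allI impI)
    fix I assume "length I = length J" "cls I J = (mv s t ^^ m) M"
    then obtain u where "is_unit_laurent u" "app (rv s t ^ m) (app (op x) (delta J)) I = u * (qfact m * c)"
      using 2 unfolding lead_def by blast
    then show "\<exists>u. is_unit_laurent u \<and> inverse (qfact m) * app (rv s t ^ m) (app (op x) (delta J)) I = u * c"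
      by (intro exI[of _ u]) simp
  qed
qed

section \<open>Monomials and their leading classes\<close>

definition fpm :: "(nat \<times> nat) list \<Rightarrow> (nat \<times> nat \<Rightarrow> nat) \<Rightarrow> free_alg" where
  "fpm L B = fp_eval (map (\<lambda>a. (a, B a)) L)"

lemma fpm_simps [simp]: "fpm [] B = 1" "fpm (a # L) B = divpow (root_vec a) (B a) * fpm L B"
  by (simp_all add: fpm_def fp_eval_def)

definition mvs :: "(nat \<times> nat) list \<Rightarrow> (nat \<times> nat \<Rightarrow> nat) \<Rightarrow> (nat \<times> nat) multiset \<Rightarrow> (nat \<times> nat) multiset" where
  "mvs L B M = foldr (\<lambda>a M. (mv (snd a) (fst a) ^^ B a) M) L M"

lemma mvs_simps [simp]: "mvs [] B M = M" "mvs (a # L) B M = (mv (snd a) (fst a) ^^ B a) (mvs L B M)"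
  by (simp_all add: mvs_def)

definition src :: "(nat \<times> nat) list \<Rightarrow> (nat \<times> nat \<Rightarrow> nat) \<Rightarrow> nat \<Rightarrow> nat" where
  "src L B k = (\<Sum>a\<leftarrow>L. if snd a = k then B a else 0)"

lemma src_simps [simp]: "src [] B k = 0" "src (a # L) B k = (if snd a = k then B a else 0) + src L B k"
  by (simp_all add: src_def)

lemma count_mvs:
  assumes "distinct L" "\<forall>a\<in>set L. fst a \<noteq> snd a" "\<forall>k. src L B k \<le> count M (k, k)"
  shows "count (mvs L B M) (i, j) = (if i = j then count M (i, i) - src L B i
    else if (i, j) \<in> set L then count M (i, j) + B (i, j) else count M (i, j))"
  using assms
proof (induction L arbitrary: i j)
  case (Cons a L)
  obtain t s where a: "a = (t, s)" by (cases a)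
  have st: "s \<noteq> t" using Cons.prems(2) a by auto
  have "\<forall>k. src L B k \<le> count M (k, k)"
  proof
    fix k show "src L B k \<le> count M (k, k)" using Cons.prems(3)[rule_format, of k] by simp
  qed
  then have IH: "count (mvs L B M) (i, j) = (if i = j then count M (i, i) - src L B i
    else if (i, j) \<in> set L then count M (i, j) + B (i, j) else count M (i, j))" for i j
    using Cons by auto
  have "B a + src L B s \<le> count M (s, s)" using Cons.prems(3)[rule_format, of s] a by simp
  then have "B a \<le> count (mvs L B M) (s, s)" unfolding IH by simp
  from count_mv_iter[OF st this] show ?case
    using Cons.prems(1) st by (auto simp: a IH)
qed simp

text \<open>Since \<open>clean_step\<close> returns the same kind of hypothesis that it consumes,
  the order of the root vectors is free.\<close>

lemma clean_prod:
  fixes \<epsilon> :: int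
  assumes e: "\<epsilon> = 1 \<or> \<epsilon> = -1" and J: "srt (- \<epsilon>) J"
    and L: "distinct L" "\<forall>(t, s)\<in>set L. \<epsilon> * int t < \<epsilon> * int s"
    and f: "clean \<epsilon> J M (app (op x) (delta J))" "lead J M (app (op x) (delta J)) c"
    and M: "\<forall>a\<in>set L. count M a = 0" "\<forall>k. src L B k \<le> count M (k, k)"
  shows "clean \<epsilon> J (mvs L B M) (app (op (fpm L B * x)) (delta J))
    \<and> lead J (mvs L B M) (app (op (fpm L B * x)) (delta J)) c"
  using L M
proof (induction L)
  case Nil
  then show ?case using f by simp
next
  case (Cons a L)
  obtain t s where a: "a = (t, s)" by (cases a)
  have ts: "\<epsilon> * int t < \<epsilon> * int s" using Cons.prems(2) a by simp
  then have st: "s \<noteq> t" by auto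
  have s: "\<forall>k. src L B k \<le> count M (k, k)"
  proof
    fix k show "src L B k \<le> count M (k, k)" using Cons.prems(4)[rule_format, of k] by simp
  qed
  then have IH: "clean \<epsilon> J (mvs L B M) (app (op (fpm L B * x)) (delta J))"
    "lead J (mvs L B M) (app (op (fpm L B * x)) (delta J)) c"
    using Cons by auto
  have ne: "\<forall>a\<in>set L. fst a \<noteq> snd a" using Cons.prems(2) by fastforce
  have dL: "distinct L" using Cons.prems(1) by simp
  have "B a + src L B s \<le> count M (s, s)" using Cons.prems(4)[rule_format, of s] a by simp
  then have m: "B a \<le> count (mvs L B M) (s, s)" unfolding count_mvs[OF dL ne s] by simp
  have z: "count (mvs L B M) (t, s) = 0"
    unfolding count_mvs[OF dL ne s] using Cons.prems(1,3) st a by auto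
  have sc: "clean \<epsilon> J N (\<lambda>I. d * g I)" if "clean \<epsilon> J N g" for N g d
    using that unfolding clean_def by auto
  have step: "clean \<epsilon> J (mv s t N) (app (rv s t) g) \<and> shaped s t J N g" if "clean \<epsilon> J N g" "(s, s) \<in># N" for N g
    using clean_step[OF e ts J that] by blast
  have e0: "- \<epsilon> \<noteq> 0" using e by auto
  have dpe: "app (op (fpm (a # L) B * x)) (delta J) = app (dp (rv s t) (B a)) (app (op (fpm L B * x)) (delta J))"
    by (simp add: a rv_def mult.assoc)
  show ?case unfolding dpe mvs_simps(2)
    using lead_divpow[where Q = "clean \<epsilon> J", OF step sc st J e0 IH m z] by (simp add: a)
qed

text \<open>The rightmost root vector acts first, so the list is sorted with sources decreasing in
  the \<epsilon>-order: when a source s is treated, the columns beyond s are still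
  untouched.\<close>

lemma good_prod:
  fixes \<epsilon> :: int
  assumes e: "\<epsilon> = 1 \<or> \<epsilon> = -1" and J: "srt \<epsilon> J"
    and L: "distinct L" "\<forall>(t, s)\<in>set L. \<epsilon> * int t < \<epsilon> * int s"
      "sorted_wrt (\<lambda>a b. \<epsilon> * int (snd a) \<ge> \<epsilon> * int (snd b)) L"
    and f: "\<And>c. good \<epsilon> J c M (app (op x) (delta J))" "lead J M (app (op x) (delta J)) c"
    and M: "\<forall>a\<in>set L. count M a = 0" "\<forall>k. src L B k \<le> count M (k, k)"
    and k: "\<forall>a\<in>set L. \<epsilon> * int (snd a) \<le> \<epsilon> * int k"
  shows "good \<epsilon> J k (mvs L B M) (app (op (fpm L B * x)) (delta J))
    \<and> lead J (mvs L B M) (app (op (fpm L B * x)) (delta J)) c"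
  using L M k
proof (induction L arbitrary: k)
  case Nil
  then show ?case using f by simp
next
  case (Cons a L)
  obtain t s where a: "a = (t, s)" by (cases a)
  have ts: "\<epsilon> * int t < \<epsilon> * int s" using Cons.prems(2) a by simp
  then have st: "s \<noteq> t" by auto
  have s: "\<forall>k. src L B k \<le> count M (k, k)"
  proof
    fix k show "src L B k \<le> count M (k, k)" using Cons.prems(5)[rule_format, of k] by simp
  qed
  then have IH: "good \<epsilon> J s (mvs L B M) (app (op (fpm L B * x)) (delta J))"
    "lead J (mvs L B M) (app (op (fpm L B * x)) (delta J)) c"
    using Cons.IH[of s] Cons.prems a by auto
  have ne: "\<forall>a\<in>set L. fst a \<noteq> snd a" using Cons.prems(2) by fastforce
  have dL: "distinct L" using Cons.prems(1) by simp
  have "B a + src L B s \<le> count M (s, s)" using Cons.prems(5)[rule_format, of s] a by simp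
  then have m: "B a \<le> count (mvs L B M) (s, s)" unfolding count_mvs[OF dL ne s] by simp
  have z: "count (mvs L B M) (t, s) = 0"
    unfolding count_mvs[OF dL ne s] using Cons.prems(1,4) st a by auto
  have sc: "good \<epsilon> J s N (\<lambda>I. d * g I)" if "good \<epsilon> J s N g" for N g d
    using that unfolding good_def by auto
  have step: "good \<epsilon> J s (mv s t N) (app (rv s t) g) \<and> shaped s t J N g" if "good \<epsilon> J s N g" "(s, s) \<in># N" for N g
    using good_step[OF e ts J that] by blast
  have e0: "\<epsilon> \<noteq> 0" using e by auto
  have dpe: "app (op (fpm (a # L) B * x)) (delta J) = app (dp (rv s t) (B a)) (app (op (fpm L B * x)) (delta J))"
    by (simp add: a rv_def mult.assoc)
  have sk: "\<epsilon> * int s \<le> \<epsilon> * int k" using Cons.prems(6) a by simp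
  \<comment> \<open>A larger threshold restricts fewer columns.\<close>
  have mono: "good \<epsilon> J k N g" if "good \<epsilon> J s N g" for N g
    using that sk unfolding good_def by fastforce
  show ?case unfolding dpe mvs_simps(2)
    using lead_divpow[where Q = "good \<epsilon> J s", OF step sc st J e0 IH m z] by (simp add: a mono)
qed

section \<open>Elimination\<close>

definition ent :: "free_alg \<Rightarrow> nat list \<Rightarrow> nat list \<Rightarrow> Qv" where
  "ent x I J = app (op x) (delta J) I"

lemma ent_simps [simp]: "ent (x + y) I J = ent x I J + ent y I J" "ent (x - y) I J = ent x I J - ent y I J"
  "ent 0 I J = 0" "ent (cst c * x) I J = c * ent x I J"
  by (simp_all add: ent_def)

text \<open>Equality of the images in the q-Schur algebra, expressed for representatives in the free
  algebra.\<close>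

definition agree :: "nat \<Rightarrow> nat \<Rightarrow> free_alg \<Rightarrow> free_alg \<Rightarrow> bool" where
  "agree n d x y \<longleftrightarrow> (\<forall>I\<in>words n d. \<forall>J\<in>words n d. ent x I J = ent y I J)"

lemma app_nonzero: "app a f I \<noteq> 0 \<Longrightarrow> \<exists>I'. f I' \<noteq> 0"
proof (rule ccontr)
  assume "app a f I \<noteq> 0" "\<not> (\<exists>I'. f I' \<noteq> 0)"
  moreover from this have "f = (\<lambda>I. 0)" by auto
  ultimately show False by (simp add: app_zero)
qed

text \<open>The companion of \<open>local_op\<close>: there, what is read stays among the words of
  the tensor power; here, the support of a column does. It is needed because leading terms were
  studied on all words.\<close>

lemma keeps_words:
  assumes "x \<in> C n" "J \<in> words n d" "app (op x) (delta J) I \<noteq> 0"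
  shows "I \<in> words n d"
proof -
  define K where "K = (\<lambda>a. \<forall>f. (\<forall>I. f I \<noteq> 0 \<longrightarrow> I \<in> words n d) \<longrightarrow> (\<forall>I. app a f I \<noteq> 0 \<longrightarrow> I \<in> words n d))"
  have g: "I \<in> words n d" if "g \<in> gens n" "\<And>I. f I \<noteq> 0 \<Longrightarrow> I \<in> words n d" "app (gop g) f I \<noteq> 0" for g f I d
    using that(2,3)
  proof (induction I arbitrary: f d)
    case Nil
    then show ?case by (cases g) (auto simp: app_kk)
  next
    case (Cons x I)
    show ?case
    proof (cases g)
      case (GE i)
      then consider "app (ee i) (\<lambda>I. f (x # I)) I \<noteq> 0" | "x = i" "f (Suc i # I) \<noteq> 0"
        using Cons.prems(2) by (cases "app (ee i) (\<lambda>I. f (x # I)) I = 0") (auto split: if_splits)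
      then show ?thesis
      proof cases
        case 1
        then obtain I' where "f (x # I') \<noteq> 0"
          using app_nonzero by blast
        then have x: "x # I' \<in> words n d" by (rule Cons.prems)
        then obtain d' where d: "d = Suc d'" by (auto simp: words_def)
        have "I \<in> words n d'"
          by (rule Cons.IH[of "\<lambda>I. f (x # I)"]) (use Cons.prems(1)[of "x # _"] 1 GE d in auto)
        then show ?thesis using x d by simp
      next
        case 2
        then have "Suc i # I \<in> words n d" using Cons.prems by simp
        then show ?thesis using 2 by (auto simp: words_def)
      qed
    next
      case (GF i)
      then consider "app (ff i) (\<lambda>I. f (x # I)) I \<noteq> 0" | "x = Suc i" "f (i # I) \<noteq> 0"
        using Cons.prems(2) by (cases "app (ff i) (\<lambda>I. f (x # I)) I = 0") (auto split: if_splits)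
      then show ?thesis
      proof cases
        case 1
        then obtain I' where "f (x # I') \<noteq> 0"
          using app_nonzero by blast
        then have x: "x # I' \<in> words n d" by (rule Cons.prems)
        then obtain d' where d: "d = Suc d'" by (auto simp: words_def)
        have "I \<in> words n d'"
          by (rule Cons.IH[of "\<lambda>I. f (x # I)"]) (use Cons.prems(1)[of "x # _"] 1 GF d in auto)
        then show ?thesis using x d by simp
      next
        case 2
        then have "i # I \<in> words n d" using Cons.prems by simp
        then show ?thesis using 2 that(1) GF by (auto simp: words_def)
      qed
    qed (use Cons.prems in \<open>auto simp: app_kk\<close>)
  qed
  have K1: "K 1" by (simp add: K_def)
  have Km: "K (a * b)" if "K a" "K b" for a b
    unfolding K_def app_times
  proof (intro allI impI)
    fix f I assume f: "\<forall>I. f I \<noteq> 0 \<longrightarrow> I \<in> words n d" and nz: "app a (app b f) I \<noteq> 0"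
    have "\<forall>I. app b f I \<noteq> 0 \<longrightarrow> I \<in> words n d"
      using that(2)[unfolded K_def, THEN spec, THEN mp, OF f] .
    from that(1)[unfolded K_def, THEN spec, THEN mp, OF this] nz show "I \<in> words n d" by blast
  qed
  have Ks: "K (scal c)" for c unfolding K_def by simp
  have Ksum: "K (\<Sum>w\<in>W. a w)" if "\<And>w. w \<in> W \<Longrightarrow> K (a w)" for W :: "gword set" and a
    using that unfolding K_def app_sum by (metis (no_types, lifting) sum.neutral)
  have "K (prod_list (map gop l))" if "set l \<subseteq> gens n" for l
    using that
  proof (induction l)
    case (Cons h l)
    have "K (gop h)" unfolding K_def using g Cons.prems by auto
    then show ?case using Cons Km by simp
  qed (simp add: K1)
  then have "K (wop w)" if "w \<in> Poly_Mapping.keys x" for w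
    using that assms(1) by (simp add: wop_def C_iff)
  then have "K (op x)" unfolding op_def by (intro Ksum Km Ks) auto
  moreover have "delta J I \<noteq> 0 \<longrightarrow> I \<in> words n d" for I using assms(2) by (simp add: delta_def)
  ultimately show ?thesis using assms(3) unfolding K_def by blast
qed

lemma ent_mult:
  assumes "x \<in> C n" "I \<in> words n d"
  shows "ent (x * z) I J = (\<Sum>K\<in>words n d. ent x I K * ent z K J)"
  using app_expand[OF local_op_op[OF assms(1)] assms(2), of "app (op z) (delta J)"] by (simp add: ent_def)

lemma agree_mult_right:
  assumes "agree n d x y" "x \<in> C n" "y \<in> C n"
  shows "agree n d (x * z) (y * z)"
  using assms by (simp add: agree_def ent_mult)

lemma agree_refl [simp]: "agree n d x x"
  and agree_trans [trans]: "agree n d x y \<Longrightarrow> agree n d y z \<Longrightarrow> agree n d x z"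
  and agree_add: "agree n d x y \<Longrightarrow> agree n d x' y' \<Longrightarrow> agree n d (x + x') (y + y')"
  and agree_cst: "agree n d x y \<Longrightarrow> agree n d (cst c * x) (cst c * y)"
  by (simp_all add: agree_def)

definition wsort :: "int \<Rightarrow> nat multiset \<Rightarrow> nat list" where
  "wsort \<eta> X = (if \<eta> = 1 then sorted_list_of_multiset X else rev (sorted_list_of_multiset X))"

lemma mset_wsort [simp]: "mset (wsort \<eta> X) = X"
  by (simp add: wsort_def)

lemma srt_wsort: "\<eta> = 1 \<or> \<eta> = -1 \<Longrightarrow> srt \<eta> (wsort \<eta> X)"
  using sorted_sorted_list_of_multiset[of X] by (auto simp: srt_def wsort_def sorted_wrt_rev)

lemma srt_unique:
  assumes "\<eta> \<noteq> 0" "srt \<eta> J" "srt \<eta> J'" "mset J = mset J'"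
  shows "J = J'"
  using assms(2-4)
proof (induction J arbitrary: J')
  case (Cons b J)
  then obtain c K where J': "J' = c # K" by (cases J') auto
  have "b \<in> set J'" "c \<in> set (b # J)"
    using Cons.prems(3) J' by (metis list.set_intros(1) set_mset_mset)+
  then have "\<eta> * int c \<le> \<eta> * int b" "\<eta> * int b \<le> \<eta> * int c" using Cons.prems J' by auto
  then have "\<eta> * int b = \<eta> * int c" by (intro order_antisym)
  then have "b = c" using assms(1) by simp
  then show ?case using Cons J' by auto
qed simp

lemma words_mset: "mset I = mset J \<Longrightarrow> I \<in> words n d \<longleftrightarrow> J \<in> words n d"
  unfolding words_def by (metis (mono_tags, lifting) mem_Collect_eq mset_eq_length mset_eq_setD)

text \<open>Every column word is a rearrangement of a sorted one, and vanishing of columns passes to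
  rearrangements.\<close>

lemma agree_0I:
  assumes "\<eta> = 1 \<or> \<eta> = -1" "\<And>I J. I \<in> words n d \<Longrightarrow> J \<in> words n d \<Longrightarrow> srt \<eta> J \<Longrightarrow> ent x I J = 0"
  shows "agree n d x 0"
  unfolding agree_def
proof (intro ballI)
  fix I J assume IJ: "I \<in> words n d" "J \<in> words n d"
  have "app (op x) (delta J) I = 0"
  proof (rule determined_by_rearrangement[where J = "wsort \<eta> (mset J)" and n = n and d = d])
    fix I assume "I \<in> words n d"
    moreover have "wsort \<eta> (mset J) \<in> words n d" using IJ words_mset[of "wsort \<eta> (mset J)" J] by simp
    ultimately show "app (op x) (delta (wsort \<eta> (mset J))) I = 0"
      using assms srt_wsort by (simp add: ent_def)
  qed (use IJ in auto)
  then show "ent x I J = ent 0 I J" by (simp add: ent_def)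
qed

text \<open>Laurent combinations are formed from representatives; whether two of them have the same
  image is recorded separately by \<open>agree\<close>.\<close>

inductive_set LS :: "free_alg set \<Rightarrow> free_alg set" for Y where
  LS_0: "0 \<in> LS Y"
| LS_add: "x \<in> LS Y \<Longrightarrow> a \<in> laurent \<Longrightarrow> y \<in> Y \<Longrightarrow> x + cst a * y \<in> LS Y"

lemma LS_base: "y \<in> Y \<Longrightarrow> y \<in> LS Y"
  using LS_add[OF LS_0, of 1 y] by (simp add: cst_def single_one)

lemma LS_plus: "x \<in> LS Y \<Longrightarrow> z \<in> LS Y \<Longrightarrow> x + z \<in> LS Y"
  by (rotate_tac, induction rule: LS.induct) (auto simp flip: add.assoc intro: LS_add)

lemma cst_mult: "cst a * cst b = cst (a * b)"
  by (simp add: cst_def mult_single)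

lemma LS_cst: "x \<in> LS Y \<Longrightarrow> c \<in> laurent \<Longrightarrow> cst c * x \<in> LS Y"
proof (induction rule: LS.induct)
  case (LS_add x a y)
  then show ?case by (simp add: distrib_left cst_mult LS.LS_add flip: mult.assoc)
qed (simp add: LS_0)

lemma LS_uminus: "x \<in> LS Y \<Longrightarrow> - x \<in> LS Y"
proof -
  have "cst (- 1) * x = - x" by (simp add: cst_def single_uminus)
  then show "x \<in> LS Y \<Longrightarrow> ?thesis" using LS_cst[of x Y "- 1"] by simp
qed

lemma LS_mono: "x \<in> LS Y \<Longrightarrow> Y \<subseteq> Z \<Longrightarrow> x \<in> LS Z"
  by (induction rule: LS.induct) (auto intro: LS_0 LS_add)

lemma LS_GA: "x \<in> LS Y \<Longrightarrow> Y \<subseteq> GA n \<Longrightarrow> x \<in> GA n"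
proof (induction rule: LS.induct)
  case LS_0
  have "cst 0 \<in> GA n" by (rule GA_cst) simp
  then show ?case by (simp add: cst_def)
qed (auto intro: GA_add GA_mult GA_cst)

lemma LS_agree: "x \<in> LS Y \<Longrightarrow> (\<And>y. y \<in> Y \<Longrightarrow> \<exists>z\<in>LS Z. agree n d y z) \<Longrightarrow> \<exists>z\<in>LS Z. agree n d x z"
proof (induction rule: LS.induct)
  case (LS_add x a y)
  then obtain z z' where "z \<in> LS Z" "agree n d x z" "z' \<in> LS Z" "agree n d y z'" by blast
  then show ?case using LS_add.hyps(2)
    by (intro bexI[of _ "z + cst a * z'"]) (auto intro: agree_add agree_cst LS_plus LS_cst)
next
  case LS_0
  show ?case by (rule bexI[OF agree_refl LS.LS_0])
qed

lemma ent_GA: "x \<in> GA n \<Longrightarrow> ent x I J \<in> laurent"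
  using GA_lpres[of x n] unfolding lpres_def ent_def by (auto simp: delta_def)

lemma unit_divide: "c \<in> laurent \<Longrightarrow> is_unit_laurent u \<Longrightarrow> c / u \<in> laurent"
  using unit_laurent[OF unit_inverse] by (simp add: divide_inverse)

text \<open>Triangular elimination with unit leading entries, needed three times: to reorder outer
  monomials, to isolate one class with inner monomials, and for the final spanning argument. By
  \<open>tri\<close>, D contains all classes that occur in its members.\<close>

locale elimination =
  fixes n d :: nat and \<eta> :: int and D :: "(nat \<times> nat) multiset set"
    and y :: "(nat \<times> nat) multiset \<Rightarrow> free_alg" and gr :: "(nat \<times> nat) multiset \<Rightarrow> int"
  assumes sign: "\<eta> = 1 \<or> \<eta> = -1"
    and fin: "finite D"
    and rep: "\<And>P. P \<in> D \<Longrightarrow> \<exists>I\<in>words n d. \<exists>J\<in>words n d. srt \<eta> J \<and> cls I J = P"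
    and GA: "\<And>P. P \<in> D \<Longrightarrow> y P \<in> GA n"
    and tri: "\<And>P I J. P \<in> D \<Longrightarrow> I \<in> words n d \<Longrightarrow> J \<in> words n d \<Longrightarrow> srt \<eta> J \<Longrightarrow> ent (y P) I J \<noteq> 0
      \<Longrightarrow> cls I J = P \<or> cls I J \<in> D \<and> gr (cls I J) < gr P"
    and unit: "\<And>P I J. P \<in> D \<Longrightarrow> I \<in> words n d \<Longrightarrow> J \<in> words n d \<Longrightarrow> srt \<eta> J \<Longrightarrow> cls I J = P
      \<Longrightarrow> is_unit_laurent (ent (y P) I J)"
begin

lemma cls_snd: "length I = length J \<Longrightarrow> image_mset snd (cls I J) = mset J"
  by (simp add: cls_def flip: mset_map)

text \<open>A class of maximal grade in S is cleared first. The multiple of \<open>y P\<close> that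
  is subtracted disturbs only classes of smaller grade in D, and these belong to S because S is
  closed downwards.\<close>

lemma eliminate:
  assumes "S \<subseteq> D" "\<And>P P'. P \<in> S \<Longrightarrow> P' \<in> D \<Longrightarrow> gr P' < gr P \<Longrightarrow> P' \<in> S"
    and "x \<in> C n" "\<And>I J. I \<in> words n d \<Longrightarrow> J \<in> words n d \<Longrightarrow> ent x I J \<in> laurent"
  shows "\<exists>z\<in>LS (y ` S). \<forall>I\<in>words n d. \<forall>J\<in>words n d. srt \<eta> J \<longrightarrow>
    ent (x - z) I J = (if cls I J \<in> S then 0 else ent x I J)"
  using assms
proof (induction "card S" arbitrary: S x)
  case 0
  then have "S = {}" using finite_subset[OF _ fin] by simp
  then show ?case by (intro bexI[OF _ LS_0]) simp
next
  case (Suc m)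
  have finS: "finite S" using Suc.prems(1) fin by (rule finite_subset)
  have "S \<noteq> {}" using Suc.hyps(2) by auto
  then obtain P where P: "P \<in> S" "\<And>Q. Q \<in> S \<Longrightarrow> gr Q \<le> gr P"
  proof -
    assume S: "S \<noteq> {}"
    then have "Max (gr ` S) \<in> gr ` S" using finS by (intro Max_in) auto
    then obtain P where "P \<in> S" "gr P = Max (gr ` S)" by (auto simp del: Max_in)
    then show thesis using that[of P] finS by simp
  qed
  have PD: "P \<in> D" using P Suc.prems by blast
  obtain I0 J0 where r: "I0 \<in> words n d" "J0 \<in> words n d" "srt \<eta> J0" "cls I0 J0 = P"
    using rep[OF PD] by blast
  \<comment> \<open>The quotient is integral because the leading entry is a unit.\<close>
  define c where "c = ent x I0 J0 / ent (y P) I0 J0"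
  have uc: "is_unit_laurent (ent (y P) I0 J0)" using unit[OF PD r] .
  have cl: "c \<in> laurent" unfolding c_def using unit_divide[OF _ uc] Suc.prems(4) r by blast
  define x1 where "x1 = x - cst c * y P"
  have yC: "y P \<in> C n" using GA[OF PD] GA_C by blast
  have x1C: "x1 \<in> C n" using yC Suc.prems(3) by (simp add: x1_def)
  have x1L: "ent x1 I J \<in> laurent" if "I \<in> words n d" "J \<in> words n d" for I J
    using Suc.prems(4)[OF that] ent_GA[OF GA[OF PD]] cl by (simp add: x1_def)
  \<comment> \<open>One vanishing entry suffices: the entries in a class differ by units, and a
    class determines its sorted column word.\<close>
  have x1P: "ent x1 I J = 0" if "I \<in> words n d" "J \<in> words n d" "srt \<eta> J" "cls I J = P" for I J
  proof -
    have l: "length I = length J" "length I0 = length J0" using that r by (auto simp: words_def)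
    have "mset J = mset J0" using cls_snd[OF l(1)] cls_snd[OF l(2)] that r by simp
    then have JJ: "J = J0" using srt_unique[of \<eta> J J0] sign that r by auto
    have "\<exists>u. is_unit_laurent u \<and> app (op x1) (delta J0) I = u * app (op x1) (delta J0) I0"
      by (rule qsym_class[OF qsym_op r(3)]) (use sign l that r JJ in auto)
    moreover have "ent x1 I0 J0 = 0"
      using unit_nonzero[OF uc] by (simp add: x1_def c_def)
    ultimately show ?thesis by (auto simp: ent_def JJ)
  qed
  define S' where "S' = S - {P}"
  have "\<exists>z\<in>LS (y ` S'). \<forall>I\<in>words n d. \<forall>J\<in>words n d. srt \<eta> J \<longrightarrow>
    ent (x1 - z) I J = (if cls I J \<in> S' then 0 else ent x1 I J)"
  proof (rule Suc.hyps(1))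
    show "m = card S'" using Suc.hyps(2) P(1) finS by (simp add: S'_def)
    show "S' \<subseteq> D" using Suc.prems(1) by (auto simp: S'_def)
    fix Q Q' assume "Q \<in> S'" "Q' \<in> D" "gr Q' < gr Q"
    then show "Q' \<in> S'" using Suc.prems(2)[of Q Q'] P(2)[of Q] by (auto simp: S'_def)
  qed (use x1C x1L in auto)
  then obtain z where z: "z \<in> LS (y ` S')" "\<And>I J. I \<in> words n d \<Longrightarrow> J \<in> words n d \<Longrightarrow> srt \<eta> J
    \<Longrightarrow> ent (x1 - z) I J = (if cls I J \<in> S' then 0 else ent x1 I J)" by blast
  have z': "z + cst c * y P \<in> LS (y ` S)"
    by (rule LS_add[OF LS_mono[OF z(1)] cl]) (use P in \<open>auto simp: S'_def\<close>)
  have out: "ent (y P) I J = 0" if "I \<in> words n d" "J \<in> words n d" "srt \<eta> J" "cls I J \<notin> S" for I J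
    using tri[OF PD that(1-3)] that(4) P(1) Suc.prems(2)[OF P(1)] by blast
  show ?case
  proof (intro bexI[OF _ z'] ballI impI)
    fix I J assume IJ: "I \<in> words n d" "J \<in> words n d" "srt \<eta> J"
    have "ent (x - (z + cst c * y P)) I J = ent (x1 - z) I J" by (simp add: x1_def)
    also have "\<dots> = (if cls I J \<in> S' then 0 else ent x1 I J)" by (rule z(2)[OF IJ])
    also have "\<dots> = (if cls I J \<in> S then 0 else ent x I J)"
      using x1P[OF IJ] out[OF IJ] P(1) by (auto simp: S'_def x1_def)
    finally show "ent (x - (z + cst c * y P)) I J = (if cls I J \<in> S then 0 else ent x I J)" .
  qed
qed

lemma in_span:
  assumes "x \<in> C n" "\<And>I J. I \<in> words n d \<Longrightarrow> J \<in> words n d \<Longrightarrow> ent x I J \<in> laurent"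
    and "\<And>I J. I \<in> words n d \<Longrightarrow> J \<in> words n d \<Longrightarrow> srt \<eta> J \<Longrightarrow> ent x I J \<noteq> 0 \<Longrightarrow> cls I J \<in> D"
  shows "\<exists>z\<in>LS (y ` D). agree n d x z"
proof -
  obtain z where z: "z \<in> LS (y ` D)" "\<And>I J. I \<in> words n d \<Longrightarrow> J \<in> words n d \<Longrightarrow> srt \<eta> J
    \<Longrightarrow> ent (x - z) I J = (if cls I J \<in> D then 0 else ent x I J)"
    using eliminate[OF order_refl _ assms(1,2)] by blast
  have "agree n d (x - z) 0"
    by (rule agree_0I[OF sign]) (use z(2) assms(3) in auto)
  then have "agree n d x z" by (simp add: agree_def)
  then show ?thesis using z(1) by blast
qed

text \<open>All classes of smaller grade are cleared from \<open>y P\<close>; only its own class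
  remains.\<close>

lemma concentrated:
  assumes "P \<in> D"
  obtains f where "f \<in> LS (y ` D)" "\<And>I J. I \<in> words n d \<Longrightarrow> J \<in> words n d \<Longrightarrow> srt \<eta> J \<Longrightarrow> ent f I J \<noteq> 0 \<Longrightarrow> cls I J = P"
    "\<And>I J. I \<in> words n d \<Longrightarrow> J \<in> words n d \<Longrightarrow> srt \<eta> J \<Longrightarrow> cls I J = P \<Longrightarrow> is_unit_laurent (ent f I J)"
proof -
  define S where "S = {P' \<in> D. gr P' < gr P}"
  have "\<exists>z\<in>LS (y ` S). \<forall>I\<in>words n d. \<forall>J\<in>words n d. srt \<eta> J \<longrightarrow>
    ent (y P - z) I J = (if cls I J \<in> S then 0 else ent (y P) I J)"
    by (rule eliminate) (use GA_C[OF GA[OF assms]] ent_GA[OF GA[OF assms]] in \<open>auto simp: S_def\<close>)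
  then obtain z where z: "z \<in> LS (y ` S)" "\<And>I J. I \<in> words n d \<Longrightarrow> J \<in> words n d \<Longrightarrow> srt \<eta> J
    \<Longrightarrow> ent (y P - z) I J = (if cls I J \<in> S then 0 else ent (y P) I J)" by blast
  show thesis
  proof (rule that[of "y P - z"])
    have "z \<in> LS (y ` D)" using z(1) by (rule LS_mono) (auto simp: S_def)
    then have "y P + - z \<in> LS (y ` D)" using assms by (intro LS_plus[OF LS_base[OF imageI] LS_uminus])
    then show "y P - z \<in> LS (y ` D)" by simp
    fix I J assume IJ: "I \<in> words n d" "J \<in> words n d" "srt \<eta> J"
    show "ent (y P - z) I J \<noteq> 0 \<Longrightarrow> cls I J = P"
      using z(2)[OF IJ] tri[OF assms IJ] by (auto simp: S_def split: if_splits)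
    show "cls I J = P \<Longrightarrow> is_unit_laurent (ent (y P - z) I J)"
      unfolding z(2)[OF IJ] using unit[OF assms IJ] by (auto simp: S_def)
  qed
qed

end

section \<open>Monomials in root vectors\<close>

text \<open>As pairs of target and source these are the positive roots for \<epsilon> = 1 and the
  negative ones for \<epsilon> = -1.\<close>

definition posn :: "int \<Rightarrow> nat \<Rightarrow> (nat \<times> nat) set" where
  "posn \<epsilon> n = {(t, s). t < n \<and> s < n \<and> \<epsilon> * int t < \<epsilon> * int s}"

definition tgt :: "(nat \<times> nat) list \<Rightarrow> (nat \<times> nat \<Rightarrow> nat) \<Rightarrow> nat \<Rightarrow> nat" where
  "tgt L B k = (\<Sum>a\<leftarrow>L. if fst a = k then B a else 0)"

lemma src_add_mset:
  assumes "distinct L"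
  shows "src L (count (add_mset p M)) k = src L (count M) k + (if p \<in> set L \<and> snd p = k then 1 else 0)"
  using assms by (induction L) (auto simp: src_def)

lemma tgt_add_mset:
  assumes "distinct L"
  shows "tgt L (count (add_mset p M)) k = tgt L (count M) k + (if p \<in> set L \<and> fst p = k then 1 else 0)"
  using assms by (induction L) (auto simp: tgt_def)

lemma src_empty: "src L (\<lambda>a. 0) k = 0"
  by (induction L) simp_all

lemma tgt_empty: "tgt L (\<lambda>a. 0) k = 0"
  by (induction L) (simp_all add: tgt_def)

lemma col_sum:
  assumes "distinct L" "length I = length J" "\<forall>(a, b)\<in>set (zip I J). (a, b) \<in> set L \<or> a = b"
    and "\<forall>(a, b)\<in>set L. a \<noteq> b"
  shows "count_list J k = count (cls I J) (k, k) + src L (count (cls I J)) k"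
  using assms(2,3)
proof (induction I J rule: list_induct2)
  case Nil
  then show ?case by (simp add: src_empty)
next
  case (Cons a I b J)
  then show ?case using assms(4) unfolding cls_simps src_add_mset[OF assms(1)] by auto
qed

lemma row_sum:
  assumes "distinct L" "length I = length J" "\<forall>(a, b)\<in>set (zip I J). (a, b) \<in> set L \<or> a = b"
    and "\<forall>(a, b)\<in>set L. a \<noteq> b"
  shows "count_list I k = count (cls I J) (k, k) + tgt L (count (cls I J)) k"
  using assms(2,3)
proof (induction I J rule: list_induct2)
  case Nil
  then show ?case by (simp add: tgt_empty)
next
  case (Cons a I b J)
  then show ?case using assms(4) unfolding cls_simps tgt_add_mset[OF assms(1)] by auto
qed

lemma GA_fpm:
  assumes "\<forall>(i, j)\<in>set L. i \<noteq> j \<and> i < n \<and> j < n"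
  shows "fpm L B \<in> GA n"
  using assms
proof (induction L)
  case (Cons a L)
  obtain i j where a: "a = (i, j)" by (cases a)
  then have "divpow (root_vec a) (B a) \<in> GA n" using Cons.prems GA_divpow_root_vec by auto
  then show ?case using Cons by (simp add: GA_mult)
qed (simp add: GA_1)

lemma fpm_cong: "(\<And>a. a \<in> set L \<Longrightarrow> B a = B' a) \<Longrightarrow> fpm L B = fpm L B'"
  by (induction L) auto

lemma count_cls_diag: "count (cls J J) (a, b) = (if a = b then count_list J a else 0)"
  by (induction J) auto

lemma clean_delta: "srt (- \<epsilon>) J \<Longrightarrow> clean \<epsilon> J (cls J J) (delta J)"
  unfolding clean_def delta_def by (auto simp: zip_same set_zip)

lemma cls_inj: "length I = length J \<Longrightarrow> cls I J = cls J J \<Longrightarrow> I = J"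
proof (induction I J rule: list_induct2)
  case (Cons a I b J)
  show ?case
  proof -
    have "(a, b) \<in># cls (b # J) (b # J)" using Cons.prems by (metis cls_simps(2) union_single_eq_member)
    then have "a = b" by (auto simp: cls_def zip_same set_zip)
    then show ?thesis using Cons by auto
  qed
qed simp

lemma lead_delta: "lead J (cls J J) (delta J) 1"
  unfolding lead_def by (auto simp: delta_def dest: cls_inj intro!: exI[of _ 1])

text \<open>Weights are additive: each root vector exchanges one letter for another. So the
  exponents and the row word determine the letters of the column word.\<close>

lemma mset_shift:
  assumes "app (op (fpm L B)) (delta J) I \<noteq> 0" "\<forall>a\<in>set L. fst a \<noteq> snd a"
  shows "mset I + (\<Sum>a\<leftarrow>L. replicate_mset (B a) (snd a)) = mset J + (\<Sum>a\<leftarrow>L. replicate_mset (B a) (fst a))"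
  using assms
proof (induction L arbitrary: I)
  case Nil
  then show ?case by (simp add: delta_def split: if_splits)
next
  case (Cons a L)
  obtain t s where a: "a = (t, s)" by (cases a)
  have st: "s \<noteq> t" using Cons.prems a by auto
  have ch: "mset I + {#s#} = mset I' + {#t#}" if "ch s t I I'" for I I' t
    using that by (induction rule: ch.induct) (auto simp: add_mset_commute)
  have pw: "\<exists>I'. f I' \<noteq> 0 \<and> mset I + replicate_mset m s = mset I' + replicate_mset m t"
    if "app (rv s t ^ m) f I \<noteq> 0" for m f I
    using that
  proof (induction m arbitrary: I)
    case (Suc m)
    then have "app (rv s t) (app (rv s t ^ m) f) I \<noteq> 0" by simp
    then obtain I1 where I1: "ch s t I I1" "app (rv s t ^ m) f I1 \<noteq> 0" by (rule rv_nonzero[OF st])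
    then obtain I' where I': "f I' \<noteq> 0" "mset I1 + replicate_mset m s = mset I' + replicate_mset m t"
      using Suc.IH by blast
    have "mset I + replicate_mset (Suc m) s = (mset I + {#s#}) + replicate_mset m s" by simp
    also have "\<dots> = (mset I1 + replicate_mset m s) + {#t#}" unfolding ch[OF I1(1)] by simp
    also have "\<dots> = mset I' + replicate_mset (Suc m) t" unfolding I'(2) by simp
    finally show ?case using I'(1) by blast
  qed auto
  have "app (rv s t ^ B a) (app (op (fpm L B)) (delta J)) I \<noteq> 0"
    using Cons.prems(1) by (simp add: a app_dp rv_def)
  then obtain I' where I': "app (op (fpm L B)) (delta J) I' \<noteq> 0"
    "mset I + replicate_mset (B a) s = mset I' + replicate_mset (B a) t" using pw by blast
  have "mset I' + (\<Sum>a\<leftarrow>L. replicate_mset (B a) (snd a)) = mset J + (\<Sum>a\<leftarrow>L. replicate_mset (B a) (fst a))"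
    by (rule Cons.IH) (use I' Cons.prems in auto)
  then show ?case using I'(2) by (simp add: a) (metis (no_types, lifting) add.assoc add.commute)
qed

section \<open>Spanning\<close>

definition listing :: "int \<Rightarrow> nat \<Rightarrow> (nat \<times> nat) list \<Rightarrow> bool" where
  "listing \<epsilon> n L \<longleftrightarrow> distinct L \<and> set L = posn \<epsilon> n"

definition tri :: "int \<Rightarrow> nat list \<Rightarrow> nat list \<Rightarrow> bool" where
  "tri \<epsilon> I J \<longleftrightarrow> (\<forall>(a, b)\<in>set (zip I J). \<epsilon> * int a \<le> \<epsilon> * int b)"

lemma set_cls: "set_mset (cls I J) = set (zip I J)"
  by (simp add: cls_def)

lemma tri_cong: "cls I J = cls I' J' \<Longrightarrow> tri \<epsilon> I J = tri \<epsilon> I' J'"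
  unfolding tri_def by (metis set_cls)

lemma listing_ne: "listing \<epsilon> n L \<Longrightarrow> \<forall>a\<in>set L. fst a \<noteq> snd a"
  by (auto simp: listing_def posn_def)

lemma listing_GA: "listing \<epsilon> n L \<Longrightarrow> fpm L B \<in> GA n"
  by (rule GA_fpm) (auto simp: listing_def posn_def)

lemma tri_sums:
  assumes L: "listing \<epsilon> n L" and e: "\<epsilon> = 1 \<or> \<epsilon> = -1" and IJ: "I \<in> words n d" "J \<in> words n d" "tri \<epsilon> I J"
  shows "count_list J k = count (cls I J) (k, k) + src L (count (cls I J)) k"
    and "count_list I k = count (cls I J) (k, k) + tgt L (count (cls I J)) k"
proof -
  have "a = b \<or> (a, b) \<in> set L" if "(a, b) \<in> set (zip I J)" for a b
  proof -
    have "a < n" "b < n" using that IJ by (auto simp: words_def dest: set_zip_leftD set_zip_rightD)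
    then show ?thesis using that IJ(3) L e unfolding tri_def listing_def posn_def
      by (cases "\<epsilon> * int a = \<epsilon> * int b") force+
  qed
  then have z: "\<forall>(a, b)\<in>set (zip I J). (a, b) \<in> set L \<or> a = b" by auto
  have ne: "\<forall>(a, b)\<in>set L. a \<noteq> b" using listing_ne[OF L] by auto
  have l: "length I = length J" using IJ by (simp add: words_def)
  have dl: "distinct L" using L by (simp add: listing_def)
  show "count_list J k = count (cls I J) (k, k) + src L (count (cls I J)) k"
    by (rule col_sum[OF dl l z ne])
  show "count_list I k = count (cls I J) (k, k) + tgt L (count (cls I J)) k"
    by (rule row_sum[OF dl l z ne])
qed

lemma fpm_clean:
  assumes L: "listing \<epsilon> n L" and e: "\<epsilon> = 1 \<or> \<epsilon> = -1" and J: "srt (- \<epsilon>) J" "J \<in> words n d"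
    and B: "\<And>k. src L B k \<le> count_list J k"
  shows "clean \<epsilon> J (mvs L B (cls J J)) (app (op (fpm L B)) (delta J))"
    and "lead J (mvs L B (cls J J)) (app (op (fpm L B)) (delta J)) 1"
    and "count (mvs L B (cls J J)) (i, j) = (if i = j then count_list J i - src L B i
      else if (i, j) \<in> set L then B (i, j) else 0)"
proof -
  have dl: "distinct L" "\<forall>(t, s)\<in>set L. \<epsilon> * int t < \<epsilon> * int s" using L by (auto simp: listing_def posn_def)
  have c: "\<forall>a\<in>set L. count (cls J J) a = 0" using listing_ne[OF L] by (auto simp: count_cls_diag)
  have s: "\<forall>k. src L B k \<le> count (cls J J) (k, k)" using B by (simp add: count_cls_diag)
  have "clean \<epsilon> J (mvs L B (cls J J)) (app (op (fpm L B * 1)) (delta J))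
    \<and> lead J (mvs L B (cls J J)) (app (op (fpm L B * 1)) (delta J)) 1"
    by (rule clean_prod[OF e J(1) dl _ _ c s]) (simp_all add: clean_delta[OF J(1)] lead_delta)
  then show "clean \<epsilon> J (mvs L B (cls J J)) (app (op (fpm L B)) (delta J))"
    "lead J (mvs L B (cls J J)) (app (op (fpm L B)) (delta J)) 1" by simp_all
  show "count (mvs L B (cls J J)) (i, j) = (if i = j then count_list J i - src L B i
      else if (i, j) \<in> set L then B (i, j) else 0)"
    unfolding count_mvs[OF dl(1) listing_ne[OF L] s] by (simp add: count_cls_diag)
qed

text \<open>Taking the off-diagonal entries of a triangular class as exponents makes this very class
  the leading one; the column sums match because J is fixed.\<close>

lemma fpm_clean_class:
  assumes L: "listing \<epsilon> n L" and e: "\<epsilon> = 1 \<or> \<epsilon> = -1"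
    and IJ: "I0 \<in> words n d" "J \<in> words n d" "srt (- \<epsilon>) J" "tri \<epsilon> I0 J"
  shows "\<And>I. ent (fpm L (count (cls I0 J))) I J \<noteq> 0 \<Longrightarrow> tri \<epsilon> I J
      \<and> (cls I J = cls I0 J \<or> Hm (cls I J) < Hm (cls I0 J)) \<and> (\<forall>k. count (cls I0 J) (k, k) \<le> count (cls I J) (k, k))"
    and "\<And>I. length I = length J \<Longrightarrow> cls I J = cls I0 J \<Longrightarrow> is_unit_laurent (ent (fpm L (count (cls I0 J))) I J)"
proof -
  let ?B = "count (cls I0 J)"
  have s: "src L ?B k \<le> count_list J k" for k
    using tri_sums(1)[OF L e IJ(1,2,4)] by simp
  note c = fpm_clean[OF L e IJ(3,2) s]
  have z: "count (cls I0 J) (i, j) = 0" if "i \<noteq> j" "(i, j) \<notin> set L" for i j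
  proof -
    have "(i, j) \<notin> set (zip I0 J)"
    proof
      assume z: "(i, j) \<in> set (zip I0 J)"
      then have "i < n" "j < n" using IJ by (auto simp: words_def dest: set_zip_leftD set_zip_rightD)
      moreover have "\<epsilon> * int i \<le> \<epsilon> * int j" using z IJ(4) by (auto simp: tri_def)
      ultimately show False using that L e by (auto simp: listing_def posn_def)
    qed
    then show ?thesis by (simp add: set_cls count_eq_zero_iff)
  qed
  have M: "mvs L ?B (cls J J) = cls I0 J"
  proof (rule multiset_eqI)
    fix p :: "nat \<times> nat"
    obtain i j where "p = (i, j)" by (cases p)
    then show "count (mvs L ?B (cls J J)) p = count (cls I0 J) p"
      using c(3)[of i j] z[of i j] tri_sums(1)[OF L e IJ(1,2,4), of i] by auto
  qed
  show "tri \<epsilon> I J \<and> (cls I J = cls I0 J \<or> Hm (cls I J) < Hm (cls I0 J)) \<and> (\<forall>k. ?B (k, k) \<le> count (cls I J) (k, k))"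
    if "ent (fpm L ?B) I J \<noteq> 0" for I
    using c(1) that unfolding M clean_def ent_def tri_def by blast
  show "is_unit_laurent (ent (fpm L ?B) I J)" if "length I = length J" "cls I J = cls I0 J" for I
    using c(2) that unfolding M lead_def ent_def by auto
qed

lemma weight_mset:
  assumes "I \<in> words n d" "J \<in> words n d" "has_weight n l I" "has_weight n l J"
  shows "mset I = mset J"
proof (rule multiset_eqI)
  fix k
  have "count_list K k = 0" if "K \<in> words n d" "\<not> k < n" for K
    using that by (intro count_notin) (auto simp: words_def)
  then show "count (mset I) k = count (mset J) k"
    using assms by (cases "k < n") (simp_all add: has_weight_def count_mset)
qed

lemma has_weight_mset: "mset I = mset J \<Longrightarrow> has_weight n l I = has_weight n l J"
  unfolding has_weight_def by (metis count_mset)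

lemma ent_one_wt_left:
  assumes "l \<in> Lambda n d" "I \<in> words n d"
  shows "ent (one_wt n l * x) I J = (if has_weight n l I then ent x I J else 0)"
  using app_one_wt[OF assms] by (simp add: ent_def)

lemma ent_one_wt_right:
  assumes "l \<in> Lambda n d" "I \<in> words n d" "J \<in> words n d" "x \<in> C n"
  shows "ent (x * one_wt n l) I J = (if has_weight n l J then ent x I J else 0)"
proof -
  have "app (op x) (app (op (one_wt n l)) (delta J)) I = app (op x) (\<lambda>K. (if has_weight n l J then 1 else 0) * delta J K) I"
    by (rule local_opD[OF local_op_op[OF assms(4)] _ assms(2)])
      (auto simp: app_one_wt[OF assms(1)] delta_def)
  also have "\<dots> = (if has_weight n l J then 1 else 0) * app (op x) (delta J) I"
    by (simp only: app_cmult)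
  finally show ?thesis by (simp add: ent_def)
qed

definition pair_classes :: "nat \<Rightarrow> nat \<Rightarrow> int \<Rightarrow> (nat \<times> nat) multiset set" where
  "pair_classes n d \<eta> = {cls I J | I J. I \<in> words n d \<and> J \<in> words n d \<and> srt \<eta> J}"

lemma finite_pair_classes: "finite (pair_classes n d \<eta>)"
proof -
  have "pair_classes n d \<eta> \<subseteq> (\<lambda>(I, J). cls I J) ` (words n d \<times> words n d)"
    by (auto simp: pair_classes_def)
  then show ?thesis by (rule finite_subset) simp
qed

lemma cls_mset:
  assumes "I \<in> words n d" "J \<in> words n d" "I' \<in> words n d" "J' \<in> words n d" "cls I J = cls I' J'"
  shows "mset I = mset I'" "mset J = mset J'"
proof -
  have l: "length I = length J" "length I' = length J'" using assms by (auto simp: words_def)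
  have "image_mset fst (cls I J) = mset I" "image_mset snd (cls I J) = mset J"
    "image_mset fst (cls I' J') = mset I'" "image_mset snd (cls I' J') = mset J'"
    using l by (simp_all add: cls_def flip: mset_map)
  then show "mset I = mset I'" "mset J = mset J'" using assms(5) by metis+
qed

text \<open>The column weight is fixed by the idempotent on the right. Among triangular classes with
  this weight, those with bounded off-diagonal column sums contain all classes of the given monomial
  and, since diagonals do not shrink, all lower terms of the monomials in the other order.\<close>

lemma outer_reorder:
  assumes L: "listing \<epsilon> n L" and L': "listing \<epsilon> n L'" and e: "\<epsilon> = 1 \<or> \<epsilon> = -1"
    and l: "l \<in> Lambda n d" "\<And>k. k < n \<Longrightarrow> src L' B k \<le> l k"
  shows "\<exists>z\<in>LS {fpm L B' * one_wt n l | B'. \<forall>k<n. src L B' k \<le> src L' B k}. agree n d (fpm L' B * one_wt n l) z"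
proof -
  \<comment> \<open>What column k lacks on the diagonal is its off-diagonal sum, so this condition
    bounds that sum by the content of the given monomial.\<close>
  define D where "D = {cls I J | I J. I \<in> words n d \<and> J \<in> words n d \<and> srt (- \<epsilon>) J \<and> has_weight n l J \<and> tri \<epsilon> I J
    \<and> (\<forall>k<n. l k \<le> count (cls I J) (k, k) + src L' B k)}"
  define y where "y = (\<lambda>M. fpm L (count M) * one_wt n l)"
  have e': "- \<epsilon> = 1 \<or> - \<epsilon> = -1" and e0: "- \<epsilon> \<noteq> 0" using e by auto
  have DI: "cls I J \<in> D" if "I \<in> words n d" "J \<in> words n d" "srt (- \<epsilon>) J" "has_weight n l J" "tri \<epsilon> I J"
    "\<forall>k<n. l k \<le> count (cls I J) (k, k) + src L' B k" for I J
    using that unfolding D_def by blast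
  have DE: "\<exists>I0\<in>words n d. P = cls I0 J \<and> tri \<epsilon> I0 J \<and> (\<forall>k<n. l k \<le> count P (k, k) + src L' B k)"
    if P: "P \<in> D" and J: "J \<in> words n d" "srt (- \<epsilon>) J" "has_weight n l J" for P J
  proof -
    obtain I0 J0 where 0: "P = cls I0 J0" "I0 \<in> words n d" "J0 \<in> words n d" "srt (- \<epsilon>) J0" "has_weight n l J0"
      "tri \<epsilon> I0 J0" "\<forall>k<n. l k \<le> count P (k, k) + src L' B k" using P unfolding D_def by blast
    have "J = J0" by (rule srt_unique[OF e0 J(2) 0(4) weight_mset[OF J(1) 0(3) J(3) 0(5)]])
    then show ?thesis using 0 by blast
  qed
  have entD: "ent (fpm M K * one_wt n l) I J = (if has_weight n l J then ent (fpm M K) I J else 0)"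
    if "listing \<epsilon> n M" "I \<in> words n d" "J \<in> words n d" for M K I J
    by (rule ent_one_wt_right[OF l(1) that(2,3) GA_C[OF listing_GA[OF that(1)]]])
  interpret elimination n d "- \<epsilon>" D y Hm
  proof
    show "- \<epsilon> = 1 \<or> - \<epsilon> = -1" by (rule e')
    have "D \<subseteq> pair_classes n d (- \<epsilon>)" unfolding D_def pair_classes_def by blast
    then show "finite D" by (rule finite_subset[OF _ finite_pair_classes])
  next
    fix P assume "P \<in> D"
    then show "\<exists>I\<in>words n d. \<exists>J\<in>words n d. srt (- \<epsilon>) J \<and> cls I J = P" unfolding D_def by blast
  next
    fix P show "y P \<in> GA n" unfolding y_def using listing_GA[OF L] GA_one_wt GA_mult by blast
  next
    fix P I J assume P: "P \<in> D" and IJ: "I \<in> words n d" "J \<in> words n d" "srt (- \<epsilon>) J" and nz: "ent (y P) I J \<noteq> 0"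
    from nz have w: "has_weight n l J" and nz': "ent (fpm L (count P)) I J \<noteq> 0"
      unfolding y_def entD[OF L IJ(1,2)] by (auto split: if_splits)
    obtain I0 where I0: "I0 \<in> words n d" "P = cls I0 J" "tri \<epsilon> I0 J" "\<forall>k<n. l k \<le> count P (k, k) + src L' B k"
      using DE[OF P IJ(2,3) w] by blast
    have "tri \<epsilon> I J \<and> (cls I J = P \<or> Hm (cls I J) < Hm P) \<and> (\<forall>k. count P (k, k) \<le> count (cls I J) (k, k))"
      using fpm_clean_class(1)[OF L e I0(1) IJ(2,3) I0(3)] nz' unfolding I0(2) by blast
    then show "cls I J = P \<or> cls I J \<in> D \<and> Hm (cls I J) < Hm P"
      using DI[OF IJ w] I0(4) by (meson add_le_cancel_right order_trans)
  next
    fix P I J assume P: "P \<in> D" and IJ: "I \<in> words n d" "J \<in> words n d" "srt (- \<epsilon>) J" and c: "cls I J = P"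
    obtain I1 J1 where 1: "P = cls I1 J1" "I1 \<in> words n d" "J1 \<in> words n d" "has_weight n l J1"
      using P unfolding D_def by blast
    have w: "has_weight n l J" using has_weight_mset[OF cls_mset(2)[OF IJ(1,2) 1(2,3)]] c 1 by simp
    obtain I0 where I0: "I0 \<in> words n d" "P = cls I0 J" "tri \<epsilon> I0 J" using DE[OF P IJ(2,3) w] by blast
    have len: "length I = length J" using IJ by (simp add: words_def)
    show "is_unit_laurent (ent (y P) I J)"
      unfolding y_def entD[OF L IJ(1,2)] using w fpm_clean_class(2)[OF L e I0(1) IJ(2,3) I0(3) len] c I0(2) by simp
  qed
  have "\<exists>z\<in>LS (y ` D). agree n d (fpm L' B * one_wt n l) z"
  proof (rule in_span)
    have g: "fpm L' B * one_wt n l \<in> GA n" using listing_GA[OF L'] GA_one_wt GA_mult by blast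
    show "fpm L' B * one_wt n l \<in> C n" by (rule GA_C[OF g])
    show "ent (fpm L' B * one_wt n l) I J \<in> laurent" for I J by (rule ent_GA[OF g])
    fix I J assume IJ: "I \<in> words n d" "J \<in> words n d" "srt (- \<epsilon>) J" and nz: "ent (fpm L' B * one_wt n l) I J \<noteq> 0"
    from nz have w: "has_weight n l J" and nz': "ent (fpm L' B) I J \<noteq> 0"
      unfolding entD[OF L' IJ(1,2)] by (auto split: if_splits)
    have s: "src L' B k \<le> count_list J k" for k
    proof (cases "k < n")
      case True
      then show ?thesis using l(2) w by (simp add: has_weight_def)
    next
      case False
      have "\<forall>a\<in>set L'. snd a \<noteq> k" using L' False by (auto simp: listing_def posn_def)
      then have "src L' B k = 0" by (induction L') auto
      then show ?thesis by simp
    qed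
    note c = fpm_clean[OF L' e IJ(3,2) s]
    have "tri \<epsilon> I J" and d: "\<forall>k. count (mvs L' B (cls J J)) (k, k) \<le> count (cls I J) (k, k)"
      using c(1) nz' unfolding clean_def ent_def tri_def by blast+
    moreover have "\<forall>k<n. l k \<le> count (cls I J) (k, k) + src L' B k"
    proof (intro allI impI)
      fix k assume "k < n"
      then show "l k \<le> count (cls I J) (k, k) + src L' B k"
        using d[rule_format, of k] w unfolding c(3) by (auto simp: has_weight_def)
    qed
    ultimately show "cls I J \<in> D" using DI[OF IJ w] by blast
  qed
  then obtain z where z: "z \<in> LS (y ` D)" "agree n d (fpm L' B * one_wt n l) z" by blast
  have "y ` D \<subseteq> {fpm L B' * one_wt n l | B'. \<forall>k<n. src L B' k \<le> src L' B k}"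
  proof
    fix x assume "x \<in> y ` D"
    then obtain I J where IJ: "x = y (cls I J)" "I \<in> words n d" "J \<in> words n d" "has_weight n l J" "tri \<epsilon> I J"
      "\<forall>k<n. l k \<le> count (cls I J) (k, k) + src L' B k" unfolding D_def by blast
    have "\<forall>k<n. src L (count (cls I J)) k \<le> src L' B k"
    proof (intro allI impI)
      fix k assume "k < n"
      then show "src L (count (cls I J)) k \<le> src L' B k"
        using IJ(4,6) tri_sums(1)[OF L e IJ(2,3,5), of k] by (auto simp: has_weight_def)
    qed
    then show "x \<in> {fpm L B' * one_wt n l | B'. \<forall>k<n. src L B' k \<le> src L' B k}"
      unfolding IJ(1) y_def by blast
  qed
  then show ?thesis using z LS_mono by blast
qed

text \<open>The counterpart for inner monomials: the idempotent on the left fixes the row weight,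
  and the bound concerns off-diagonal row sums.\<close>

lemma inner_concentrated:
  assumes L: "listing \<epsilon> n L" and e: "\<epsilon> = 1 \<or> \<epsilon> = -1"
    and N: "IN \<in> words n d" "JN \<in> words n d" "srt (- \<epsilon>) JN" "tri \<epsilon> IN JN" "has_weight n l IN"
    and l: "l \<in> Lambda n d"
  obtains f where "f \<in> LS {one_wt n l * fpm L B | B. \<forall>k<n. tgt L B k \<le> tgt L (count (cls IN JN)) k}"
    "\<And>I J. I \<in> words n d \<Longrightarrow> J \<in> words n d \<Longrightarrow> srt (- \<epsilon>) J \<Longrightarrow> ent f I J \<noteq> 0 \<Longrightarrow> cls I J = cls IN JN"
    "\<And>I J. I \<in> words n d \<Longrightarrow> J \<in> words n d \<Longrightarrow> srt (- \<epsilon>) J \<Longrightarrow> cls I J = cls IN JN \<Longrightarrow> is_unit_laurent (ent f I J)"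
proof -
  let ?\<nu> = "\<lambda>k. tgt L (count (cls IN JN)) k"
  define D where "D = {cls I J | I J. I \<in> words n d \<and> J \<in> words n d \<and> srt (- \<epsilon>) J \<and> has_weight n l I \<and> tri \<epsilon> I J
    \<and> (\<forall>k<n. l k \<le> count (cls I J) (k, k) + ?\<nu> k)}"
  define y where "y = (\<lambda>M. one_wt n l * fpm L (count M))"
  have e': "- \<epsilon> = 1 \<or> - \<epsilon> = -1" and e0: "- \<epsilon> \<noteq> 0" using e by auto
  have DI: "cls I J \<in> D" if "I \<in> words n d" "J \<in> words n d" "srt (- \<epsilon>) J" "has_weight n l I" "tri \<epsilon> I J"
    "\<forall>k<n. l k \<le> count (cls I J) (k, k) + ?\<nu> k" for I J
    using that unfolding D_def by blast
  interpret elimination n d "- \<epsilon>" D y Hm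
  proof
    show "- \<epsilon> = 1 \<or> - \<epsilon> = -1" by (rule e')
    have "D \<subseteq> pair_classes n d (- \<epsilon>)" unfolding D_def pair_classes_def by blast
    then show "finite D" by (rule finite_subset[OF _ finite_pair_classes])
  next
    fix P assume "P \<in> D"
    then show "\<exists>I\<in>words n d. \<exists>J\<in>words n d. srt (- \<epsilon>) J \<and> cls I J = P" unfolding D_def by blast
  next
    fix P show "y P \<in> GA n" unfolding y_def using listing_GA[OF L] GA_one_wt GA_mult by blast
  next
    fix P I J assume P: "P \<in> D" and IJ: "I \<in> words n d" "J \<in> words n d" "srt (- \<epsilon>) J" and nz: "ent (y P) I J \<noteq> 0"
    from nz have w: "has_weight n l I" and nz': "ent (fpm L (count P)) I J \<noteq> 0"
      unfolding y_def ent_one_wt_left[OF l IJ(1)] by (auto split: if_splits)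
    obtain I0 J0 where 0: "P = cls I0 J0" "I0 \<in> words n d" "J0 \<in> words n d" "srt (- \<epsilon>) J0" "has_weight n l I0"
      "tri \<epsilon> I0 J0" "\<forall>k<n. l k \<le> count P (k, k) + ?\<nu> k" using P unfolding D_def by blast
    have len: "length I0 = length J0" using 0 by (simp add: words_def)
    have "ent (fpm L (count P)) I0 J0 \<noteq> 0"
      using unit_nonzero[OF fpm_clean_class(2)[OF L e 0(2,3,4,6) len refl]] 0(1) by simp
    \<comment> \<open>The row weight and the exponents are the same for both pairs of words, hence
      so is the column weight, and the sorted columns coincide.\<close>
    from mset_shift[OF this[unfolded ent_def] listing_ne[OF L]] mset_shift[OF nz'[unfolded ent_def] listing_ne[OF L]]
    have "mset J = mset J0" using weight_mset[OF IJ(1) 0(2) w 0(5)] by (metis add_right_imp_eq)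
    then have J: "J = J0" using srt_unique[OF e0 IJ(3) 0(4)] by blast
    have "tri \<epsilon> I J \<and> (cls I J = P \<or> Hm (cls I J) < Hm P) \<and> (\<forall>k. count P (k, k) \<le> count (cls I J) (k, k))"
      using fpm_clean_class(1)[OF L e 0(2,3,4,6)] nz' unfolding 0(1) J by blast
    then show "cls I J = P \<or> cls I J \<in> D \<and> Hm (cls I J) < Hm P"
      using DI[OF IJ w] 0(7) by (meson add_le_cancel_right order_trans)
  next
    fix P I J assume P: "P \<in> D" and IJ: "I \<in> words n d" "J \<in> words n d" "srt (- \<epsilon>) J" and c: "cls I J = P"
    obtain I0 J0 where 0: "P = cls I0 J0" "I0 \<in> words n d" "J0 \<in> words n d" "srt (- \<epsilon>) J0" "has_weight n l I0"
      "tri \<epsilon> I0 J0" using P unfolding D_def by blast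
    have m: "mset I = mset I0" "mset J = mset J0" using cls_mset[OF IJ(1,2) 0(2,3)] c 0(1) by auto
    have J: "J = J0" using srt_unique[OF e0 IJ(3) 0(4)] m by blast
    have len: "length I = length J0" using IJ J by (simp add: words_def)
    show "is_unit_laurent (ent (y P) I J)"
      unfolding y_def ent_one_wt_left[OF l IJ(1)]
      using has_weight_mset[OF m(1)] 0(5) fpm_clean_class(2)[OF L e 0(2,3,4,6) len] c J 0(1) by simp
  qed
  have rs: "count_list I k = count (cls I J) (k, k) + tgt L (count (cls I J)) k"
    if "I \<in> words n d" "J \<in> words n d" "tri \<epsilon> I J" for I J k by (rule tri_sums(2)[OF L e that])
  have ND: "cls IN JN \<in> D"
  proof (rule DI[OF N(1-3,5,4)], intro allI impI)
    fix k assume "k < n"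
    then show "l k \<le> count (cls IN JN) (k, k) + ?\<nu> k"
      using rs[OF N(1,2,4), of k] N(5) by (simp add: has_weight_def)
  qed
  obtain f where f: "f \<in> LS (y ` D)"
    "\<And>I J. I \<in> words n d \<Longrightarrow> J \<in> words n d \<Longrightarrow> srt (- \<epsilon>) J \<Longrightarrow> ent f I J \<noteq> 0 \<Longrightarrow> cls I J = cls IN JN"
    "\<And>I J. I \<in> words n d \<Longrightarrow> J \<in> words n d \<Longrightarrow> srt (- \<epsilon>) J \<Longrightarrow> cls I J = cls IN JN \<Longrightarrow> is_unit_laurent (ent f I J)"
    using concentrated[OF ND] by blast
  have "y ` D \<subseteq> {one_wt n l * fpm L B | B. \<forall>k<n. tgt L B k \<le> ?\<nu> k}"
  proof
    fix x assume "x \<in> y ` D"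
    then obtain I J where IJ: "x = y (cls I J)" "I \<in> words n d" "J \<in> words n d" "has_weight n l I" "tri \<epsilon> I J"
      "\<forall>k<n. l k \<le> count (cls I J) (k, k) + ?\<nu> k" unfolding D_def by blast
    have "\<forall>k<n. tgt L (count (cls I J)) k \<le> ?\<nu> k"
    proof (intro allI impI)
      fix k assume "k < n"
      then show "tgt L (count (cls I J)) k \<le> ?\<nu> k"
        using IJ(4,6) rs[OF IJ(2,3,5), of k] by (auto simp: has_weight_def)
    qed
    then show "x \<in> {one_wt n l * fpm L B | B. \<forall>k<n. tgt L B k \<le> ?\<nu> k}"
      unfolding IJ(1) y_def by blast
  qed
  from LS_mono[OF f(1) this] f(2,3) show thesis by (rule that)
qed

text \<open>The common form of both sets: the index counted by the content is the source for outer
  roots and the target for inner ones, with the maximum when E is outside and the minimum when F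
  is.\<close>

definition Ymon :: "nat \<Rightarrow> nat \<Rightarrow> (nat \<times> nat) list \<Rightarrow> (nat \<times> nat) list \<Rightarrow> free_alg set" where
  "Ymon n d Lo Li = {fpm Lo A * one_wt n l * fpm Li B | l A B. l \<in> Lambda n d \<and> (\<forall>k<n. src Lo A k + tgt Li B k \<le> l k)}"

lemma LS_mult_left:
  assumes "x \<in> LS S" "w \<in> C n" "\<And>y. y \<in> S \<Longrightarrow> \<exists>z\<in>LS Z. agree n d (w * y) z"
  shows "\<exists>z\<in>LS Z. agree n d (w * x) z"
  using assms(1)
proof (induction rule: LS.induct)
  case LS_0
  show ?case by (rule bexI[OF _ LS.LS_0]) simp
next
  case (LS_add x a y)
  then obtain z z' where z: "z \<in> LS Z" "agree n d (w * x) z" "z' \<in> LS Z" "agree n d (w * y) z'"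
    using assms(3) by blast
  have "op (w * (cst a * y)) = op (cst a * (w * y))"
    by (simp, metis mult.assoc scal_central)
  then have "agree n d (w * (cst a * y)) (cst a * (w * y))" by (simp add: agree_def ent_def)
  from agree_trans[OF this agree_cst[OF z(4)]] have "agree n d (w * (x + cst a * y)) (z + cst a * z')"
    using agree_add[OF z(2)] by (simp add: distrib_left)
  then show ?case using z LS_add.hyps(2) by (intro bexI[of _ "z + cst a * z'"]) (auto intro: LS_plus LS_cst)
qed

lemma LS_mult_right: "x \<in> LS S \<Longrightarrow> (\<And>y. y \<in> S \<Longrightarrow> y * w \<in> LS Z) \<Longrightarrow> x * w \<in> LS Z"
  by (induction rule: LS.induct) (auto simp: distrib_right mult.assoc intro: LS_0 LS_plus LS_cst)

text \<open>Replacing a by b wherever \<epsilon> a < \<epsilon> b pushes the outer part of each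
  column onto the diagonal, and the class becomes triangular for the sign of the inner
  factor.\<close>

lemma straighten_count:
  assumes L: "listing \<epsilon> n L" and e: "\<epsilon> = 1 \<or> \<epsilon> = -1" and IJ: "I \<in> words n d" "J \<in> words n d"
  defines "I' \<equiv> map2 (\<lambda>a b. if \<epsilon> * int a < \<epsilon> * int b then b else a) I J"
  shows "count (cls I' J) (i, j) = (if i = j then count (cls I J) (i, i) + src L (count (cls I J)) i
      else if (i, j) \<in> set L then 0 else count (cls I J) (i, j))"
proof -
  have l: "length I = length J" using IJ by (simp add: words_def)
  have b: "\<forall>x\<in>set I. x < n" "\<forall>x\<in>set J. x < n" using IJ by (auto simp: words_def)
  have dl: "distinct L" and sL: "\<And>a b. (a, b) \<in> set L \<longleftrightarrow> a < n \<and> b < n \<and> \<epsilon> * int a < \<epsilon> * int b"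
    using L by (auto simp: listing_def posn_def)
  show ?thesis unfolding I'_def using l b
  proof (induction I J rule: list_induct2)
    case Nil
    have "count {#} = (\<lambda>a :: nat \<times> nat. 0)" by auto
    then show ?case by (simp add: src_empty)
  next
    case (Cons a I b J)
    then show ?case
      unfolding zip_Cons_Cons list.map prod.case cls_simps src_add_mset[OF dl] by (auto simp: sL)
  qed
qed

text \<open>P is split into an outer and an inner part. An inner element concentrated on the
  straightened class N is multiplied by the outer monomial whose exponents are the outer entries of
  P; these exponents move N back to P.\<close>

lemma leading_family:
  assumes e: "\<epsilon> = 1 \<or> \<epsilon> = -1" and Lo: "listing \<epsilon> n Lo" and Li: "listing (- \<epsilon>) n Li"
    and P: "P \<in> pair_classes n d \<epsilon>"
  shows "\<exists>g. g \<in> GA n \<and> (\<exists>z\<in>LS (Ymon n d Lo Li). agree n d g z)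
    \<and> (\<forall>I\<in>words n d. \<forall>J\<in>words n d. srt \<epsilon> J \<longrightarrow> ent g I J \<noteq> 0 \<longrightarrow> cls I J = P \<or> Hm (cls I J) > Hm P)
    \<and> (\<forall>I\<in>words n d. \<forall>J\<in>words n d. srt \<epsilon> J \<longrightarrow> cls I J = P \<longrightarrow> is_unit_laurent (ent g I J))"
proof -
  have e': "- \<epsilon> = 1 \<or> - \<epsilon> = -1" and e0: "\<epsilon> \<noteq> 0" using e by auto
  obtain I0 J0 where 0: "P = cls I0 J0" "I0 \<in> words n d" "J0 \<in> words n d" "srt \<epsilon> J0"
    using P unfolding pair_classes_def by blast
  \<comment> \<open>The order required by \<open>good_prod\<close>; \<open>outer_reorder\<close>
    leads from it to the prescribed order.\<close>
  define Lg where "Lg = sort_key (\<lambda>a. - (\<epsilon> * int (snd a))) Lo"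
  have Lg: "listing \<epsilon> n Lg" using Lo by (simp add: listing_def Lg_def)
  have sorted: "sorted_wrt (\<lambda>a b. \<epsilon> * int (snd a) \<ge> \<epsilon> * int (snd b)) Lg"
    using sorted_sort_key[of "\<lambda>a. - (\<epsilon> * int (snd a))" Lo] unfolding Lg_def
    by (simp add: sorted_map)
  define IN where "IN = map2 (\<lambda>a b. if \<epsilon> * int a < \<epsilon> * int b then b else a) I0 J0"
  have len0: "length I0 = length J0" using 0 by (simp add: words_def)
  have INw: "IN \<in> words n d"
    using 0 unfolding IN_def words_def by (auto simp: set_zip split: if_splits) (metis lessThan_iff nth_mem subsetD)+
  have tN: "tri (- \<epsilon>) IN J0"
    unfolding tri_def IN_def by (auto simp: set_zip)
  define N where "N = cls IN J0"
  have cN: "count N (i, j) = (if i = j then count P (i, i) + src Lg (count P) i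
      else if (i, j) \<in> set Lg then 0 else count P (i, j))" for i j
    unfolding N_def IN_def 0(1) by (rule straighten_count[OF Lg e 0(2,3)])
  \<comment> \<open>The idempotent between the two factors is given by the row weight of the
    straightened pair.\<close>
  define l where "l = (\<lambda>k. if k < n then count_list IN k else 0)"
  have lL: "l \<in> Lambda n d" using sum_count_words[OF INw] by (simp add: Lambda_def l_def)
  have lw: "has_weight n l IN" by (simp add: has_weight_def l_def)
  obtain f where f: "f \<in> LS {one_wt n l * fpm Li B | B. \<forall>k<n. tgt Li B k \<le> tgt Li (count N) k}"
    "\<And>I J. I \<in> words n d \<Longrightarrow> J \<in> words n d \<Longrightarrow> srt \<epsilon> J \<Longrightarrow> ent f I J \<noteq> 0 \<Longrightarrow> cls I J = N"
    "\<And>I J. I \<in> words n d \<Longrightarrow> J \<in> words n d \<Longrightarrow> srt \<epsilon> J \<Longrightarrow> cls I J = N \<Longrightarrow> is_unit_laurent (ent f I J)"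
    using inner_concentrated[OF Li e' INw 0(3) _ tN lw lL] 0(4) unfolding N_def by auto
  have fGA: "f \<in> GA n"
    by (rule LS_GA[OF f(1)]) (auto intro!: GA_mult GA_one_wt listing_GA[OF Li])
  define g where "g = fpm Lg (count P) * f"
  have gGA: "g \<in> GA n" unfolding g_def using listing_GA[OF Lg] fGA by (rule GA_mult)
  \<comment> \<open>The diagonal of N has absorbed the outer content of P, and the remainder of its
    row is the inner content. Hence the two contents together are at most l.\<close>
  have rN: "l k = count N (k, k) + tgt Li (count N) k" if "k < n" for k
    using tri_sums(2)[OF Li e' INw 0(3) tN, of k] that by (simp add: l_def N_def)
  have sk: "src Lg (count P) k \<le> count N (k, k)" for k unfolding cN by simp
  have span: "\<exists>z\<in>LS (Ymon n d Lo Li). agree n d g z"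
    unfolding g_def
  proof (rule LS_mult_left[OF f(1) GA_C[OF listing_GA[OF Lg]]])
    fix y assume "y \<in> {one_wt n l * fpm Li B | B. \<forall>k<n. tgt Li B k \<le> tgt Li (count N) k}"
    then obtain B where B: "y = one_wt n l * fpm Li B" "\<And>k. k < n \<Longrightarrow> tgt Li B k \<le> tgt Li (count N) k" by blast
    have s: "src Lg (count P) k \<le> l k" if "k < n" for k using rN[OF that] sk[of k] by simp
    obtain z where z: "z \<in> LS {fpm Lo B' * one_wt n l | B'. \<forall>k<n. src Lo B' k \<le> src Lg (count P) k}"
      "agree n d (fpm Lg (count P) * one_wt n l) z" using outer_reorder[OF Lo Lg e lL s] by blast
    have zGA: "z \<in> GA n" by (rule LS_GA[OF z(1)]) (auto intro!: GA_mult GA_one_wt listing_GA[OF Lo])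
    have "agree n d (fpm Lg (count P) * one_wt n l * fpm Li B) (z * fpm Li B)"
      by (rule agree_mult_right[OF z(2) GA_C GA_C[OF zGA]]) (intro GA_mult GA_one_wt listing_GA[OF Lg])
    then have "agree n d (fpm Lg (count P) * y) (z * fpm Li B)" by (simp add: B(1) mult.assoc)
    moreover have "z * fpm Li B \<in> LS (Ymon n d Lo Li)"
    proof (rule LS_mult_right[OF z(1)])
      fix w assume "w \<in> {fpm Lo B' * one_wt n l | B'. \<forall>k<n. src Lo B' k \<le> src Lg (count P) k}"
      then obtain A where A: "w = fpm Lo A * one_wt n l" "\<And>k. k < n \<Longrightarrow> src Lo A k \<le> src Lg (count P) k" by blast
      have "src Lo A k + tgt Li B k \<le> l k" if "k < n" for k
        using A(2)[OF that] B(2)[OF that] rN[OF that] sk[of k] by linarith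
      then have "w * fpm Li B \<in> Ymon n d Lo Li" unfolding Ymon_def A(1) using lL by blast
      then show "w * fpm Li B \<in> LS (Ymon n d Lo Li)" by (rule LS_base)
    qed
    ultimately show "\<exists>z\<in>LS (Ymon n d Lo Li). agree n d (fpm Lg (count P) * y) z" by blast
  qed
  let ?h = "app (op f) (delta J0)"
  have hw: "I \<in> words n d" if "?h I \<noteq> 0" for I
    using keeps_words[OF GA_C[OF fGA] 0(3) that] .
  have hN: "cls I J0 = N" if "?h I \<noteq> 0" for I
    using f(2)[OF hw[OF that] 0(3,4)] that by (simp add: ent_def)
  have good: "good \<epsilon> J0 c N ?h" for c
    unfolding good_def
  proof (intro allI impI conjI)
    fix I assume nz: "?h I \<noteq> 0"
    show "length I = length J0" using hw[OF nz] 0(3) by (simp add: words_def)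
    have "tri (- \<epsilon>) I J0" using hN[OF nz] tN tri_cong unfolding N_def by blast
    then show "\<forall>(a, b)\<in>set (zip I J0). \<epsilon> * int c < \<epsilon> * int b \<longrightarrow> \<epsilon> * int b \<le> \<epsilon> * int a"
      unfolding tri_def by auto
    show "cls I J0 = N \<or> Hm N < Hm (cls I J0)" using hN[OF nz] by blast
  qed
  have ld: "lead J0 N ?h 1"
    unfolding lead_def
  proof (intro allI impI)
    fix I assume I: "length I = length J0" "cls I J0 = N"
    have "image_mset fst (cls I J0) = mset I" "image_mset fst (cls IN J0) = mset IN"
      using I(1) INw 0(3) by (simp_all add: cls_def words_def flip: mset_map)
    then have "mset I = mset IN" using I(2) by (simp add: N_def)
    then have "I \<in> words n d" using INw words_mset by blast
    from f(3)[OF this 0(3,4) I(2)] show "\<exists>u. is_unit_laurent u \<and> ?h I = u * 1" by (auto simp: ent_def)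
  qed
  \<comment> \<open>A threshold beyond all sources in the \<epsilon>-order, for either sign.\<close>
  define k where "k = (if \<epsilon> = 1 then n else 0)"
  have kb: "\<forall>a\<in>set Lg. \<epsilon> * int (snd a) \<le> \<epsilon> * int k"
    using Lg e by (auto simp: k_def listing_def posn_def)
  have dLg: "distinct Lg" "\<forall>(t, s)\<in>set Lg. \<epsilon> * int t < \<epsilon> * int s" using Lg by (auto simp: listing_def posn_def)
  have c0: "\<forall>a\<in>set Lg. count N a = 0"
  proof
    fix a assume a: "a \<in> set Lg"
    obtain i j where ij: "a = (i, j)" by (cases a)
    then have "i \<noteq> j" using listing_ne[OF Lg] a by auto
    then show "count N a = 0" using a unfolding ij cN by simp
  qed
  have sk': "\<forall>k. src Lg (count P) k \<le> count N (k, k)" using sk by blast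
  have gp: "good \<epsilon> J0 k (mvs Lg (count P) N) (app (op g) (delta J0))
    \<and> lead J0 (mvs Lg (count P) N) (app (op g) (delta J0)) 1"
    unfolding g_def by (rule good_prod[OF e 0(4) dLg sorted good ld c0 sk' kb])
  have M: "mvs Lg (count P) N = P"
  proof (rule multiset_eqI)
    fix p :: "nat \<times> nat"
    obtain i j where p: "p = (i, j)" by (cases p)
    show "count (mvs Lg (count P) N) p = count P p"
      unfolding p count_mvs[OF dLg(1) listing_ne[OF Lg] sk'] cN by auto
  qed
  \<comment> \<open>Concentration on N makes every sorted column of f other than J0 vanish, so
    nothing has to be known about the outer monomial at those columns.\<close>
  have z: "ent g I J = 0" if "I \<in> words n d" "J \<in> words n d" "srt \<epsilon> J" "J \<noteq> J0" for I J
  proof -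
    have "app (op f) (delta J) K = 0" for K
    proof (rule ccontr)
      assume nz: "app (op f) (delta J) K \<noteq> 0"
      then have K: "K \<in> words n d" using keeps_words[OF GA_C[OF fGA] that(2)] by blast
      have "cls K J = N" using f(2)[OF K that(2,3)] nz by (simp add: ent_def)
      then have "mset J = mset J0" using cls_mset(2)[OF K that(2) INw 0(3)] by (simp add: N_def)
      then show False using srt_unique[OF e0 that(3) 0(4)] that(4) by blast
    qed
    then have "app (op f) (delta J) = (\<lambda>K. 0)" by blast
    then show ?thesis by (simp add: ent_def g_def app_zero)
  qed
  show ?thesis
  proof (intro exI[of _ g] conjI ballI impI)
    show "g \<in> GA n" by (rule gGA)
    show "\<exists>z\<in>LS (Ymon n d Lo Li). agree n d g z" by (rule span)
  next
    fix I J assume IJ: "I \<in> words n d" "J \<in> words n d" "srt \<epsilon> J" and nz: "ent g I J \<noteq> 0"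
    have "J = J0" using z[OF IJ] nz by blast
    then show "cls I J = P \<or> Hm P < Hm (cls I J)"
      using gp nz unfolding M good_def ent_def by blast
  next
    fix I J assume IJ: "I \<in> words n d" "J \<in> words n d" "srt \<epsilon> J" and c: "cls I J = P"
    have "mset J = mset J0" using cls_mset(2)[OF IJ(1,2) 0(2,3)] c 0(1) by simp
    then have J: "J = J0" using srt_unique[OF e0 IJ(3) 0(4)] by blast
    have "length I = length J0" using IJ J by (simp add: words_def)
    then show "is_unit_laurent (ent g I J)"
      using gp c unfolding M lead_def ent_def J by auto
  qed
qed

definition lfam :: "nat \<Rightarrow> nat \<Rightarrow> int \<Rightarrow> (nat \<times> nat) list \<Rightarrow> (nat \<times> nat) list \<Rightarrow> (nat \<times> nat) multiset \<Rightarrow> free_alg" where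
  "lfam n d \<epsilon> Lo Li P = (SOME g. g \<in> GA n \<and> (\<exists>z\<in>LS (Ymon n d Lo Li). agree n d g z)
    \<and> (\<forall>I\<in>words n d. \<forall>J\<in>words n d. srt \<epsilon> J \<longrightarrow> ent g I J \<noteq> 0 \<longrightarrow> cls I J = P \<or> Hm (cls I J) > Hm P)
    \<and> (\<forall>I\<in>words n d. \<forall>J\<in>words n d. srt \<epsilon> J \<longrightarrow> cls I J = P \<longrightarrow> is_unit_laurent (ent g I J)))"

lemma lfam:
  assumes "\<epsilon> = 1 \<or> \<epsilon> = -1" "listing \<epsilon> n Lo" "listing (- \<epsilon>) n Li" "P \<in> pair_classes n d \<epsilon>"
  shows "lfam n d \<epsilon> Lo Li P \<in> GA n" "\<exists>z\<in>LS (Ymon n d Lo Li). agree n d (lfam n d \<epsilon> Lo Li P) z"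
    and "\<And>I J. I \<in> words n d \<Longrightarrow> J \<in> words n d \<Longrightarrow> srt \<epsilon> J \<Longrightarrow> ent (lfam n d \<epsilon> Lo Li P) I J \<noteq> 0
      \<Longrightarrow> cls I J = P \<or> Hm (cls I J) > Hm P"
    and "\<And>I J. I \<in> words n d \<Longrightarrow> J \<in> words n d \<Longrightarrow> srt \<epsilon> J \<Longrightarrow> cls I J = P
      \<Longrightarrow> is_unit_laurent (ent (lfam n d \<epsilon> Lo Li P) I J)"
  using someI_ex[OF leading_family[OF assms]] unfolding lfam_def[symmetric] by blast+

theorem Ymon_spans:
  assumes e: "\<epsilon> = 1 \<or> \<epsilon> = -1" and Lo: "listing \<epsilon> n Lo" and Li: "listing (- \<epsilon>) n Li"
    and x: "x \<in> C n" "\<And>I J. I \<in> words n d \<Longrightarrow> J \<in> words n d \<Longrightarrow> ent x I J \<in> laurent"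
  shows "\<exists>z\<in>LS (Ymon n d Lo Li). agree n d x z"
proof -
  note lf = lfam[OF e Lo Li]
  \<comment> \<open>The leading classes are now the lowest ones, hence the negated
    statistic.\<close>
  interpret elimination n d \<epsilon> "pair_classes n d \<epsilon>" "lfam n d \<epsilon> Lo Li" "\<lambda>M. - Hm M"
  proof
    show "\<epsilon> = 1 \<or> \<epsilon> = -1" by (rule e)
    show "finite (pair_classes n d \<epsilon>)" by (rule finite_pair_classes)
  next
    fix P assume "P \<in> pair_classes n d \<epsilon>"
    then show "\<exists>I\<in>words n d. \<exists>J\<in>words n d. srt \<epsilon> J \<and> cls I J = P" unfolding pair_classes_def by blast
  next
    fix P assume "P \<in> pair_classes n d \<epsilon>"
    then show "lfam n d \<epsilon> Lo Li P \<in> GA n" by (rule lf)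
  next
    fix P I J assume P: "P \<in> pair_classes n d \<epsilon>" and IJ: "I \<in> words n d" "J \<in> words n d" "srt \<epsilon> J"
      and nz: "ent (lfam n d \<epsilon> Lo Li P) I J \<noteq> 0"
    have "cls I J \<in> pair_classes n d \<epsilon>" using IJ unfolding pair_classes_def by blast
    then show "cls I J = P \<or> cls I J \<in> pair_classes n d \<epsilon> \<and> - Hm (cls I J) < - Hm P"
      using lf(3)[OF P IJ nz] by auto
  next
    fix P I J assume "P \<in> pair_classes n d \<epsilon>" "I \<in> words n d" "J \<in> words n d" "srt \<epsilon> J" "cls I J = P"
    then show "is_unit_laurent (ent (lfam n d \<epsilon> Lo Li P) I J)" by (rule lf(4))
  qed
  obtain z where z: "z \<in> LS (lfam n d \<epsilon> Lo Li ` pair_classes n d \<epsilon>)" "agree n d x z"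
    using in_span[OF x] unfolding pair_classes_def by blast
  have "\<exists>z'\<in>LS (Ymon n d Lo Li). agree n d z z'"
    by (rule LS_agree[OF z(1)]) (use lf(2) in auto)
  then show ?thesis using z(2) agree_trans by blast
qed

section \<open>Independence\<close>

interpretation endo_space: vector_space smul
  by unfold_locales (simp_all add: smul_simps smul_add)

definition word_proj :: "nat \<Rightarrow> nat \<Rightarrow> endo" where
  "word_proj n d = Endo (\<lambda>f I. if I \<in> words n d then f I else 0)"

text \<open>Cutting down to \<open>words n d\<close> on both sides makes equality of operators the
  same as equality of matrices, so linear algebra over the ground field applies inside the type
  \<open>endo\<close>.\<close>

definition restr :: "nat \<Rightarrow> nat \<Rightarrow> free_alg \<Rightarrow> endo" where
  "restr n d x = word_proj n d * op x * word_proj n d"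

lemma app_word_proj: "app (word_proj n d) f = (\<lambda>I. if I \<in> words n d then f I else 0)"
  unfolding word_proj_def by (subst app_Endo) (auto simp: linear_op_def)

lemma app_restr:
  assumes "x \<in> C n"
  shows "app (restr n d x) f I = (if I \<in> words n d then \<Sum>K\<in>words n d. ent x I K * f K else 0)"
proof (cases "I \<in> words n d")
  case True
  have "app (restr n d x) f I = app (op x) (\<lambda>K. if K \<in> words n d then f K else 0) I"
    using True by (simp add: restr_def app_times app_word_proj)
  also have "\<dots> = (\<Sum>K\<in>words n d. app (op x) (delta K) I * (if K \<in> words n d then f K else 0))"
    by (rule app_expand[OF local_op_op[OF assms] True])
  also have "\<dots> = (\<Sum>K\<in>words n d. ent x I K * f K)" by (intro sum.cong refl) (simp add: ent_def)
  finally show ?thesis using True by simp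
qed (simp add: restr_def app_times app_word_proj)

lemma restr_delta: "x \<in> C n \<Longrightarrow> I \<in> words n d \<Longrightarrow> J \<in> words n d \<Longrightarrow> app (restr n d x) (delta J) I = ent x I J"
  by (simp add: app_restr delta_def if_distrib cong: if_cong)

lemma restr_eq_iff:
  assumes "x \<in> C n" "y \<in> C n"
  shows "restr n d x = restr n d y \<longleftrightarrow> agree n d x y"
proof
  assume "restr n d x = restr n d y"
  then show "agree n d x y" unfolding agree_def using assms restr_delta by metis
next
  assume "agree n d x y"
  then show "restr n d x = restr n d y"
    by (intro endo_eqI) (simp add: app_restr assms agree_def)
qed

lemma restr_add: "restr n d (x + y) = restr n d x + restr n d y"
  by (simp add: restr_def distrib_left distrib_right)

lemma restr_cst: "restr n d (cst a * x) = a \<star> restr n d x"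
  by (simp add: restr_def smul_simps flip: smul_def)

lemma restr_LS: "z \<in> LS Y \<Longrightarrow> restr n d z \<in> endo_space.span (restr n d ` Y)"
proof (induction rule: LS.induct)
  case LS_0
  then show ?case by (simp add: restr_def endo_space.span_zero)
next
  case (LS_add x a y)
  then show ?case
    by (simp add: restr_add restr_cst endo_space.span_add endo_space.span_scale endo_space.span_base)
qed

text \<open>Among the classes with nonzero coefficient take one with the smallest statistic. At its
  entries all other members of the combination vanish, while its own entry is a unit.\<close>

lemma lfam_independent:
  assumes e: "\<epsilon> = 1 \<or> \<epsilon> = -1" and Lo: "listing \<epsilon> n Lo" and Li: "listing (- \<epsilon>) n Li"
    and s: "(\<Sum>P\<in>pair_classes n d \<epsilon>. c P \<star> restr n d (lfam n d \<epsilon> Lo Li P)) = 0"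
    and P: "P \<in> pair_classes n d \<epsilon>"
  shows "c P = 0"
proof (rule ccontr)
  assume cP: "c P \<noteq> 0"
  note lf = lfam[OF e Lo Li]
  define Z where "Z = {P \<in> pair_classes n d \<epsilon>. c P \<noteq> 0}"
  have fZ: "finite Z" "Z \<noteq> {}" using P cP finite_pair_classes by (auto simp: Z_def)
  then have "Min (Hm ` Z) \<in> Hm ` Z" by (intro Min_in) auto
  then obtain Q where Q: "Q \<in> Z" "Hm Q = Min (Hm ` Z)" by (auto simp del: Min_in)
  have min: "Hm Q \<le> Hm R" if "R \<in> Z" for R using Q(2) fZ(1) that by simp
  have QD: "Q \<in> pair_classes n d \<epsilon>" using Q(1) by (simp add: Z_def)
  then obtain I J where IJ: "Q = cls I J" "I \<in> words n d" "J \<in> words n d" "srt \<epsilon> J"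
    unfolding pair_classes_def by blast
  have "0 = app (\<Sum>P\<in>pair_classes n d \<epsilon>. c P \<star> restr n d (lfam n d \<epsilon> Lo Li P)) (delta J) I"
    unfolding s by simp
  also have "\<dots> = (\<Sum>P\<in>pair_classes n d \<epsilon>. c P * ent (lfam n d \<epsilon> Lo Li P) I J)"
    unfolding app_sum app_smul by (intro sum.cong refl) (simp add: restr_delta IJ GA_C[OF lf(1)])
  also have "\<dots> = (\<Sum>P\<in>{Q}. c P * ent (lfam n d \<epsilon> Lo Li P) I J)"
  proof (rule sum.mono_neutral_right)
    show "\<forall>R\<in>pair_classes n d \<epsilon> - {Q}. c R * ent (lfam n d \<epsilon> Lo Li R) I J = 0"
    proof
      fix R assume R: "R \<in> pair_classes n d \<epsilon> - {Q}"
      show "c R * ent (lfam n d \<epsilon> Lo Li R) I J = 0"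
      proof (rule ccontr)
        assume "\<not> ?thesis"
        then have "R \<in> Z" "Hm Q > Hm R" using lf(3)[where P = R and I = I and J = J] R IJ by (auto simp: Z_def)
        then show False using min by fastforce
      qed
    qed
  qed (use QD finite_pair_classes in auto)
  also have "\<dots> = c Q * ent (lfam n d \<epsilon> Lo Li Q) I J" by simp
  finally show False
    using Q(1) unit_nonzero[OF lf(4)[OF QD IJ(2-4)]] IJ(1) by (auto simp: Z_def)
qed

section \<open>Counting the monomials\<close>

lemma sum_src: "\<forall>a\<in>set L. snd a < n \<Longrightarrow> (\<Sum>k<n. src L B k) = (\<Sum>a\<leftarrow>L. B a)"
  by (induction L) (auto simp: sum.distrib)

lemma sum_tgt: "\<forall>a\<in>set L. fst a < n \<Longrightarrow> (\<Sum>k<n. tgt L B k) = (\<Sum>a\<leftarrow>L. B a)"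
  by (induction L) (auto simp: sum.distrib tgt_def)

lemma src_cong: "(\<And>a. a \<in> set L \<Longrightarrow> B a = B' a) \<Longrightarrow> src L B k = src L B' k"
  by (induction L) auto

lemma tgt_cong: "(\<And>a. a \<in> set L \<Longrightarrow> B a = B' a) \<Longrightarrow> tgt L B k = tgt L B' k"
  by (induction L) (auto simp: tgt_def)

definition cells :: "(nat \<times> nat) list \<Rightarrow> (nat \<times> nat \<Rightarrow> nat) \<Rightarrow> (nat \<times> nat) multiset" where
  "cells L B = (\<Sum>a\<leftarrow>L. replicate_mset (B a) a)"

lemma count_cells: "distinct L \<Longrightarrow> count (cells L B) p = (if p \<in> set L then B p else 0)"
  by (induction L) (auto simp: cells_def)

lemma size_cells: "size (cells L B) = (\<Sum>a\<leftarrow>L. B a)"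
  by (induction L) (auto simp: cells_def)

lemma pair_classesI:
  assumes "\<epsilon> = 1 \<or> \<epsilon> = -1" "size P = d" "\<And>a b. (a, b) \<in># P \<Longrightarrow> a < n \<and> b < n"
  shows "P \<in> pair_classes n d \<epsilon>"
proof -
  obtain xs where xs: "mset xs = P" using ex_mset by blast
  define ys where "ys = sort_key (\<lambda>p. \<epsilon> * int (snd p)) xs"
  have ys: "mset ys = P" by (simp add: ys_def xs)
  have "sorted (map (\<lambda>p. \<epsilon> * int (snd p)) ys)" unfolding ys_def by (rule sorted_sort_key)
  then have "srt \<epsilon> (map snd ys)" by (simp add: srt_def sorted_wrt_map)
  moreover have "cls (map fst ys) (map snd ys) = P" by (simp add: cls_def zip_map_fst_snd ys)
  moreover have "length ys = d" using assms(2) ys by (metis size_mset)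
  moreover have "(a, b) \<in># P" if "(a, b) \<in> set ys" for a b using that ys by auto
  then have "set (map fst ys) \<subseteq> {..<n}" "set (map snd ys) \<subseteq> {..<n}" using assms(3) by fastforce+
  ultimately show ?thesis unfolding pair_classes_def words_def
    by (intro CollectI exI[of _ "map fst ys"] exI[of _ "map snd ys"]) auto
qed

text \<open>A monomial is recorded in one matrix: exponents of outer and inner root vectors are
  off-diagonal entries on the two sides, and the diagonal holds what the content leaves of l. The
  entries then sum to d, so there are at most as many monomials as classes.\<close>

lemma Ymon_param:
  assumes e: "\<epsilon> = 1 \<or> \<epsilon> = -1" and Lo: "listing \<epsilon> n Lo" and Li: "listing (- \<epsilon>) n Li"
  shows "Ymon n d Lo Li \<subseteq> (\<lambda>P. fpm Lo (count P)
    * one_wt n (\<lambda>k. if k < n then count P (k, k) + src Lo (count P) k + tgt Li (count P) k else 0)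
    * fpm Li (count P)) ` pair_classes n d \<epsilon>"
proof
  fix y assume "y \<in> Ymon n d Lo Li"
  then obtain l A B where y: "y = fpm Lo A * one_wt n l * fpm Li B" and l: "l \<in> Lambda n d"
    and le: "\<And>k. k < n \<Longrightarrow> src Lo A k + tgt Li B k \<le> l k" unfolding Ymon_def by blast
  define dg where "dg = map (\<lambda>k. (k, k)) [0..<n]"
  define E :: "nat \<times> nat \<Rightarrow> nat" where "E = (\<lambda>p. l (fst p) - (src Lo A (fst p) + tgt Li B (fst p)))"
  define P where "P = cells Lo A + cells Li B + cells dg E"
  have dis: "distinct Lo" "distinct Li" "distinct dg"
    using Lo Li by (auto simp: listing_def dg_def distinct_map inj_on_def)
  have so: "set Lo = posn \<epsilon> n" and si: "set Li = posn (- \<epsilon>) n" and sd: "set dg = {(k, k) | k. k < n}"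
    using Lo Li by (auto simp: listing_def dg_def)
  have cP: "count P p = (if p \<in> set Lo then A p else 0) + (if p \<in> set Li then B p else 0) + (if p \<in> set dg then E p else 0)" for p
    by (simp add: P_def count_cells dis)
  have cA: "count P a = A a" if "a \<in> set Lo" for a
    using that unfolding cP so si sd posn_def by auto
  have cB: "count P a = B a" if "a \<in> set Li" for a
    using that unfolding cP so si sd posn_def by auto
  have cD: "count P (k, k) = l k - (src Lo A k + tgt Li B k)" if "k < n" for k
    using that unfolding cP so si sd posn_def E_def by auto
  have sA: "src Lo (count P) k = src Lo A k" for k by (rule src_cong) (rule cA)
  have tB: "tgt Li (count P) k = tgt Li B k" for k by (rule tgt_cong) (rule cB)
  have "size P = (\<Sum>k<n. src Lo A k) + (\<Sum>k<n. tgt Li B k) + (\<Sum>k<n. l k - (src Lo A k + tgt Li B k))"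
  proof -
    have "(\<Sum>a\<leftarrow>dg. E a) = (\<Sum>k<n. l k - (src Lo A k + tgt Li B k))"
      by (simp add: dg_def E_def comp_def interv_sum_list_conv_sum_set_nat atLeast0LessThan)
    moreover have "\<forall>a\<in>set Lo. snd a < n" "\<forall>a\<in>set Li. fst a < n" unfolding so si posn_def by auto
    ultimately show ?thesis by (simp add: P_def size_cells sum_src sum_tgt)
  qed
  also have "\<dots> = (\<Sum>k<n. l k)"
    unfolding sum.distrib[symmetric] by (intro sum.cong refl) (use le in auto)
  also have "\<dots> = d" using l by (simp add: Lambda_def)
  finally have "size P = d" .
  moreover have "a < n \<and> b < n" if "(a, b) \<in># P" for a b
  proof -
    have "count P (a, b) \<noteq> 0" using that by (simp add: count_eq_zero_iff)
    then show ?thesis unfolding cP so si sd posn_def by (auto split: if_splits)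
  qed
  ultimately have P: "P \<in> pair_classes n d \<epsilon>" using pair_classesI[OF e] by blast
  have "(\<lambda>k. if k < n then count P (k, k) + src Lo (count P) k + tgt Li (count P) k else 0) = l"
  proof
    fix k show "(if k < n then count P (k, k) + src Lo (count P) k + tgt Li (count P) k else 0) = l k"
      using le[of k] l by (cases "k < n") (simp_all add: cD sA tB Lambda_def)
  qed
  moreover have "fpm Lo (count P) = fpm Lo A" by (rule fpm_cong) (rule cA)
  moreover have "fpm Li (count P) = fpm Li B" by (rule fpm_cong) (rule cB)
  ultimately show "y \<in> (\<lambda>P. fpm Lo (count P)
    * one_wt n (\<lambda>k. if k < n then count P (k, k) + src Lo (count P) k + tgt Li (count P) k else 0)
    * fpm Li (count P)) ` pair_classes n d \<epsilon>"
    unfolding y using P by (intro image_eqI[of _ _ P]) simp_all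
qed

lemma Ymon_GA: "listing \<epsilon> n Lo \<Longrightarrow> listing (- \<epsilon>) n Li \<Longrightarrow> Ymon n d Lo Li \<subseteq> GA n"
  unfolding Ymon_def by (auto intro!: GA_mult GA_one_wt listing_GA)

text \<open>
  The leading family consists of as many independent elements as there are classes of pairs, it
  lies in the span of the monomials, and there are no more monomials than classes.
\<close>

lemma Ymon_independent:
  assumes e: "\<epsilon> = 1 \<or> \<epsilon> = -1" and Lo: "listing \<epsilon> n Lo" and Li: "listing (- \<epsilon>) n Li"
  shows "\<not> endo_space.dependent (restr n d ` Ymon n d Lo Li)"
proof
  let ?T = "pair_classes n d \<epsilon>"
  let ?Y = "restr n d ` Ymon n d Lo Li"
  note lf = lfam[OF e Lo Li]
  define h where "h = (\<lambda>P. restr n d (lfam n d \<epsilon> Lo Li P))"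
  have ind: "c P = 0" if "(\<Sum>P\<in>?T. c P \<star> h P) = 0" "P \<in> ?T" for c P
    using lfam_independent[OF e Lo Li, where d = d and c = c and P = P] that unfolding h_def by blast
  have finT: "finite ?T" by (rule finite_pair_classes)
  have inj: "inj_on h ?T"
  proof (rule inj_onI, rule ccontr)
    fix P Q assume PQ: "P \<in> ?T" "Q \<in> ?T" "h P = h Q" "P \<noteq> Q"
    define c where "c = (\<lambda>R. if R = P then 1 else if R = Q then - 1 else 0 :: Qv)"
    have "(\<Sum>R\<in>?T. c R \<star> h R) = (\<Sum>R\<in>{P, Q}. c R \<star> h R)"
      by (rule sum.mono_neutral_right) (use PQ finT in \<open>auto simp: c_def\<close>)
    also have "\<dots> = 0" using PQ by (simp add: c_def smul_uminus smul_simps)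
    finally have "c P = 0" using ind PQ(1) by blast
    then show False by (simp add: c_def)
  qed
  have indep: "\<not> endo_space.dependent (h ` ?T)"
  proof
    assume "endo_space.dependent (h ` ?T)"
    then obtain t u where t: "finite t" "t \<subseteq> h ` ?T" "(\<Sum>v\<in>t. u v \<star> v) = 0" "\<exists>v\<in>t. u v \<noteq> 0"
      unfolding endo_space.dependent_explicit by blast
    define S where "S = {P \<in> ?T. h P \<in> t}"
    have tS: "t = h ` S" using t(2) by (auto simp: S_def)
    have iS: "inj_on h S" using inj by (rule inj_on_subset) (auto simp: S_def)
    define c where "c = (\<lambda>P. if h P \<in> t then u (h P) else 0)"
    have "(\<Sum>P\<in>?T. c P \<star> h P) = (\<Sum>P\<in>S. c P \<star> h P)"
      by (rule sum.mono_neutral_right) (use finT in \<open>auto simp: S_def c_def\<close>)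
    also have "\<dots> = (\<Sum>P\<in>S. u (h P) \<star> h P)" by (intro sum.cong) (auto simp: c_def S_def)
    also have "\<dots> = 0" using t(3) unfolding tS sum.reindex[OF iS] by simp
    finally have z: "(\<Sum>P\<in>?T. c P \<star> h P) = 0" .
    obtain v where v: "v \<in> t" "u v \<noteq> 0" using t(4) by blast
    obtain P where P: "P \<in> ?T" "v = h P" using v(1) t(2) by blast
    show False using ind[OF z P(1)] v by (simp add: c_def P(2))
  qed
  have sub: "h ` ?T \<subseteq> endo_space.span ?Y"
  proof
    fix v assume "v \<in> h ` ?T"
    then obtain P where P: "P \<in> ?T" "v = h P" by blast
    obtain z where z: "z \<in> LS (Ymon n d Lo Li)" "agree n d (lfam n d \<epsilon> Lo Li P) z" using lf(2)[OF P(1)] by blast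
    have "z \<in> C n" by (rule GA_C[OF LS_GA[OF z(1) Ymon_GA[OF Lo Li]]])
    then have "v = restr n d z" unfolding P(2) h_def using restr_eq_iff[OF GA_C[OF lf(1)[OF P(1)]]] z(2) by blast
    then show "v \<in> endo_space.span ?Y" using restr_LS[OF z(1)] by simp
  qed
  have Yf: "finite ?Y" "card ?Y \<le> card ?T"
  proof -
    have "?Y \<subseteq> (\<lambda>P. restr n d (fpm Lo (count P)
      * one_wt n (\<lambda>k. if k < n then count P (k, k) + src Lo (count P) k + tgt Li (count P) k else 0)
      * fpm Li (count P))) ` ?T" (is "_ \<subseteq> ?g ` _")
      using image_mono[OF Ymon_param[OF e Lo Li, of d], of "restr n d"] unfolding image_image .
    moreover have "finite (?g ` ?T)" using finT by blast
    ultimately show "finite ?Y" "card ?Y \<le> card ?T"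
      using card_mono[of "?g ` ?T" ?Y] card_image_le[OF finT, of ?g] finite_subset by (blast, linarith)
  qed
  \<comment> \<open>If some element were redundant, fewer vectors than there are classes would span
    a space that contains the independent leading family.\<close>
  assume "endo_space.dependent ?Y"
  then obtain y where y: "y \<in> ?Y" "y \<in> endo_space.span (?Y - {y})"
    unfolding endo_space.dependent_def by blast
  have "endo_space.span ?Y = endo_space.span (?Y - {y})"
    using endo_space.span_redundant[OF y(2)] insert_Diff[OF y(1)] by simp
  then have "h ` ?T \<subseteq> endo_space.span (?Y - {y})" using sub by simp
  from endo_space.independent_span_bound[OF _ indep this]
  have "card (h ` ?T) \<le> card (?Y - {y})" using Yf(1) by blast
  then have "card ?T \<le> card ?Y - 1" using card_image[OF inj] y(1) Yf(1) by simp
  moreover have "card ?Y > 0" using y(1) Yf(1) card_gt_0_iff by blast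
  ultimately show False using Yf(2) by linarith
qed

section \<open>The integral form as a module of matrices\<close>

lemma free_act_eq_iff:
  assumes "x \<in> C n" "y \<in> C n"
  shows "free_act n d x = free_act n d y \<longleftrightarrow> agree n d x y"
proof
  assume "free_act n d x = free_act n d y"
  then show "agree n d x y" unfolding agree_def ent_def using free_act_entry assms by metis
next
  assume "agree n d x y"
  then show "free_act n d x = free_act n d y"
    by (intro mat_eq_encI[of _ n d]) (simp_all add: free_act_entry assms agree_def ent_def)
qed

lemma qSchur_int_eq:
  "qSchur_int n d = free_act n d ` {x \<in> C n. \<forall>I\<in>words n d. \<forall>J\<in>words n d. ent x I J \<in> laurent}"
proof -
  have "(\<forall>v\<in>lattice n d. free_act n d x *\<^sub>v v \<in> lattice n d) \<longleftrightarrow> (\<forall>I\<in>words n d. \<forall>J\<in>words n d. ent x I J \<in> laurent)"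
    if x: "x \<in> C n" for x
  proof
    assume *: "\<forall>v\<in>lattice n d. free_act n d x *\<^sub>v v \<in> lattice n d"
    show "\<forall>I\<in>words n d. \<forall>J\<in>words n d. ent x I J \<in> laurent"
    proof (intro ballI)
      fix I J assume IJ: "I \<in> words n d" "J \<in> words n d"
      have "unit_vec (n ^ d) (enc n J) \<in> lattice n d"
        by (auto simp: lattice_def unit_vec_def)
      then have "(free_act n d x *\<^sub>v unit_vec (n ^ d) (enc n J)) $ enc n I \<in> laurent"
        using * enc_less[OF IJ(1)] unfolding lattice_def by blast
      moreover have "(free_act n d x *\<^sub>v unit_vec (n ^ d) (enc n J)) $ enc n I = free_act n d x $$ (enc n I, enc n J)"
        using enc_less[OF IJ(1)] enc_less[OF IJ(2)] by simp
      ultimately show "ent x I J \<in> laurent" using free_act_entry[OF x IJ] by (simp add: ent_def)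
    qed
  next
    assume *: "\<forall>I\<in>words n d. \<forall>J\<in>words n d. ent x I J \<in> laurent"
    have e: "free_act n d x $$ (r, c) \<in> laurent" if rc: "r < n ^ d" "c < n ^ d" for r c
    proof -
      obtain I where I: "I \<in> words n d" "r = enc n I" using rc(1) by (rule enc_surj)
      obtain J where J: "J \<in> words n d" "c = enc n J" using rc(2) by (rule enc_surj)
      show ?thesis using * I J free_act_entry[OF x I(1) J(1)] by (simp add: ent_def)
    qed
    show "\<forall>v\<in>lattice n d. free_act n d x *\<^sub>v v \<in> lattice n d"
    proof
      fix v assume v: "v \<in> lattice n d"
      have "(free_act n d x *\<^sub>v v) $ r \<in> laurent" if r: "r < n ^ d" for r
      proof -
        have "(free_act n d x *\<^sub>v v) $ r = (\<Sum>c = 0..<n ^ d. free_act n d x $$ (r, c) * v $ c)"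
          using r v by (auto simp: scalar_prod_def lattice_def intro!: sum.cong)
        also have "\<dots> \<in> laurent" using e[OF r] v by (intro laurent_sum laurent_mult) (auto simp: lattice_def)
        finally show ?thesis .
      qed
      then show "free_act n d x *\<^sub>v v \<in> lattice n d"
        using mult_mat_vec_carrier[OF free_act_carrier] v by (auto simp: lattice_def)
    qed
  qed
  then show ?thesis unfolding qSchur_int_def qSchur_eq by auto
qed

text \<open>A circle of inclusions: combinations of the monomials are generated, generated elements
  preserve the lattice, and lattice-preserving elements are combinations of the monomials.\<close>

lemma qSchur_int_GA_LS:
  assumes e: "\<epsilon> = 1 \<or> \<epsilon> = -1" and Lo: "listing \<epsilon> n Lo" and Li: "listing (- \<epsilon>) n Li"
  shows "qSchur_int n d = free_act n d ` LS (Ymon n d Lo Li)" "qSchur_int n d = free_act n d ` GA n"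
proof -
  have 1: "free_act n d ` GA n \<subseteq> qSchur_int n d"
    unfolding qSchur_int_eq using GA_C ent_GA by blast
  have 2: "free_act n d ` LS (Ymon n d Lo Li) \<subseteq> free_act n d ` GA n"
    using LS_GA[OF _ Ymon_GA[OF Lo Li]] by blast
  have 3: "qSchur_int n d \<subseteq> free_act n d ` LS (Ymon n d Lo Li)"
  proof
    fix s assume "s \<in> qSchur_int n d"
    then obtain x where x: "s = free_act n d x" "x \<in> C n" "\<And>I J. I \<in> words n d \<Longrightarrow> J \<in> words n d \<Longrightarrow> ent x I J \<in> laurent"
      unfolding qSchur_int_eq by blast
    obtain z where z: "z \<in> LS (Ymon n d Lo Li)" "agree n d x z" using Ymon_spans[OF e Lo Li x(2,3)] by blast
    have "z \<in> C n" by (rule GA_C[OF LS_GA[OF z(1) Ymon_GA[OF Lo Li]]])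
    then show "s \<in> free_act n d ` LS (Ymon n d Lo Li)" using free_act_eq_iff[OF x(2)] z x(1) by blast
  qed
  show "qSchur_int n d = free_act n d ` LS (Ymon n d Lo Li)" by (rule equalityI[OF 3 order_trans[OF 2 1]])
  show "qSchur_int n d = free_act n d ` GA n" by (rule equalityI[OF order_trans[OF 3 2] 1])
qed

section \<open>The matrices as a module over the Laurent polynomials\<close>

lemma laurent_ring_simps [simp]:
  "carrier laurent_ring = laurent" "x \<oplus>\<^bsub>laurent_ring\<^esub> y = x + y" "x \<otimes>\<^bsub>laurent_ring\<^esub> y = x * y"
  "\<zero>\<^bsub>laurent_ring\<^esub> = 0" "\<one>\<^bsub>laurent_ring\<^esub> = 1"
  by (simp_all add: laurent_ring_def)

lemma cring_laurent_ring: "cring laurent_ring"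
proof (rule cringI)
  show "abelian_group laurent_ring"
    by (rule abelian_groupI) (auto simp: add.assoc add.commute intro!: bexI[of _ "- x" for x])
  show "Group.comm_monoid laurent_ring"
    by (rule comm_monoidI) (auto simp: mult.assoc mult.commute)
qed (simp add: distrib_right)

lemma End_module_simps [simp]:
  "carrier (End_module n d) = carrier_mat (n ^ d) (n ^ d)" "x \<oplus>\<^bsub>End_module n d\<^esub> y = x + y"
  "\<zero>\<^bsub>End_module n d\<^esub> = 0\<^sub>m (n ^ d) (n ^ d)" "a \<odot>\<^bsub>End_module n d\<^esub> x = a \<cdot>\<^sub>m x"
  by (simp_all add: End_module_def module_mat_simps)

lemma module_End: "Module.module laurent_ring (End_module n d)"
proof (rule moduleI)
  show "cring laurent_ring" by (rule cring_laurent_ring)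
  show "abelian_group (End_module n d)" unfolding End_module_def by (rule abelian_group_mat)
qed (auto simp: add_smult_distrib_left_mat add_smult_distrib_right_mat)

lemma lincomb_entry:
  assumes "finite A" "A \<subseteq> carrier_mat (n ^ d) (n ^ d)" "a \<in> A \<rightarrow> laurent" "r < n ^ d" "c < n ^ d"
  shows "LinearCombinations.module.lincomb (End_module n d) a A $$ (r, c) = (\<Sum>v\<in>A. a v * v $$ (r, c))"
proof -
  interpret Module.module laurent_ring "End_module n d" by (rule module_End)
  show ?thesis unfolding lincomb_def using assms(1-3)
  proof (induction A rule: finite_induct)
    case (insert v A)
    have "(\<Oplus>\<^bsub>End_module n d\<^esub>w\<in>A. a w \<odot>\<^bsub>End_module n d\<^esub> w) \<in> carrier (End_module n d)"
      by (rule finsum_closed) (use insert.prems in auto)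
    moreover have "(\<Oplus>\<^bsub>End_module n d\<^esub>w\<in>insert v A. a w \<odot>\<^bsub>End_module n d\<^esub> w)
      = a v \<odot>\<^bsub>End_module n d\<^esub> v \<oplus>\<^bsub>End_module n d\<^esub> (\<Oplus>\<^bsub>End_module n d\<^esub>w\<in>A. a w \<odot>\<^bsub>End_module n d\<^esub> w)"
      by (rule finsum_insert) (use insert in auto)
    ultimately show ?case using insert assms(4,5) by auto
  qed (use assms in simp)
qed

lemma laurent_basis_Ymon:
  assumes e: "\<epsilon> = 1 \<or> \<epsilon> = -1" and Lo: "listing \<epsilon> n Lo" and Li: "listing (- \<epsilon>) n Li"
  shows "laurent_basis n d (free_act n d ` Ymon n d Lo Li) (qSchur_int n d)"
proof -
  interpret Module.module laurent_ring "End_module n d" by (rule module_End)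
  let ?Y = "Ymon n d Lo Li"
  let ?M = "free_act n d ` ?Y"
  note S = qSchur_int_GA_LS(1)[OF e Lo Li, of d]
  have YC: "y \<in> C n" if "y \<in> ?Y" for y using that Ymon_GA[OF Lo Li] GA_C by blast
  have LSC: "z \<in> C n" if "z \<in> LS ?Y" for z by (rule GA_C[OF LS_GA[OF that Ymon_GA[OF Lo Li]]])
  have car: "?M \<subseteq> carrier (End_module n d)" by auto
  have sub: "?M \<subseteq> qSchur_int n d" unfolding S using LS_base by blast
  interpret sp: LinearCombinations.submodule laurent_ring "span ?M" "End_module n d"
    by (rule span_is_submodule[OF car])
  have "free_act n d z \<in> span ?M" if "z \<in> LS ?Y" for z
    using that
  proof (induction rule: LS.induct)
    case LS_0
    then show ?case using sp.zero_closed by (simp add: free_act_0)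
  next
    case (LS_add x a y)
    have "free_act n d y \<in> span ?M" using in_own_span[OF car] LS_add.hyps by blast
    then have "a \<cdot>\<^sub>m free_act n d y \<in> span ?M" using sp.smult_closed[of a] LS_add.hyps by simp
    then show ?case
      using sp.m_closed LS_add LSC YC by (simp add: free_act_add free_act_cst_mult)
  qed
  then have 1: "qSchur_int n d \<subseteq> span ?M" unfolding S by blast
  have 2: "span ?M \<subseteq> qSchur_int n d"
  proof
    fix s assume "s \<in> span ?M"
    then obtain a A where A: "s = lincomb a A" "finite A" "A \<subseteq> ?M" "a \<in> A \<rightarrow> carrier laurent_ring"
      unfolding span_def by blast
    have "lincomb a A \<in> free_act n d ` LS ?Y"
      using A(2-4)
    proof (induction A rule: finite_induct)
      case empty
      have "lincomb a {} = free_act n d 0" by (simp add: lincomb_def free_act_0)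
      then show ?case using LS_0 by blast
    next
      case (insert v A)
      then obtain z where z: "z \<in> LS ?Y" "lincomb a A = free_act n d z" by auto
      obtain y where y: "y \<in> ?Y" "v = free_act n d y" using insert.prems by blast
      have "lincomb a (insert v A) = a v \<cdot>\<^sub>m v + lincomb a A"
        unfolding lincomb_def using insert car by (subst finsum_insert) auto
      also have "\<dots> = free_act n d (cst (a v) * y + z)"
        using y z YC LSC by (simp add: free_act_add free_act_cst_mult)
      finally show ?case
        using insert.prems y z by (intro image_eqI[of _ _ "cst (a v) * y + z"]) (auto intro!: LS_plus[OF LS_cst[OF LS_base]])
    qed
    then show "s \<in> qSchur_int n d" unfolding S A(1) .
  qed
  have 3: "\<not> lin_dep ?M"
  proof
    assume "lin_dep ?M"
    then obtain A a v where A: "finite A" "A \<subseteq> ?M" "a \<in> A \<rightarrow> carrier laurent_ring"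
      "lincomb a A = \<zero>\<^bsub>End_module n d\<^esub>" "v \<in> A" "a v \<noteq> \<zero>\<^bsub>laurent_ring\<^esub>"
      unfolding lin_dep_def by blast
    \<comment> \<open>One representative is chosen for each matrix, in order to carry a relation
      between matrices over to operators, where independence is known even over the ground
      field.\<close>
    define X where "X = (\<lambda>M. SOME y. y \<in> ?Y \<and> free_act n d y = M)"
    have X: "X M \<in> ?Y" "free_act n d (X M) = M" if "M \<in> A" for M
    proof -
      have "\<exists>y. y \<in> ?Y \<and> free_act n d y = M" using that A(2) by blast
      from someI_ex[OF this] show "X M \<in> ?Y" "free_act n d (X M) = M" unfolding X_def by auto
    qed
    define h where "h = (\<lambda>M. restr n d (X M))"
    have inj: "inj_on h A"
    proof (rule inj_onI)
      fix M N assume MN: "M \<in> A" "N \<in> A" "h M = h N"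
      then have "agree n d (X M) (X N)" using restr_eq_iff YC X by (simp add: h_def)
      then show "M = N" using free_act_eq_iff[of "X M" n "X N" d] YC X MN by metis
    qed
    have z: "(\<Sum>M\<in>A. a M * ent (X M) I J) = 0" if IJ: "I \<in> words n d" "J \<in> words n d" for I J
    proof -
      have "(\<Sum>M\<in>A. a M * ent (X M) I J) = (\<Sum>M\<in>A. a M * M $$ (enc n I, enc n J))"
        by (intro sum.cong refl) (metis X YC ent_def free_act_entry IJ)
      also have "\<dots> = lincomb a A $$ (enc n I, enc n J)"
        by (rule lincomb_entry[symmetric]) (use A car IJ enc_less in auto)
      finally show ?thesis unfolding A(4) using IJ enc_less by simp
    qed
    have "(\<Sum>M\<in>A. a M \<star> h M) = 0"
    proof (rule endo_eqI)
      fix f I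
      have "app (\<Sum>M\<in>A. a M \<star> h M) f I = (\<Sum>M\<in>A. a M * app (h M) f I)"
        by (simp add: app_sum)
      also have "\<dots> = 0"
      proof (cases "I \<in> words n d")
        case True
        have "(\<Sum>M\<in>A. a M * app (h M) f I) = (\<Sum>M\<in>A. \<Sum>K\<in>words n d. a M * ent (X M) I K * f K)"
          using True by (intro sum.cong refl) (simp add: h_def app_restr YC X sum_distrib_left mult.assoc)
        also have "\<dots> = (\<Sum>K\<in>words n d. (\<Sum>M\<in>A. a M * ent (X M) I K) * f K)"
          by (subst sum.swap) (simp add: sum_distrib_right)
        also have "\<dots> = 0" using z[OF True] by simp
        finally show ?thesis .
      next
        case False
        then show ?thesis by (intro sum.neutral) (simp add: h_def app_restr YC X)
      qed
      finally show "app (\<Sum>M\<in>A. a M \<star> h M) f I = app 0 f I" by simp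
    qed
    then have "(\<Sum>w\<in>h ` A. a (the_inv_into A h w) \<star> w) = 0"
      by (simp add: sum.reindex[OF inj] the_inv_into_f_f[OF inj])
    moreover have "h ` A \<subseteq> restr n d ` ?Y" using X by (auto simp: h_def)
    moreover have "a (the_inv_into A h (h v)) \<noteq> 0" using A(5,6) by (simp add: the_inv_into_f_f[OF inj])
    ultimately have "endo_space.dependent (restr n d ` ?Y)"
      unfolding endo_space.dependent_explicit using A(1,5)
      by (intro exI[of _ "h ` A"] exI[of _ "\<lambda>w. a (the_inv_into A h w)"]) auto
    then show False using Ymon_independent[OF e Lo Li] by blast
  qed
  show ?thesis unfolding laurent_basis_def using sub 1 2 3 by blast
qed

text \<open>The set \<open>GA\<close> has the same generators, and its closure under equality of
  operators is invisible to matrices, since they depend on the operator only.\<close>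

lemma laurent_subalgebra_eq:
  "laurent_subalgebra n d
     ({img n d (divpow (EE i) m) | i m. Suc i < n} \<union> {img n d (divpow (FF i) m) | i m. Suc i < n}
      \<union> {img n d (Kbinom i m) | i m. i < n}) = free_act n d ` GA n" (is "laurent_subalgebra n d ?G = _")
proof -
  let ?R = "ring_mat TYPE(Qv) (n ^ d) ()"
  let ?H = "{a \<cdot>\<^sub>m 1\<^sub>m (n ^ d) | a. a \<in> laurent} \<union> ?G"
  interpret R: ring ?R by (rule ring_mat)
  have cst: "free_act n d (cst a) = a \<cdot>\<^sub>m 1\<^sub>m (n ^ d)" for a
    using free_act_cst_mult[of 1 n d a] by (simp add: free_act_1)
  have H: "?H \<subseteq> free_act n d ` GA n"
  proof
    fix h assume "h \<in> ?H"
    then consider a where "a \<in> laurent" "h = a \<cdot>\<^sub>m 1\<^sub>m (n ^ d)"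
      | i m where "Suc i < n" "h = img n d (divpow (EE i) m)"
      | i m where "Suc i < n" "h = img n d (divpow (FF i) m)"
      | i m where "i < n" "h = img n d (Kbinom i m)" by blast
    then show "h \<in> free_act n d ` GA n"
    proof cases
      case 1
      then show ?thesis by (simp only: cst[symmetric] imageI GA_cst)
    qed (simp_all only: img_eq[OF GA_C] GA_E GA_F GA_K imageI)
  qed
  have "generate_ring ?R ?H \<subseteq> free_act n d ` GA n"
  proof
    fix h assume "h \<in> generate_ring ?R ?H"
    then show "h \<in> free_act n d ` GA n"
    proof (induction rule: generate_ring.induct)
      case one
      have "\<one>\<^bsub>?R\<^esub> = free_act n d 1" by (simp add: ring_mat_simps free_act_1)
      then show ?case by (simp only: imageI GA_1)
    next
      case (incl h)
      then show ?case using H by blast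
    next
      case (a_inv h)
      then obtain x where x: "x \<in> GA n" "h = free_act n d x" by blast
      have m: "cst (- 1) * x \<in> GA n" using x(1) by (intro GA_mult GA_cst) simp_all
      have "\<ominus>\<^bsub>?R\<^esub> h = free_act n d (cst (- 1) * x)"
      proof (rule R.minus_equality)
        have "free_act n d (cst (- 1) * x) + h = free_act n d (cst (- 1) * x + x)"
          using x(2) GA_C[OF x(1)] GA_C[OF m] by (simp add: free_act_add)
        also have "cst (- 1) * x + x = 0" by (simp add: cst_def single_uminus)
        finally show "free_act n d (cst (- 1) * x) \<oplus>\<^bsub>?R\<^esub> h = \<zero>\<^bsub>?R\<^esub>" by (simp add: ring_mat_simps free_act_0)
      qed (simp_all add: ring_mat_simps x(2))
      then show ?case using m by blast
    next
      case (eng_add h k)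
      then obtain x y where "x \<in> GA n" "h = free_act n d x" "y \<in> GA n" "k = free_act n d y" by blast
      then show ?case
        by (intro image_eqI[of _ _ "x + y"]) (auto simp: ring_mat_simps free_act_add GA_C intro: GA_add)
    next
      case (eng_mult h k)
      then obtain x y where "x \<in> GA n" "h = free_act n d x" "y \<in> GA n" "k = free_act n d y" by blast
      then show ?case
        by (intro image_eqI[of _ _ "x * y"]) (auto simp: ring_mat_simps free_act_mult GA_C intro: GA_mult)
    qed
  qed
  moreover have "free_act n d x \<in> generate_ring ?R ?H" if "x \<in> GA n" for x
    using that
  proof (induction rule: GA.induct)
    case (GA_cst a)
    then show ?case unfolding cst by (intro generate_ring.incl) blast
  next
    case (GA_E i m)
    then have "free_act n d (divpow (EE i) m) = img n d (divpow (EE i) m)" by (simp only: img_eq[OF GA_C] GA.GA_E)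
    then show ?case using GA_E by (intro generate_ring.incl) blast
  next
    case (GA_F i m)
    then have "free_act n d (divpow (FF i) m) = img n d (divpow (FF i) m)" by (simp only: img_eq[OF GA_C] GA.GA_F)
    then show ?case using GA_F by (intro generate_ring.incl) blast
  next
    case (GA_K i m)
    then have "free_act n d (Kbinom i m) = img n d (Kbinom i m)" by (simp only: img_eq[OF GA_C] GA.GA_K)
    then show ?case using GA_K by (intro generate_ring.incl) blast
  next
    case (GA_add x y)
    then show ?case using generate_ring.eng_add[of _ ?R ?H] by (simp add: free_act_add GA_C ring_mat_simps)
  next
    case (GA_mult x y)
    then show ?case using generate_ring.eng_mult[of _ ?R ?H] by (simp add: free_act_mult GA_C ring_mat_simps)
  next
    case (GA_cong x y)
    then show ?case using free_act_cong[OF GA_C, of x n y d] by simp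
  qed
  ultimately show ?thesis unfolding laurent_subalgebra_def by blast
qed

section \<open>Translation of the two sets of the theorem\<close>

lemma posn_plus: "posn 1 n = pos_roots n"
  by (auto simp: posn_def pos_roots_def)

lemma posn_minus: "posn (- 1) n = prod.swap ` pos_roots n"
proof (intro equalityI subsetI)
  fix p assume "p \<in> posn (- 1) n"
  then show "p \<in> prod.swap ` pos_roots n"
    by (intro image_eqI[of _ _ "prod.swap p"]) (auto simp: posn_def pos_roots_def)
qed (auto simp: posn_def pos_roots_def)

lemma listing_plus: "root_ordering n os \<Longrightarrow> listing 1 n os"
  unfolding root_ordering_def listing_def posn_plus .

lemma listing_minus: "root_ordering n os \<Longrightarrow> listing (- 1) n (map prod.swap os)"
  unfolding root_ordering_def listing_def posn_minus by (simp add: distinct_map)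

lemma fp_eval_E: "fp_eval (E_prod os A) = fpm os A"
  by (simp add: fpm_def E_prod_def)

lemma F_prod_eq: "F_prod os B = map (\<lambda>a. (a, B (prod.swap a))) (map prod.swap os)"
  by (auto simp: F_prod_def)

lemma fp_eval_F: "fp_eval (F_prod os B) = fpm (map prod.swap os) (\<lambda>a. B (prod.swap a))"
  by (simp only: fpm_def F_prod_eq)

lemma content_append: "content ix (p @ q) k = content ix p k + content ix q k"
  by (simp add: content_def)

lemma content_src:
  "(\<And>i j. (i, j) \<in> set L \<Longrightarrow> ix i j = j) \<Longrightarrow> content ix (map (\<lambda>a. (a, B a)) L) k = src L B k"
  by (induction L) (auto simp: content_def)

lemma content_tgt:
  "(\<And>i j. (i, j) \<in> set L \<Longrightarrow> ix i j = i) \<Longrightarrow> content ix (map (\<lambda>a. (a, B a)) L) k = tgt L B k"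
  by (induction L) (auto simp: content_def tgt_def)

text \<open>With E outside, the larger index of a root is the source of the positive and the target
  of the negative root vector.\<close>

lemma Y_plus_eq:
  assumes E: "root_ordering n osE" and F: "root_ordering n osF"
  shows "Y_plus n d osE osF = free_act n d ` Ymon n d osE (map prod.swap osF)"
proof -
  let ?Li = "map prod.swap osF"
  have c: "content max (E_prod osE A @ F_prod osF B) k = src osE A k + tgt ?Li (\<lambda>a. B (prod.swap a)) k" for A B k
    unfolding content_append E_prod_def F_prod_eq using E F
    by (subst content_src, force simp: root_ordering_def pos_roots_def,
        subst content_tgt, force simp: root_ordering_def pos_roots_def, simp)
  have g: "fpm osE A * one_wt n l * fpm ?Li B \<in> C n" for l A B
    using listing_GA[OF listing_plus[OF E]] listing_GA[OF listing_minus[OF F]] GA_one_wt by (intro C_mult GA_C)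
  have "Y_plus n d osE osF = {free_act n d (fpm osE A * one_wt n l * fpm ?Li (\<lambda>a. B (prod.swap a))) | l A B.
      l \<in> Lambda n d \<and> (\<forall>k<n. src osE A k + tgt ?Li (\<lambda>a. B (prod.swap a)) k \<le> l k)}"
    unfolding Y_plus_def fp_eval_E fp_eval_F c by (simp add: img_eq[OF g])
  also have "\<dots> = free_act n d ` Ymon n d osE ?Li"
  proof (intro equalityI subsetI)
    fix s assume "s \<in> free_act n d ` Ymon n d osE ?Li"
    then obtain l A B where "s = free_act n d (fpm osE A * one_wt n l * fpm ?Li B)" "l \<in> Lambda n d"
      "\<forall>k<n. src osE A k + tgt ?Li B k \<le> l k" unfolding Ymon_def by blast
    then show "s \<in> {free_act n d (fpm osE A * one_wt n l * fpm ?Li (\<lambda>a. B (prod.swap a))) | l A B.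
      l \<in> Lambda n d \<and> (\<forall>k<n. src osE A k + tgt ?Li (\<lambda>a. B (prod.swap a)) k \<le> l k)}"
      by (intro CollectI exI[of _ l] exI[of _ A] exI[of _ "\<lambda>a. B (prod.swap a)"]) simp
  qed (auto simp: Ymon_def)
  finally show ?thesis .
qed

text \<open>With F outside, the smaller index is the source of the negative and the target of the
  positive root vector.\<close>

lemma Y_minus_eq:
  assumes E: "root_ordering n osE" and F: "root_ordering n osF"
  shows "Y_minus n d osE osF = free_act n d ` Ymon n d (map prod.swap osF) osE"
proof -
  let ?Lo = "map prod.swap osF"
  have c: "content min (F_prod osF A @ E_prod osE B) k = src ?Lo (\<lambda>a. A (prod.swap a)) k + tgt osE B k" for A B k
    unfolding content_append E_prod_def F_prod_eq using E F
    by (subst content_src, force simp: root_ordering_def pos_roots_def,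
        subst content_tgt, force simp: root_ordering_def pos_roots_def, simp)
  have g: "fpm ?Lo A * one_wt n l * fpm osE B \<in> C n" for l A B
    using listing_GA[OF listing_plus[OF E]] listing_GA[OF listing_minus[OF F]] GA_one_wt by (intro C_mult GA_C)
  have "Y_minus n d osE osF = {free_act n d (fpm ?Lo (\<lambda>a. A (prod.swap a)) * one_wt n l * fpm osE B) | l A B.
      l \<in> Lambda n d \<and> (\<forall>k<n. src ?Lo (\<lambda>a. A (prod.swap a)) k + tgt osE B k \<le> l k)}"
    unfolding Y_minus_def fp_eval_E fp_eval_F c by (simp add: img_eq[OF g])
  also have "\<dots> = free_act n d ` Ymon n d ?Lo osE"
  proof (intro equalityI subsetI)
    fix s assume "s \<in> free_act n d ` Ymon n d ?Lo osE"
    then obtain l A B where "s = free_act n d (fpm ?Lo A * one_wt n l * fpm osE B)" "l \<in> Lambda n d"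
      "\<forall>k<n. src ?Lo A k + tgt osE B k \<le> l k" unfolding Ymon_def by blast
    then show "s \<in> {free_act n d (fpm ?Lo (\<lambda>a. A (prod.swap a)) * one_wt n l * fpm osE B) | l A B.
      l \<in> Lambda n d \<and> (\<forall>k<n. src ?Lo (\<lambda>a. A (prod.swap a)) k + tgt osE B k \<le> l k)}"
      by (intro CollectI exI[of _ l] exI[of _ "\<lambda>a. A (prod.swap a)"] exI[of _ B]) simp
  qed (auto simp: Ymon_def)
  finally show ?thesis .
qed

theorem theorem2p3:
  fixes n d :: nat and osE osF :: "(nat \<times> nat) list"
  assumes "n \<ge> 1" and "root_ordering n osE" and "root_ordering n osF"
  shows "qSchur_int n d = laurent_subalgebra n d
           ({img n d (divpow (EE i) m) | i m. Suc i < n}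
            \<union> {img n d (divpow (FF i) m) | i m. Suc i < n}
            \<union> {img n d (Kbinom i m) | i m. i < n})
         \<and> laurent_basis n d (Y_plus n d osE osF) (qSchur_int n d)
         \<and> laurent_basis n d (Y_minus n d osE osF) (qSchur_int n d)"
proof -
  note E = listing_plus[OF assms(2)] and F = listing_minus[OF assms(3)]
  have "laurent_basis n d (Y_plus n d osE osF) (qSchur_int n d)"
    unfolding Y_plus_eq[OF assms(2,3)] by (rule laurent_basis_Ymon[OF _ E F]) simp
  moreover have "laurent_basis n d (Y_minus n d osE osF) (qSchur_int n d)"
    unfolding Y_minus_eq[OF assms(2,3)] by (rule laurent_basis_Ymon[OF _ F]) (use E in simp_all)
  ultimately show ?thesis
    unfolding laurent_subalgebra_eq using qSchur_int_GA_LS(2)[OF _ E F] by blast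
qed

end
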